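(* Let $p$ be a prime. For every $n\ge 2$, the number $\mathrm{DBW}_p(pn)$ of generalized de Bruijn words of length $pn$ over $\Sigma_p$ satisfies \[\mathrm{DBW}_p(pn)=\frac{((p-1)!)^n}{p-1}\cdot\frac{\Phi_p(n)}{n}=\frac{((p-1)!)^n}{p-1}\cdot\mathrm{InvNeck}_p(n),\] where $\mathrm{InvNeck}_p(n)$ is the number of invertible necklaces of length $n$ over $\Sigma_p$.
   Context: $\Sigma_p=\{0,\ldots,p-1\}$ with its natural order. A necklace is the set of rotations of a word. The Burrows–Wheeler matrix of a necklace $[w]$ of length $N$ is the $N\times N$ matrix whose rows are the $N$ rotations of $w$ (with multiplicity) in ascending lexicographic order; $\mathrm{BWT}([w])$ is its last column. A generalized de Bruijn word is a necklace of length $pn$ over $\Sigma_p$ whose BWT is a concatenation of words each containing every letter of $\Sigma_p$ exactly once. A necklace of length $n$ over $\Sigma_p$ is invertible if its Burrows–Wheeler matrix is nonsingular over $\mathrm{GF}_p$. $\Phi_p(n)$ is the number of normal elements of $\mathrm{GF}_{p^n}$ over $\mathrm{GF}_p$ (elements $\gamma$ such that $\gamma,\gamma^p,\ldots,\gamma^{p^{n-1}}$ form a basis). *)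

theory Defs
  imports
    "HOL-Library.List_Lexorder"
    "HOL-Algebra.Algebraic_Closure_Type"
    "Jordan_Normal_Form.Determinant"
    "Berlekamp_Zassenhaus.Finite_Field"
begin

section \<open>Necklaces and the Burrows--Wheeler matrix\<close>

definition words :: "nat \<Rightarrow> nat \<Rightarrow> nat list set" where
  "words p N = {w. length w = N \<and> set w \<subseteq> {..<p}}"

definition necklace :: "'a list \<Rightarrow> 'a list set" where
  "necklace w = range (\<lambda>k. rotate k w)"

text \<open>The order on lists is the lexicographic one of \<^theory>\<open>HOL-Library.List_Lexorder\<close>.
  Repeated rotations are kept, so there are always \<open>length w\<close> rows.\<close>

definition bw_rows :: "'a :: linorder list \<Rightarrow> 'a list list" where
  "bw_rows w = sort (map (\<lambda>k. rotate k w) [0..<length w])"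

definition bwt :: "'a :: linorder list \<Rightarrow> 'a list" where
  "bwt w = map last (bw_rows w)"

text \<open>The matrix and the transform depend only on the necklace, so below a property of a
  necklace is stated for an arbitrary representative.\<close>

lemma mset_rotations_rotate1:
  "mset (map (\<lambda>k. rotate k (rotate1 w)) [0..<length w]) = mset (map (\<lambda>k. rotate k w) [0..<length w])"
proof (cases "length w")
  case 0
  then show ?thesis by simp
next
  case (Suc m)
  have "map (\<lambda>k. rotate k (rotate1 w)) [0..<Suc m] = map (\<lambda>k. rotate k w) (map Suc [0..<Suc m])"
    by (simp del: upt_Suc add: rotate1_rotate_swap)
  also have "map Suc [0..<Suc m] = [1..<Suc m] @ [Suc m]"
    by (simp add: map_Suc_upt)
  finally have "mset (map (\<lambda>k. rotate k (rotate1 w)) [0..<Suc m]) =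
      mset (map (\<lambda>k. rotate k w) [1..<Suc m]) + {#rotate (Suc m) w#}"
    by (simp del: upt_Suc)
  also have "rotate (Suc m) w = rotate 0 w"
    using rotate_id[of "Suc m" w] Suc by simp
  also have "mset (map (\<lambda>k. rotate k w) [1..<Suc m]) + {#rotate 0 w#} =
      mset (map (\<lambda>k. rotate k w) [0..<Suc m])"
    by (subst (2) upt_conv_Cons) (simp_all del: upt_Suc)
  finally show ?thesis by (simp only: Suc)
qed

lemma bw_rows_rotate [simp]: "bw_rows (rotate k w) = bw_rows w"
proof (induction k)
  case (Suc k)
  have "bw_rows (rotate1 v) = bw_rows v" for v :: "'a list"
    unfolding bw_rows_def
    by (metis length_rotate1 mset_rotations_rotate1 mset_sort properties_for_sort sorted_sort)
  with Suc show ?case by simp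
qed simp

lemma bw_rows_necklace_cong: "v \<in> necklace w \<Longrightarrow> bw_rows v = bw_rows w"
  by (auto simp: necklace_def)

lemma bwt_necklace_cong: "v \<in> necklace w \<Longrightarrow> bwt v = bwt w"
  by (simp add: bwt_def bw_rows_necklace_cong)

section \<open>Generalized de Bruijn words\<close>

definition alphabet_perm :: "nat \<Rightarrow> nat list \<Rightarrow> bool" where
  "alphabet_perm p u \<longleftrightarrow> distinct u \<and> set u = {..<p}"

definition gen_de_Bruijn_words :: "nat \<Rightarrow> nat \<Rightarrow> nat list set set" where
  "gen_de_Bruijn_words p N =
    {necklace w | w. w \<in> words p N \<and> (\<exists>us. (\<forall>u\<in>set us. alphabet_perm p u) \<and> bwt w = concat us)}"

definition DBW :: "nat \<Rightarrow> nat \<Rightarrow> nat" where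
  "DBW p N = card (gen_de_Bruijn_words p N)"

section \<open>Invertible necklaces\<close>

text \<open>The field with \<open>p\<close> elements is \<^typ>\<open>'p mod_ring\<close> where \<open>p = CARD('p)\<close>;
  the type class \<^class>\<open>prime_card\<close> says that \<open>p\<close> is prime.\<close>

definition bw_matrix :: "nat list \<Rightarrow> 'p :: prime_card mod_ring mat" where
  "bw_matrix w = mat_of_rows_list (length w) (map (map of_nat) (bw_rows w))"

definition invertible_necklaces :: "'p :: prime_card itself \<Rightarrow> nat \<Rightarrow> nat list set set" where
  "invertible_necklaces _ n =
    {necklace w | w. w \<in> words CARD('p) n \<and> invertible_mat (bw_matrix w :: 'p mod_ring mat)}"

definition InvNeck :: "'p :: prime_card itself \<Rightarrow> nat \<Rightarrow> nat" where
  "InvNeck TYPE('p) n = card (invertible_necklaces TYPE('p) n)"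

section \<open>Normal elements\<close>

text \<open>The field with \<open>p ^ n\<close> elements is realised inside the algebraic closure of the field
  with \<open>p\<close> elements, as the set of roots of \<open>X ^ (p ^ n) - X\<close>.\<close>

definition GF_ext :: "nat \<Rightarrow> 'p :: prime_card mod_ring alg_closure set" where
  "GF_ext n = {x. x ^ (CARD('p) ^ n) = x}"

lemma CHAR_alg_closure_mod_ring: "CHAR('p :: prime_card mod_ring alg_closure) = CARD('p)"
  by simp

lemma card_GF_ext:
  assumes "n > 0"
  shows "card (GF_ext n :: 'p :: prime_card mod_ring alg_closure set) = CARD('p) ^ n"
proof -
  define q where "q = CARD('p) ^ n"
  have q: "q > 1"
    unfolding q_def by (rule one_less_power[OF nontriv assms])
  have q0: "of_nat q = (0 :: 'p mod_ring alg_closure)"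
    unfolding of_nat_eq_0_iff_char_dvd CHAR_alg_closure_mod_ring using assms by (simp add: q_def)
  define f :: "'p mod_ring alg_closure poly" where "f = monom 1 q - [:0, 1:]"
  have deg: "degree f = q"
    unfolding f_def diff_conv_add_uminus
    by (subst degree_add_eq_left) (use q in \<open>simp_all add: degree_monom_eq\<close>)
  then have f0: "f \<noteq> 0"
    using q by auto
  have roots: "poly f x = 0 \<longleftrightarrow> x \<in> GF_ext n" for x
    by (simp add: f_def GF_ext_def q_def poly_monom)
  have deriv: "pderiv f = -1"
    by (simp add: f_def pderiv_diff pderiv_monom pderiv_pCons q0 one_pCons)
  have le1: "order x f \<le> 1" for x
  proof (rule ccontr)
    assume "\<not> order x f \<le> 1"
    then have "[:-x, 1:] ^ 2 dvd f"
      using f0 by (simp add: order_divides)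
    then obtain g where "f = [:-x, 1:] ^ 2 * g"
      by (elim dvdE)
    then have "f = [:-x, 1:] * ([:-x, 1:] * g)"
      by (simp only: power2_eq_square mult.assoc)
    then have "poly (pderiv f) x = 0"
      by (simp only: pderiv_mult poly_add poly_mult) simp
    then show False
      by (simp add: deriv)
  qed
  have mult: "order x f = (if x \<in> GF_ext n then 1 else 0)" for x
    using f0 roots[of x] order_root[of f x] le1[of x] by auto
  obtain A where A: "size A = degree f" "f = smult (lead_coeff f) (\<Prod>x\<in>#A. [:-x, 1:])"
    using alg_closed_imp_factorization[OF f0] by metis
  have lin: "proots (\<Prod>x\<in>#B. [:-x, 1:]) = B" for B :: "'p mod_ring alg_closure multiset"
  proof (induction B)
    case (add x B)
    have "(\<Prod>x\<in>#B. [:-x, 1:]) \<noteq> 0"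
      by (auto simp: prod_mset_zero_iff)
    then have "proots ([:-x, 1:] * (\<Prod>x\<in>#B. [:-x, 1:])) = {#x#} + B"
      by (subst proots_mult) (simp_all add: add.IH)
    then show ?case by simp
  qed simp
  have "proots f = A"
    by (subst A(2)) (use f0 in \<open>simp add: lin\<close>)
  then have size: "size (proots f) = q"
    using A(1) deg by simp
  have set: "set_mset (proots f) = GF_ext n"
    using f0 roots by simp
  have "size (proots f) = (\<Sum>x\<in>set_mset (proots f). 1)"
    unfolding size_multiset_overloaded_eq
    by (rule sum.cong) (use f0 mult set in auto)
  then show ?thesis
    using size set q_def by simp
qed

definition GF_scale ::
    "'p :: prime_card mod_ring \<Rightarrow> 'p mod_ring alg_closure \<Rightarrow> 'p mod_ring alg_closure" where
  "GF_scale a x = to_ac a * x"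

interpretation GF: Vector_Spaces.vector_space GF_scale
  by unfold_locales (simp_all add: GF_scale_def algebra_simps)

definition normal_elements :: "nat \<Rightarrow> 'p :: prime_card mod_ring alg_closure set" where
  "normal_elements n = {\<gamma> \<in> GF_ext n.
     let conj = (\<lambda>i. \<gamma> ^ (CARD('p) ^ i)) in
       inj_on conj {..<n} \<and> GF.independent (conj ` {..<n}) \<and> GF.span (conj ` {..<n}) = GF_ext n}"

definition num_normal :: "'p :: prime_card itself \<Rightarrow> nat \<Rightarrow> nat" where
  "num_normal TYPE('p) n = card (normal_elements n :: 'p mod_ring alg_closure set)"

end

theory Submission
  imports Defs "HOL-Combinatorics.Cycles"
begin

text \<open>
  By the Burrows--Wheeler transform, generalized de Bruijn words of length \<open>pn\<close> correspond to the
  families of \<open>n\<close> permutations of the alphabet whose standard permutation \<open>\<pi>\<close> is a single cycle.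
  A permutation is a single cycle iff the principal minor of \<open>1 - P\<^sub>\<pi>\<close> omitting one index is \<open>1\<close>, and
  otherwise this minor is \<open>0\<close>. Averaging the minor over all families replaces every block by its mean,
  because terms using two rows of one block cancel by antisymmetry; the mean has low rank, and what
  remains is the \<open>n \<times> n\<close> adjacency matrix of the generalized de Bruijn graph, which is intertwined
  with the matrix \<open>F\<close> of \<open>x\<^sup>i \<mapsto> x\<^bsup>pi\<^esup>\<close> on \<open>\<int>[x] / (x\<^sup>n - 1)\<close> by multiplication with \<open>1 - x\<close>. So the
  count is a multiple of \<open>det (p - F)\<close>.

  On the other side, \<open>det (p - F)\<close> expands as a sum over the sets of exponents that \<open>i \<mapsto> pi\<close> maps onto
  themselves. Read in the algebraic closure of the prime field, this is the inclusion--exclusion formula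
  for the polynomials of degree less than \<open>n\<close> without a zero among the \<open>n\<close>-th roots of unity, i.e. for
  the units modulo \<open>x\<^sup>n - 1\<close>. These are the words with invertible Burrows--Wheeler matrix, and they are
  as many as the normal elements since \<open>GF(p\<^sup>n)\<close> with the Frobenius map and the polynomials modulo
  \<open>x\<^sup>n - 1\<close> have equally many elements with any given annihilator.
\<close>

section \<open>Determinants of index functions\<close>

text \<open>A determinant is the right carrier for the average because its antisymmetry removes the
  dependence between the rows of one random permutation; the mean of the block matrices alone would
  not determine the count otherwise. Two degeneracies shape the rest. The averaged matrix
  \<open>1 - A/p\<close> has zero row and column sums, so it is singular, and multiplication by
  \<open>1 - x\<close> is not invertible modulo \<open>x^n - 1\<close> either. Both are repaired by
  rank one terms, and any such term gives the same number up to the coefficient sums of its two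
  factors; the factors \<open>n\<close> and \<open>p - 1\<close> of the formula come from these
  repairs. Secondly, \<open>x^n - 1\<close> has repeated zeros when \<open>p\<close> divides
  \<open>n\<close>, so exponents below \<open>n\<close> name roots of unity with repetition. Only
  exponent sets mapped onto themselves contribute, however, and their elements are all divisible by
  the full power of \<open>p\<close> in \<open>n\<close>, which makes the named roots distinct. The
  comparison of annihilators runs through an inequality summed over all annihilators, so it needs no
  normal element to start from.\<close>

lemma sum_of_bool_select:
  fixes i n :: nat
  shows
  "i < n \<Longrightarrow> (\<Sum>j<n. of_bool (j = i) * g j) = (g i :: 'a :: semiring_1)"
  "i < n \<Longrightarrow> (\<Sum>j<n. of_bool (i = j) * g j) = (g i :: 'a :: semiring_1)"
  "i < n \<Longrightarrow> (\<Sum>j<n. g j * of_bool (j = i)) = (g i :: 'a :: semiring_1)"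
  "i < n \<Longrightarrow> (\<Sum>j<n. g j * of_bool (i = j)) = (g i :: 'a :: semiring_1)"
proof -
  have "(\<Sum>j<n. if j = i then g j else 0) = g i" if "i < n"
    using that by simp
  then show "i < n \<Longrightarrow> (\<Sum>j<n. of_bool (j = i) * g j) = g i"
    "i < n \<Longrightarrow> (\<Sum>j<n. of_bool (i = j) * g j) = g i"
    "i < n \<Longrightarrow> (\<Sum>j<n. g j * of_bool (j = i)) = g i"
    "i < n \<Longrightarrow> (\<Sum>j<n. g j * of_bool (i = j)) = g i"
    by (auto simp: if_distrib cong: if_cong sum.cong)
qed

text \<open>Entries are a function of two indices, so that matrices built from indicators of index
  equations can be rewritten entrywise, free of carrier and dimension conditions.\<close>

definition fdet :: "nat \<Rightarrow> (nat \<Rightarrow> nat \<Rightarrow> 'a :: comm_ring_1) \<Rightarrow> 'a" where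
  "fdet n f = det (mat n n (\<lambda>(i, j). f i j))"

lemma fdet_leibniz:
  "fdet n f = (\<Sum>\<tau> | \<tau> permutes {..<n}. signof \<tau> * (\<Prod>i<n. f i (\<tau> i)))"
proof -
  have "fdet n f = (\<Sum>\<tau> | \<tau> permutes {0..<n}. signof \<tau> * (\<Prod>i = 0..<n. mat n n (\<lambda>(i, j). f i j) $$ (i, \<tau> i)))"
    unfolding fdet_def by (rule det_def') simp
  also have "\<dots> = (\<Sum>\<tau> | \<tau> permutes {..<n}. signof \<tau> * (\<Prod>i<n. f i (\<tau> i)))"
    by (intro sum.cong refl arg_cong2[of _ _ _ _ "(*)"] prod.cong)
       (auto simp: atLeast0LessThan dest: permutes_in_image[THEN iffD2, of _ "{..<n}"])
  finally show ?thesis .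
qed

lemma fdet_cong:
  assumes "\<And>i j. i < n \<Longrightarrow> j < n \<Longrightarrow> f i j = g i j"
  shows "fdet n f = fdet n g"
  unfolding fdet_def using assms by (intro arg_cong[of _ _ det] eq_matI) auto

lemma fdet_mult: "fdet n f * fdet n g = fdet n (\<lambda>i j. \<Sum>k<n. f i k * g k j)"
proof -
  have "mat n n (\<lambda>(i, j). \<Sum>k<n. f i k * g k j) = mat n n (\<lambda>(i, j). f i j) * mat n n (\<lambda>(i, j). g i j)"
    by (intro eq_matI) (auto simp: scalar_prod_def atLeast0LessThan)
  then show ?thesis
    unfolding fdet_def by (simp add: det_mult[of _ n])
qed

lemma fdet_scale: "fdet n (\<lambda>i j. c * f i j) = c ^ n * fdet n f"
  by (simp add: fdet_leibniz prod.distrib sum_distrib_left mult_ac)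

lemma fdet_eq_0_iff:
  fixes f :: "nat \<Rightarrow> nat \<Rightarrow> 'a :: idom"
  shows "fdet n f = 0 \<longleftrightarrow> (\<exists>v. (\<exists>j<n. v j \<noteq> 0) \<and> (\<forall>i<n. (\<Sum>j<n. f i j * v j) = 0))"
proof -
  have "fdet n f = 0 \<longleftrightarrow>
    (\<exists>v. v \<in> carrier_vec n \<and> v \<noteq> 0\<^sub>v n \<and> mat n n (\<lambda>(i, j). f i j) *\<^sub>v v = 0\<^sub>v n)"
    unfolding fdet_def by (rule det_0_iff_vec_prod_zero) simp
  also have "\<dots> \<longleftrightarrow> (\<exists>v. (\<exists>j<n. v j \<noteq> 0) \<and> (\<forall>i<n. (\<Sum>j<n. f i j * v j) = 0))"
  proof safe
    fix v :: "'a vec" assume v: "v \<in> carrier_vec n" "v \<noteq> 0\<^sub>v n"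
      "mat n n (\<lambda>(i, j). f i j) *\<^sub>v v = 0\<^sub>v n"
    have "\<exists>j<n. v $ j \<noteq> 0"
      using v(1,2) by (metis carrier_vecD eq_vecI index_zero_vec)
    moreover have "(\<Sum>j<n. f i j * v $ j) = 0" if "i < n" for i
    proof -
      have "(mat n n (\<lambda>(i, j). f i j) *\<^sub>v v) $ i = 0"
        using v(3) that by simp
      then show ?thesis
        using that v(1) by (simp add: scalar_prod_def atLeast0LessThan)
    qed
    ultimately show "\<exists>v. (\<exists>j<n. v j \<noteq> 0) \<and> (\<forall>i<n. (\<Sum>j<n. f i j * v j) = 0)"
      by blast
  next
    fix v j assume v: "j < n" "v j \<noteq> 0" "\<forall>i<n. (\<Sum>j<n. f i j * v j) = 0"
    have "mat n n (\<lambda>(i, j). f i j) *\<^sub>v vec n v = 0\<^sub>v n"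
      using v(3) by (intro eq_vecI) (auto simp: scalar_prod_def atLeast0LessThan)
    moreover have "vec n v \<noteq> 0\<^sub>v n"
      using v(1,2) by (metis index_vec index_zero_vec(1))
    ultimately show "\<exists>v. v \<in> carrier_vec n \<and> v \<noteq> 0\<^sub>v n \<and> mat n n (\<lambda>(i, j). f i j) *\<^sub>v v = 0\<^sub>v n"
      by (intro exI[of _ "vec n v"]) auto
  qed
  finally show ?thesis .
qed

lemma fdet_identical_rows:
  assumes "a < n" "b < n" "a \<noteq> b" "\<And>j. j < n \<Longrightarrow> f a j = f b j"
  shows "fdet n f = 0"
  unfolding fdet_def
  by (rule det_identical_rows[of _ n a b]) (use assms in \<open>auto intro!: eq_vecI\<close>)

lemma fdet_id: "fdet n (\<lambda>i j. of_bool (j = i)) = 1"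
proof -
  have "mat n n (\<lambda>(i, j). of_bool (j = i) :: 'a) = 1\<^sub>m n"
    by (intro eq_matI) auto
  then show ?thesis
    by (simp add: fdet_def)
qed

text \<open>Take the block matrix with identity diagonal blocks and off-diagonal blocks
  \<open>A\<close>, \<open>B\<close>. Eliminating either off-diagonal block leaves one of the two
  Schur complements, and the eliminations have determinant 1. This later trades size
  \<open>n * p\<close> for size \<open>n\<close>.\<close>

lemma fdet_sylvester:
  fixes R Q :: "nat \<Rightarrow> nat \<Rightarrow> 'a :: idom"
  shows "fdet m (\<lambda>i j. of_bool (j = i) - (\<Sum>k<n. R i k * Q k j)) =
         fdet n (\<lambda>k l. of_bool (l = k) - (\<Sum>i<m. Q k i * R i l))"
proof -
  define A where "A = mat m n (\<lambda>(i, k). R i k)"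
  define B where "B = mat n m (\<lambda>(k, j). Q k j)"
  have [simp]: "A \<in> carrier_mat m n" "B \<in> carrier_mat n m"
      "dim_row A = m" "dim_col A = n" "dim_row B = n" "dim_col B = m"
    by (simp_all add: A_def B_def)
  let ?M = "four_block_mat (1\<^sub>m m) A B (1\<^sub>m n)"
  let ?L = "four_block_mat (1\<^sub>m m) (- A) (0\<^sub>m n m) (1\<^sub>m n)"
  let ?R = "four_block_mat (1\<^sub>m m) (0\<^sub>m m n) (- B) (1\<^sub>m n)"
  have [simp]: "?M \<in> carrier_mat (m + n) (m + n)" "?L \<in> carrier_mat (m + n) (m + n)"
      "?R \<in> carrier_mat (m + n) (m + n)"
    by simp_all
  have L: "?L * ?M = four_block_mat (1\<^sub>m m - A * B) (0\<^sub>m m n) B (1\<^sub>m n)"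
    by (subst mult_four_block_mat[of _ m m _ n _ n _ _ m _ n])
       (auto simp: minus_add_uminus_mat[of _ m m] intro!: cong_four_block_mat)
  have R: "?R * ?M = four_block_mat (1\<^sub>m m) A (0\<^sub>m n m) (1\<^sub>m n - B * A)"
    by (subst mult_four_block_mat[of _ m m _ n _ n _ _ m _ n])
       (auto simp: minus_add_uminus_mat[of _ n n] intro!: cong_four_block_mat)
  have "det (1\<^sub>m m - A * B) = det (?L * ?M)"
    unfolding L by (subst det_four_block_mat_upper_right_zero) auto
  also have "\<dots> = det ?M"
    by (subst det_mult[of _ "m + n"]) (auto simp: det_four_block_mat_lower_left_zero[of _ m _ n])
  also have "\<dots> = det (?R * ?M)"
    by (subst det_mult[of _ "m + n"]) (auto simp: det_four_block_mat_upper_right_zero[of _ m _ n])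
  also have "\<dots> = det (1\<^sub>m n - B * A)"
    unfolding R by (subst det_four_block_mat_lower_left_zero) auto
  finally have *: "det (1\<^sub>m m - A * B) = det (1\<^sub>m n - B * A)" .
  have "mat m m (\<lambda>(i, j). of_bool (j = i) - (\<Sum>k<n. R i k * Q k j)) = 1\<^sub>m m - A * B"
    by (intro eq_matI) (auto simp: A_def B_def scalar_prod_def atLeast0LessThan)
  moreover have "mat n n (\<lambda>(k, l). of_bool (l = k) - (\<Sum>i<m. Q k i * R i l)) = 1\<^sub>m n - B * A"
    by (intro eq_matI) (auto simp: A_def B_def scalar_prod_def atLeast0LessThan)
  ultimately show ?thesis
    unfolding fdet_def using * by simp
qed

lemma fdet_transpose: "fdet n (\<lambda>i j. f j i) = fdet n f"
proof -
  have "mat n n (\<lambda>(i, j). f j i) = (mat n n (\<lambda>(i, j). f i j))\<^sup>T"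
    by (intro eq_matI) auto
  then show ?thesis
    unfolding fdet_def by (simp add: det_transpose[of _ n])
qed

text \<open>Multilinearity: \<open>S\<close> collects the rows that pick the second summand.\<close>

lemma fdet_row_expand:
  "fdet n (\<lambda>i j. x i * a i j + y i * b i j) =
   (\<Sum>S\<in>Pow {..<n}. (\<Prod>i\<in>S. y i) * (\<Prod>i\<in>{..<n}-S. x i) * fdet n (\<lambda>i j. if i \<in> S then b i j else a i j))"
proof -
  have *: "(\<Prod>i<n. x i * a i (\<tau> i) + y i * b i (\<tau> i)) =
        (\<Sum>S\<in>Pow {..<n}. (\<Prod>i\<in>S. y i) * (\<Prod>i\<in>{..<n}-S. x i) *
           (\<Prod>i<n. if i \<in> S then b i (\<tau> i) else a i (\<tau> i)))" for \<tau>
  proof -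
    have "(\<Prod>i<n. x i * a i (\<tau> i) + y i * b i (\<tau> i)) = (\<Prod>i<n. y i * b i (\<tau> i) + x i * a i (\<tau> i))"
      by (simp add: add.commute)
    also have "\<dots> = (\<Sum>S\<in>Pow {..<n}. (\<Prod>i\<in>S. y i * b i (\<tau> i)) * (\<Prod>i\<in>{..<n}-S. x i * a i (\<tau> i)))"
      by (rule prod_add) simp
    also have "\<dots> = (\<Sum>S\<in>Pow {..<n}. (\<Prod>i\<in>S. y i) * (\<Prod>i\<in>{..<n}-S. x i) *
           (\<Prod>i<n. if i \<in> S then b i (\<tau> i) else a i (\<tau> i)))"
    proof (rule sum.cong[OF refl])
      fix S assume S: "S \<in> Pow {..<n}"
      then have "(\<Prod>i<n. if i \<in> S then b i (\<tau> i) else a i (\<tau> i)) =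
          (\<Prod>i\<in>S. b i (\<tau> i)) * (\<Prod>i\<in>{..<n}-S. a i (\<tau> i))"
        by (subst prod.If_cases) (auto simp: Int_absorb1 Diff_eq)
      then show "(\<Prod>i\<in>S. y i * b i (\<tau> i)) * (\<Prod>i\<in>{..<n}-S. x i * a i (\<tau> i)) =
          (\<Prod>i\<in>S. y i) * (\<Prod>i\<in>{..<n}-S. x i) * (\<Prod>i<n. if i \<in> S then b i (\<tau> i) else a i (\<tau> i))"
        by (simp add: prod.distrib mult_ac)
    qed
    finally show ?thesis .
  qed
  show ?thesis
    unfolding fdet_leibniz * sum_distrib_left
    by (subst sum.swap) (simp add: mult_ac)
qed

text \<open>Expanding along the unit rows outside \<open>S\<close> leaves the matrix of
  \<open>f\<close> on \<open>S\<close>: the value is the sign of \<open>f\<close> on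
  \<open>S\<close> if \<open>f\<close> permutes \<open>S\<close>, and 0 if \<open>f\<close> maps
  \<open>S\<close> into the index range but not onto \<open>S\<close>.\<close>

definition functional_minor :: "nat \<Rightarrow> (nat \<Rightarrow> nat) \<Rightarrow> nat set \<Rightarrow> 'a :: comm_ring_1" where
  "functional_minor n f S = fdet n (\<lambda>i j. if i \<in> S then of_bool (j = f i) else of_bool (j = i))"

lemma functional_minor_empty [simp]: "functional_minor n f {} = 1"
  by (simp add: functional_minor_def fdet_id)

text \<open>Two rows coincide. Either \<open>f\<close> identifies two elements of \<open>S\<close>,
  or it sends some element to an index outside \<open>S\<close>, whose unit row is then
  repeated.\<close>

lemma functional_minor_eq_0:
  assumes "S \<subseteq> {..<n}" "f ` S \<subseteq> {..<n}" "f ` S \<noteq> S"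
  shows "functional_minor n f S = 0"
proof (cases "f ` S \<subseteq> S")
  case True
  have "finite S"
    using assms(1) finite_subset by blast
  then have "\<not> inj_on f S"
    using True assms(3) endo_inj_surj by blast
  then obtain a b where "a \<in> S" "b \<in> S" "a \<noteq> b" "f a = f b"
    by (auto simp: inj_on_def)
  then show ?thesis
    unfolding functional_minor_def using assms by (intro fdet_identical_rows[of a n b]) auto
next
  case False
  then obtain a where "a \<in> S" "f a \<notin> S"
    by blast
  then show ?thesis
    unfolding functional_minor_def using assms by (intro fdet_identical_rows[of a n "f a"]) auto
qed

lemma fdet_functional_expand:
  "fdet n (\<lambda>i j. x i * of_bool (j = i) + y i * of_bool (j = f i)) =
   (\<Sum>S\<in>Pow {..<n}. (\<Prod>i\<in>S. y i) * (\<Prod>i\<in>{..<n}-S. x i) * functional_minor n f S)"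
  unfolding functional_minor_def by (rule fdet_row_expand)

lemma fdet_functional_expand_subset:
  assumes "Y \<subseteq> {..<n}"
  shows "fdet n (\<lambda>i j. of_bool (j = i) - of_bool (i \<in> Y \<and> j = f i)) =
    (\<Sum>S\<in>Pow Y. (-1) ^ card S * functional_minor n f S)"
proof -
  have "fdet n (\<lambda>i j. of_bool (j = i) - of_bool (i \<in> Y \<and> j = f i)) =
      fdet n (\<lambda>i j. 1 * of_bool (j = i) + (if i \<in> Y then -1 else 0) * of_bool (j = f i) :: 'a)"
    by (rule fdet_cong) auto
  also have "\<dots> = (\<Sum>S\<in>Pow {..<n}. (\<Prod>i\<in>S. if i \<in> Y then -1 else 0) * functional_minor n f S)"
    by (subst fdet_functional_expand) simp
  also have "\<dots> = (\<Sum>S\<in>Pow Y. (\<Prod>i\<in>S. if i \<in> Y then -1 else 0) * functional_minor n f S)"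
  proof (rule sum.mono_neutral_right)
    show "\<forall>S\<in>Pow {..<n} - Pow Y. (\<Prod>i\<in>S. if i \<in> Y then -1 else 0) * functional_minor n f S = (0::'a)"
    proof
      fix S assume S: "S \<in> Pow {..<n} - Pow Y"
      then obtain i where "i \<in> S" "i \<notin> Y" by blast
      moreover have "finite S"
        using S finite_subset by blast
      ultimately have "(\<Prod>i\<in>S. if i \<in> Y then -1 else 0) = (0::'a)"
        by (intro prod_zero) auto
      then show "(\<Prod>i\<in>S. if i \<in> Y then -1 else 0) * functional_minor n f S = (0::'a)"
        by simp
    qed
  qed (use assms in auto)
  also have "\<dots> = (\<Sum>S\<in>Pow Y. (-1) ^ card S * functional_minor n f S)"
  proof (rule sum.cong[OF refl])
    fix S assume "S \<in> Pow Y"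
    then have "(\<Prod>i\<in>S. if i \<in> Y then -1 else 0) = (\<Prod>i\<in>S. -1 :: 'a)"
      by (intro prod.cong) auto
    then show "(\<Prod>i\<in>S. if i \<in> Y then -1 else 0) * functional_minor n f S = (-1) ^ card S * (functional_minor n f S :: 'a)"
      by simp
  qed
  finally show ?thesis .
qed

text \<open>The sum is a determinant with the indicator vector of \<open>Y\<close> in its kernel, so \<open>functional_minor\<close> acts
  as a Moebius function for the unions of cycles of \<open>f\<close>.\<close>

lemma sum_functional_minor_closed:
  assumes "Y \<subseteq> {..<n}" "f ` Y \<subseteq> Y"
  shows "(\<Sum>S\<in>Pow Y. (-1) ^ card S * functional_minor n f S) = (of_bool (Y = {}) :: 'a :: idom)"
proof (cases "Y = {}")
  case False
  then obtain y where y: "y \<in> Y" by blast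
  have "fdet n (\<lambda>i j. of_bool (j = i) - of_bool (i \<in> Y \<and> j = f i)) = (0 :: 'a)"
    unfolding fdet_eq_0_iff
  proof (intro exI[of _ "\<lambda>j. of_bool (j \<in> Y)"] conjI allI impI)
    show "\<exists>j<n. of_bool (j \<in> Y) \<noteq> (0 :: 'a)"
      using y assms by (intro exI[of _ y]) auto
    fix i assume i: "i < n"
    have 1: "(\<Sum>j<n. of_bool (j = i) * of_bool (j \<in> Y)) = (of_bool (i \<in> Y) :: 'a)"
      using i by (rule sum_of_bool_select)
    have 2: "(\<Sum>j<n. of_bool (i \<in> Y \<and> j = f i) * of_bool (j \<in> Y)) = (of_bool (i \<in> Y) :: 'a)"
    proof (cases "i \<in> Y")
      case True
      then have "f i \<in> Y" "f i < n"
        using assms by auto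
      then show ?thesis
        using True by (simp add: sum_of_bool_select)
    qed simp
    show "(\<Sum>j<n. (of_bool (j = i) - of_bool (i \<in> Y \<and> j = f i)) * of_bool (j \<in> Y)) = (0 :: 'a)"
      by (simp only: left_diff_distrib sum_subtractf 1 2 diff_self)
  qed
  then show ?thesis
    using False by (subst fdet_functional_expand_subset[symmetric]) (use assms in auto)
qed auto

text \<open>Row 0 lacks its \<open>\<pi>\<close> term, so the expansion runs over sets avoiding 0,
  and only those mapped onto themselves count. For a single cycle this leaves the empty set;
  otherwise the indicator of the points outside the orbit of 0 is a kernel vector.\<close>

lemma fdet_reduced_permutation:
  assumes "\<pi> permutes {..<n}" "n > 0"
  shows "fdet n (\<lambda>i j. of_bool (j = i) - of_bool (i \<noteq> 0 \<and> j = \<pi> i)) =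
         (of_bool (\<forall>i<n. \<exists>k. (\<pi> ^^ k) 0 = i) :: 'a :: idom)"
proof -
  define Y where "Y = {1..<n}"
  have "fdet n (\<lambda>i j. of_bool (j = i) - of_bool (i \<noteq> 0 \<and> j = \<pi> i)) =
        fdet n (\<lambda>i j. of_bool (j = i) - of_bool (i \<in> Y \<and> j = \<pi> i) :: 'a)"
    by (rule fdet_cong) (auto simp: Y_def)
  also have "\<dots> = (\<Sum>S\<in>Pow Y. (-1) ^ card S * functional_minor n \<pi> S)"
    by (rule fdet_functional_expand_subset) (auto simp: Y_def)
  also have "\<dots> = of_bool (\<forall>i<n. \<exists>k. (\<pi> ^^ k) 0 = i)"
  proof (cases "\<forall>i<n. \<exists>k. (\<pi> ^^ k) 0 = i")
    case True
    have "(-1) ^ card S * functional_minor n \<pi> S = (0 :: 'a)" if "S \<in> Pow Y - {{}}" for S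
    proof -
      obtain s where s: "s \<in> S" and S: "S \<subseteq> Y" using \<open>S \<in> Pow Y - {{}}\<close> by blast
      have "\<pi> ` S \<noteq> S"
      proof
        assume stable: "\<pi> ` S = S"
        \<comment> \<open>As \<open>\<pi>\<close> is injective and maps \<open>S\<close> onto
          itself, an orbit point in \<open>S\<close> can be traced back to 0 inside
          \<open>S\<close>.\<close>
        have "0 \<in> S" if "(\<pi> ^^ k) 0 \<in> S" for k
          using that
        proof (induction k)
          case (Suc k)
          then have "\<pi> ((\<pi> ^^ k) 0) \<in> \<pi> ` S"
            using stable by simp
          then show ?case
            using Suc.IH permutes_inj[OF assms(1)] by (simp add: inj_image_mem_iff)
        qed simp
        moreover have "s < n"
          using s S by (auto simp: Y_def)
        ultimately have "0 \<in> S"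
          using True s by metis
        then show False
          using S by (auto simp: Y_def)
      qed
      moreover have "S \<subseteq> {..<n}" "\<pi> ` S \<subseteq> {..<n}"
        using S permutes_in_image[OF assms(1)] by (auto simp: Y_def)
      ultimately show ?thesis
        by (simp add: functional_minor_eq_0)
    qed
    then have "(\<Sum>S\<in>Pow Y. (-1) ^ card S * functional_minor n \<pi> S) =
       (\<Sum>S\<in>{{}}. (-1) ^ card S * (functional_minor n \<pi> S :: 'a))"
      by (intro sum.mono_neutral_right) (auto simp: Y_def)
    then show ?thesis
      using True by simp
  next
    case False
    define U where "U = {i. i < n \<and> (\<forall>k. (\<pi> ^^ k) 0 \<noteq> i)}"
    have "0 \<notin> U"
      unfolding U_def by (auto intro!: exI[of _ 0])
    have reach: "\<exists>k. (\<pi> ^^ k) 0 = i" if "\<pi> i = (\<pi> ^^ k) 0" for i k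
    proof (cases k)
      case (Suc l)
      then show ?thesis
        using that permutes_inj[OF assms(1)] by (auto dest: injD)
    next
      case 0
      \<comment> \<open>The predecessor of 0 is reached from 0 as the last point of a full
        period.\<close>
      have "permutation \<pi>"
        using assms(1) permutation_permutes by blast
      then obtain m where m: "\<pi> ^^ m = id" "m > 0"
        using permutation_is_nilpotent by blast
      have "(\<pi> ^^ (m - 1)) 0 = (\<pi> ^^ (m - 1)) (\<pi> i)"
        using that 0 by simp
      also have "\<dots> = (\<pi> ^^ m) i"
        using m(2) by (cases m) (simp_all add: funpow_swap1)
      finally show ?thesis
        using m(1) by auto
    qed
    have U: "\<pi> ` U \<subseteq> U"
    proof
      fix j assume "j \<in> \<pi> ` U"
      then obtain i where i: "i \<in> U" "j = \<pi> i" by blast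
      have "j < n"
        using i permutes_in_image[OF assms(1), of i] by (auto simp: U_def)
      moreover have "(\<pi> ^^ k) 0 \<noteq> j" for k
      proof
        assume "(\<pi> ^^ k) 0 = j"
        then have "\<exists>k. (\<pi> ^^ k) 0 = i"
          using i(2) by (intro reach[of i k]) simp
        then show False
          using i(1) by (auto simp: U_def)
      qed
      ultimately show "j \<in> U"
        by (auto simp: U_def)
    qed
    obtain u where u: "u \<in> U"
      using False by (auto simp: U_def)
    have "fdet n (\<lambda>i j. of_bool (j = i) - of_bool (i \<in> Y \<and> j = \<pi> i)) = (0 :: 'a)"
      unfolding fdet_eq_0_iff
    proof (intro exI[of _ "\<lambda>j. of_bool (j \<in> U)"] conjI allI impI)
      show "\<exists>j<n. of_bool (j \<in> U) \<noteq> (0 :: 'a)"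
        using u by (intro exI[of _ u]) (auto simp: U_def)
      fix i assume i: "i < n"
      have "\<pi> i \<in> U \<longleftrightarrow> i \<in> U"
      proof
        assume "\<pi> i \<in> U"
        then have "(\<pi> ^^ Suc k) 0 \<noteq> \<pi> i" for k
          unfolding U_def by blast
        then show "i \<in> U"
          using i by (auto simp: U_def)
      qed (use U in blast)
      moreover have "\<pi> i < n"
        using i permutes_in_image[OF assms(1), of i] by auto
      moreover have "i \<in> Y" if "i \<in> U"
        using that \<open>0 \<notin> U\<close> i by (cases "i = 0") (auto simp: Y_def)
      ultimately show "(\<Sum>j<n. (of_bool (j = i) - of_bool (i \<in> Y \<and> j = \<pi> i)) * of_bool (j \<in> U)) = (0 :: 'a)"
        using i by (cases "i \<in> Y") (auto simp: left_diff_distrib sum_subtractf sum_of_bool_select)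
    qed
    then show ?thesis
      using False by (subst fdet_functional_expand_subset[symmetric]) (auto simp: Y_def)
  qed
  finally show ?thesis .
qed

section \<open>Averaging over block permutations\<close>

text \<open>\<open>M\<close> kills the all-ones vector \<open>1\<close> on both sides, so right
  multiplication by \<open>I - 1 w^T\<close> does not change \<open>M\<close>, while for a suitable
  \<open>w\<close> it turns an update along the unit vector at 0 into one along \<open>v\<close>.
  Transposition does the same for \<open>u\<close>.\<close>

lemma fdet_rank_one_update:
  fixes M :: "nat \<Rightarrow> nat \<Rightarrow> 'a :: idom"
  assumes "n > 0"
    and rows: "\<And>i. i < n \<Longrightarrow> (\<Sum>j<n. M i j) = 0"
    and cols: "\<And>j. j < n \<Longrightarrow> (\<Sum>i<n. M i j) = 0"
  shows "fdet n (\<lambda>i j. M i j + u i * v j) =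
    (\<Sum>i<n. u i) * (\<Sum>j<n. v j) * fdet n (\<lambda>i j. M i j + of_bool (i = 0) * of_bool (j = 0))"
proof -
  have right: "fdet n (\<lambda>i j. L i j + a i * b j) = (\<Sum>j<n. b j) * fdet n (\<lambda>i j. L i j + a i * of_bool (j = 0))"
    if L: "\<And>i. i < n \<Longrightarrow> (\<Sum>j<n. L i j) = 0" for L :: "nat \<Rightarrow> nat \<Rightarrow> 'a" and a b
  proof -
    \<comment> \<open>This is \<open>I - 1 (e_0 - b)^T\<close>, written as a sum over one index so
      that \<open>fdet_sylvester\<close> reduces its determinant to size 1.\<close>
    define T where "T = (\<lambda>i j. of_bool (j = i) - (\<Sum>k<(1::nat). 1 * (of_bool (j = 0) - b j)))"
    have T: "fdet n T = (\<Sum>j<n. b j)"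
    proof -
      have "fdet n T = fdet 1 (\<lambda>k l. of_bool (l = k) - (\<Sum>i<n. (of_bool (i = 0) - b i) * 1))"
        unfolding T_def by (rule fdet_sylvester)
      also have "\<dots> = 1 - (\<Sum>i<n. of_bool (i = 0) - b i)"
        by (simp add: fdet_def det_single)
      also have "\<dots> = (\<Sum>j<n. b j)"
        using assms(1) sum_of_bool_select(1)[of 0 n "\<lambda>_. 1 :: 'a"] by (simp add: sum_subtractf)
      finally show ?thesis .
    qed
    have shift: "(\<Sum>k<n. x k * (z k - c)) = (\<Sum>k<n. x k * z k) - (\<Sum>k<n. x k) * c" for x z and c :: 'a
      by (simp add: right_diff_distrib sum_subtractf sum_distrib_right)
    have T': "T k j = of_bool (j = k) - (of_bool (j = 0) - b j)" for k j
      by (simp add: T_def)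
    have "fdet n (\<lambda>i j. L i j + a i * of_bool (j = 0)) * fdet n T =
        fdet n (\<lambda>i j. \<Sum>k<n. (L i k + a i * of_bool (k = 0)) * T k j)"
      by (rule fdet_mult)
    also have "\<dots> = fdet n (\<lambda>i j. L i j + a i * b j)"
    proof (rule fdet_cong)
      fix i j assume ij: "i < n" "j < n"
      have "(\<Sum>k<n. (L i k + a i * of_bool (k = 0)) * T k j) =
         (\<Sum>k<n. (L i k + a i * of_bool (k = 0)) * of_bool (j = k)) -
         (\<Sum>k<n. L i k + a i * of_bool (k = 0)) * (of_bool (j = 0) - b j)"
        by (simp only: T' shift)
      also have "(\<Sum>k<n. (L i k + a i * of_bool (k = 0)) * of_bool (j = k)) = L i j + a i * of_bool (j = 0)"
        using ij by (subst sum_of_bool_select) auto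
      also have "(\<Sum>k<n. L i k + a i * of_bool (k = 0)) = a i"
        using ij assms(1) by (simp add: sum.distrib L sum_of_bool_select)
      finally show "(\<Sum>k<n. (L i k + a i * of_bool (k = 0)) * T k j) = L i j + a i * b j"
        by (simp add: algebra_simps)
    qed
    finally show ?thesis
      by (simp add: T mult.commute)
  qed
  have "fdet n (\<lambda>i j. M i j + u i * v j) = (\<Sum>j<n. v j) * fdet n (\<lambda>i j. M i j + u i * of_bool (j = 0))"
    by (rule right[OF rows])
  also have "fdet n (\<lambda>i j. M i j + u i * of_bool (j = 0)) = fdet n (\<lambda>j i. M i j + u i * of_bool (j = 0))"
    by (rule fdet_transpose)
  also have "\<dots> = fdet n (\<lambda>j i. M i j + of_bool (j = 0) * u i)"
    by (simp add: mult.commute)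
  also have "\<dots> = (\<Sum>i<n. u i) * fdet n (\<lambda>j i. M i j + of_bool (j = 0) * of_bool (i = 0))"
    by (rule right) (use cols in auto)
  also have "fdet n (\<lambda>j i. M i j + of_bool (j = 0) * of_bool (i = 0)) =
     fdet n (\<lambda>i j. M i j + of_bool (j = 0) * of_bool (i = 0))"
    by (rule fdet_transpose)
  finally show ?thesis
    by (simp add: mult_ac)
qed

text \<open>Both determinants are the corner entry times the same principal minor.\<close>

lemma fdet_first_column:
  fixes f g :: "nat \<Rightarrow> nat \<Rightarrow> 'a :: comm_ring_1"
  assumes "n > 0"
    and f: "\<And>i. 0 < i \<Longrightarrow> i < n \<Longrightarrow> f i 0 = 0"
    and g: "\<And>i. 0 < i \<Longrightarrow> i < n \<Longrightarrow> g i 0 = 0"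
    and fg: "\<And>i j. 0 < i \<Longrightarrow> i < n \<Longrightarrow> 0 < j \<Longrightarrow> j < n \<Longrightarrow> f i j = g i j"
  shows "g 0 0 * fdet n f = f 0 0 * fdet n g"
proof -
  have eq: "g 0 0 * (\<Prod>i<n. f i (\<tau> i)) = f 0 0 * (\<Prod>i<n. g i (\<tau> i))" if \<tau>: "\<tau> permutes {..<n}" for \<tau>
  proof (cases "\<tau> 0 = 0")
    case True
    have split: "(\<Prod>i<n. h i (\<tau> i)) = h 0 0 * (\<Prod>i\<in>{..<n}-{0}. h i (\<tau> i))" for h :: "nat \<Rightarrow> nat \<Rightarrow> 'a"
      using assms(1) True by (subst prod.remove[of _ 0]) auto
    have "(\<Prod>i\<in>{..<n}-{0}. f i (\<tau> i)) = (\<Prod>i\<in>{..<n}-{0}. g i (\<tau> i))"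
    proof (rule prod.cong[OF refl])
      fix i assume i: "i \<in> {..<n} - {0}"
      then have "\<tau> i \<noteq> 0"
        using True permutes_inj[OF \<tau>] by (metis DiffD2 injD insertCI)
      moreover have "\<tau> i < n"
        using i permutes_in_image[OF \<tau>, of i] by auto
      ultimately show "f i (\<tau> i) = g i (\<tau> i)"
        using i by (intro fg) auto
    qed
    then show ?thesis
      by (simp add: split mult_ac)
  next
    case False
    obtain i where i: "\<tau> i = 0"
      using permutes_surj[OF \<tau>] by (metis surjD)
    have "i < n" "0 < i"
      using i False \<tau> assms(1) permutes_in_image[OF \<tau>, of i] by (auto intro: gr0I)
    then have "(\<Prod>i<n. f i (\<tau> i)) = 0" "(\<Prod>i<n. g i (\<tau> i)) = 0"
      using i f g by (auto intro!: prod_zero bexI[of _ i])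
    then show ?thesis by simp
  qed
  show ?thesis
    unfolding fdet_leibniz sum_distrib_left
    by (intro sum.cong refl) (use eq in \<open>simp add: mult.left_commute[of _ "of_int _"]\<close>)
qed

text \<open>Composition with the transposition flips the sign and keeps \<open>g\<close>, so the sum
  equals its own negative.\<close>

lemma sum_sign_swap_invariant:
  fixes g :: "(nat \<Rightarrow> nat) \<Rightarrow> real"
  assumes ab: "a < n" "b < n" "a \<noteq> b"
    and g: "\<And>\<tau>. \<tau> permutes {..<n} \<Longrightarrow> g (\<tau> \<circ> transpose a b) = g \<tau>"
  shows "(\<Sum>\<tau> | \<tau> permutes {..<n}. of_int (sign \<tau>) * g \<tau>) = 0"
proof -
  have t: "transpose a b permutes {..<n}"
    using ab by (intro permutes_swap_id) auto
  have "(\<Sum>\<tau> | \<tau> permutes {..<n}. of_int (sign \<tau>) * g \<tau>) =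
        (\<Sum>\<tau> | \<tau> permutes {..<n}. of_int (sign (\<tau> \<circ> transpose a b)) * g (\<tau> \<circ> transpose a b))"
    by (rule sum_permutations_compose_right[OF t])
  also have "\<dots> = (\<Sum>\<tau> | \<tau> permutes {..<n}. - (of_int (sign \<tau>) * g \<tau>))"
  proof (rule sum.cong[OF refl])
    fix \<tau> assume "\<tau> \<in> {\<tau>. \<tau> permutes {..<n}}"
    then have \<tau>: "\<tau> permutes {..<n}" by simp
    have "permutation \<tau>"
      using \<tau> permutation_permutes by blast
    then have "sign (\<tau> \<circ> transpose a b) = - sign \<tau>"
      using ab(3) by (subst sign_compose) (auto simp: permutation_swap_id sign_swap_id)
    then show "of_int (sign (\<tau> \<circ> transpose a b)) * g (\<tau> \<circ> transpose a b) = - (of_int (sign \<tau>) * g \<tau>)"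
      using g[OF \<tau>] by simp
  qed
  finally show ?thesis
    by (simp add: sum_negf)
qed

text \<open>Exchanging two values after the permutation is a bijection between the permutations
  taking either value at \<open>l\<close>, so the \<open>p\<close> classes have equal size.\<close>

lemma card_permutations_fixed_value:
  assumes "l < p" "j < p"
  shows "p * card {q. q permutes {..<p} \<and> q l = j} = fact p"
proof -
  have eq: "card {q. q permutes {..<p} \<and> q l = i} = card {q. q permutes {..<p} \<and> q l = j}" if "i < p" for i
  proof (rule bij_betw_same_card)
    have t: "transpose i j permutes {..<p}"
      using that assms by (intro permutes_swap_id) auto
    show "bij_betw (\<lambda>q. transpose i j \<circ> q) {q. q permutes {..<p} \<and> q l = i} {q. q permutes {..<p} \<and> q l = j}"
      by (rule bij_betw_byWitness[where f' = "\<lambda>q. transpose i j \<circ> q"])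
         (use t in \<open>auto simp: o_assoc intro: permutes_compose\<close>)
  qed
  have "fact p = card {q. q permutes {..<p}}"
    using card_permutations[of "{..<p}" p] by simp
  also have "{q. q permutes {..<p}} = (\<Union>i<p. {q. q permutes {..<p} \<and> q l = i})"
    using assms(1) permutes_in_image by fastforce
  also have "card \<dots> = (\<Sum>i<p. card {q. q permutes {..<p} \<and> q l = i})"
    by (rule card_UN_disjoint) (auto intro: finite_subset[OF _ finite_permutations[of "{..<p}"]])
  also have "\<dots> = p * card {q. q permutes {..<p} \<and> q l = j}"
    using eq by simp
  finally show ?thesis by simp
qed

lemma prod_blocks: "(\<Prod>i<n * p. g i) = (\<Prod>k<n. \<Prod>l<p. g (k * p + l))" for n p :: nat
proof -
  have "(\<Prod>i<n * p. g i) = (\<Prod>k<n. \<Prod>i\<in>{k * p..<k * p + p}. g i)"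
    by (rule prod.nat_group[symmetric])
  also have "\<dots> = (\<Prod>k<n. \<Prod>l<p. g (k * p + l))"
  proof (rule prod.cong[OF refl])
    fix k
    show "(\<Prod>i\<in>{k * p..<k * p + p}. g i) = (\<Prod>l<p. g (k * p + l))"
      by (rule prod.reindex_bij_witness[of _ "\<lambda>l. k * p + l" "\<lambda>i. i - k * p"]) auto
  qed
  finally show ?thesis .
qed

text \<open>\<open>\<beta> k l\<close> is the letter in column \<open>l\<close> of block \<open>k\<close>, at position \<open>k * p + l\<close>. As every block contains
  each letter once, this position is number \<open>\<beta> k l * n + k\<close> in the stable sort of all positions by letter,
  so \<open>block_map p n \<beta>\<close> is the standard permutation.\<close>

definition block_perms :: "nat \<Rightarrow> nat \<Rightarrow> (nat \<Rightarrow> nat \<Rightarrow> nat) set" where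
  "block_perms p n = PiE {..<n} (\<lambda>_. {q. q permutes {..<p}})"

definition block_map :: "nat \<Rightarrow> nat \<Rightarrow> (nat \<Rightarrow> nat \<Rightarrow> nat) \<Rightarrow> nat \<Rightarrow> nat" where
  "block_map p n \<beta> i = (if i < n * p then \<beta> (i div p) (i mod p) * n + i div p else i)"

lemma div_mod_block:
  fixes k l p :: nat
  assumes "l < p"
  shows "(k * p + l) div p = k" "(k * p + l) mod p = l"
  using assms by auto

lemma block_index_less:
  fixes k l n p :: nat
  assumes "k < n" "l < p"
  shows "k * p + l < n * p"
proof -
  have "k * p + l < k * p + p" using assms by simp
  also have "\<dots> = Suc k * p" by simp
  also have "\<dots> \<le> n * p" using assms by (intro mult_le_mono1) simp
  finally show ?thesis .
qed

text \<open>Expand each block over the set of rows taken from the permutation: sets with at most one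
  row contribute equally on both sides, and any larger set contributes terms that are invariant
  under exchanging two of its rows, so that they cancel in the determinant.\<close>

lemma sum_block_perms_fdet:
  fixes a :: "nat \<Rightarrow> nat \<Rightarrow> real" and y :: "nat \<Rightarrow> real"
  assumes p: "p > 0"
  shows "(\<Sum>\<beta>\<in>block_perms p n. fdet (n * p) (\<lambda>i j. a i j + y i * of_bool (j = block_map p n \<beta> i))) =
     fact p ^ n * fdet (n * p) (\<lambda>i j. a i j + y i * (of_bool (j mod n = i div p) / p))"
proof -
  let ?P = "{q. q permutes {..<p}}" and ?N = "n * p"
  have finP: "finite ?P"
    by (simp add: finite_permutations)
  \<comment> \<open>For a fixed Leibniz term \<open>\<tau>\<close>, \<open>W\<close> is the factor
    of block \<open>k\<close> summed over its permutations, and \<open>V\<close> is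
    \<open>fact p\<close> times the factor of the averaged block. \<open>cW\<close> and
    \<open>cV\<close> are their coefficients at the row set \<open>S\<close>.\<close>
  define W where "W = (\<lambda>k \<tau>. \<Sum>q\<in>?P. \<Prod>l<p. a (k * p + l) (\<tau> (k * p + l)) +
       y (k * p + l) * of_bool (\<tau> (k * p + l) = q l * n + k))"
  define V where "V = (\<lambda>k \<tau>. fact p * (\<Prod>l<p. a (k * p + l) (\<tau> (k * p + l)) +
       y (k * p + l) * (of_bool (\<tau> (k * p + l) mod n = k) / p)))"
  define coef where "coef = (\<lambda>k \<tau> S. (\<Prod>l\<in>S. y (k * p + l)) * (\<Prod>l\<in>{..<p}-S. a (k * p + l) (\<tau> (k * p + l))))"
  define cW where "cW = (\<lambda>k (\<tau> :: nat \<Rightarrow> nat) S. real (card {q. q permutes {..<p} \<and> (\<forall>l\<in>S. \<tau> (k * p + l) = q l * n + k)}))"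
  define cV where "cV = (\<lambda>k (\<tau> :: nat \<Rightarrow> nat) S. fact p * (\<Prod>l\<in>S. of_bool (\<tau> (k * p + l) mod n = k) / real p))"
  have W: "W k \<tau> = (\<Sum>S\<in>Pow {..<p}. coef k \<tau> S * cW k \<tau> S)" for k \<tau>
  proof -
    have "W k \<tau> = (\<Sum>q\<in>?P. \<Sum>S\<in>Pow {..<p}.
       (\<Prod>l\<in>S. y (k * p + l) * of_bool (\<tau> (k * p + l) = q l * n + k)) *
       (\<Prod>l\<in>{..<p}-S. a (k * p + l) (\<tau> (k * p + l))))"
      unfolding W_def by (intro sum.cong refl, subst add.commute) (rule prod_add, simp)
    also have "\<dots> = (\<Sum>q\<in>?P. \<Sum>S\<in>Pow {..<p}. coef k \<tau> S * of_bool (\<forall>l\<in>S. \<tau> (k * p + l) = q l * n + k))"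
    proof (intro sum.cong refl)
      fix q S assume "S \<in> Pow {..<p}"
      then have "finite S"
        using finite_subset by blast
      then have "(\<Prod>l\<in>S. of_bool (\<tau> (k * p + l) = q l * n + k)) = (of_bool (\<forall>l\<in>S. \<tau> (k * p + l) = q l * n + k) :: real)"
        by (induction S rule: finite_induct) auto
      then show "(\<Prod>l\<in>S. y (k * p + l) * of_bool (\<tau> (k * p + l) = q l * n + k)) *
         (\<Prod>l\<in>{..<p}-S. a (k * p + l) (\<tau> (k * p + l))) =
         coef k \<tau> S * of_bool (\<forall>l\<in>S. \<tau> (k * p + l) = q l * n + k)"
        by (simp add: coef_def prod.distrib mult_ac)
    qed
    also have "\<dots> = (\<Sum>S\<in>Pow {..<p}. coef k \<tau> S * (\<Sum>q\<in>?P. of_bool (\<forall>l\<in>S. \<tau> (k * p + l) = q l * n + k)))"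
      by (subst sum.swap) (simp add: sum_distrib_left)
    also have "\<dots> = (\<Sum>S\<in>Pow {..<p}. coef k \<tau> S * cW k \<tau> S)"
      using finP by (simp add: cW_def Int_def conj_commute)
    finally show ?thesis .
  qed
  have V: "V k \<tau> = (\<Sum>S\<in>Pow {..<p}. coef k \<tau> S * cV k \<tau> S)" for k \<tau>
  proof -
    have "V k \<tau> = fact p * (\<Sum>S\<in>Pow {..<p}.
       (\<Prod>l\<in>S. y (k * p + l) * (of_bool (\<tau> (k * p + l) mod n = k) / p)) *
       (\<Prod>l\<in>{..<p}-S. a (k * p + l) (\<tau> (k * p + l))))"
      unfolding V_def by (intro arg_cong[of _ _ "(*) _"], subst add.commute) (rule prod_add, simp)
    also have "\<dots> = (\<Sum>S\<in>Pow {..<p}. coef k \<tau> S * cV k \<tau> S)"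
      unfolding sum_distrib_left
      by (intro sum.cong refl) (simp only: coef_def cV_def prod.distrib mult_ac)
    finally show ?thesis .
  qed
  have small: "cW k \<tau> S = cV k \<tau> S" if k: "k < n" and \<tau>: "\<tau> permutes {..<?N}" and S: "S \<subseteq> {..<p}"
    and small: "\<And>l l'. l \<in> S \<Longrightarrow> l' \<in> S \<Longrightarrow> l = l'" for k \<tau> S
  proof (cases "S = {}")
    case True
    then show ?thesis
      using card_permutations[of "{..<p}" p] by (simp add: cW_def cV_def)
  next
    case False
    then obtain l where l: "S = {l}"
      using small by blast
    have lp: "l < p"
      using l S by auto
    let ?t = "\<tau> (k * p + l)"
    have t: "?t < n * p"
      using permutes_in_image[OF \<tau>, of "k * p + l"] block_index_less[OF k lp] by auto
    show ?thesis
    proof (cases "?t mod n = k")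
      case True
      have tn: "?t div n < p"
        using t by (simp add: less_mult_imp_div_less mult.commute)
      \<comment> \<open>Matching row \<open>l\<close> prescribes the value of \<open>q\<close> at
        \<open>l\<close>, which leaves \<open>fact p / p\<close> permutations: exactly the
        coefficient on the averaged side.\<close>
      have "?t = q l * n + k \<longleftrightarrow> q l = ?t div n" for q
        using True k by (metis div_mult_mod_eq div_mult_self3 div_less less_nat_zero_code add.right_neutral)
      then have "cW k \<tau> S = real (card {q. q permutes {..<p} \<and> q l = ?t div n})"
        by (simp add: cW_def l)
      moreover have "real p * real (card {q. q permutes {..<p} \<and> q l = ?t div n}) = fact p"
        using card_permutations_fixed_value[OF lp tn] by (metis of_nat_fact of_nat_mult)
      ultimately show ?thesis
        using True p by (simp add: cV_def l field_simps)
    next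
      case False
      then have "?t \<noteq> q l * n + k" for q
        using k by auto
      then have "cW k \<tau> S = 0"
        by (simp add: cW_def l)
      then show ?thesis
        using False by (simp add: cV_def l)
    qed
  qed
  \<comment> \<open>The other blocks enter through \<open>Z\<close>, which must be insensitive to
    exchanges of two rows of block \<open>k\<close> for the cancellation to apply.\<close>
  have swap_block: "(\<Sum>\<tau> | \<tau> permutes {..<?N}. of_int (sign \<tau>) * (W k \<tau> * Z \<tau>)) =
        (\<Sum>\<tau> | \<tau> permutes {..<?N}. of_int (sign \<tau>) * (V k \<tau> * Z \<tau>))"
    if k: "k < n" and Z: "\<And>\<tau> l l'. l < p \<Longrightarrow> l' < p \<Longrightarrow> Z (\<tau> \<circ> transpose (k * p + l) (k * p + l')) = Z \<tau>"
    for k and Z :: "(nat \<Rightarrow> nat) \<Rightarrow> real"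
  proof -
    have "(\<Sum>\<tau> | \<tau> permutes {..<?N}. of_int (sign \<tau>) * (coef k \<tau> S * cW k \<tau> S * Z \<tau>)) =
          (\<Sum>\<tau> | \<tau> permutes {..<?N}. of_int (sign \<tau>) * (coef k \<tau> S * cV k \<tau> S * Z \<tau>))"
      if S: "S \<subseteq> {..<p}" for S
    proof (cases "\<exists>l\<in>S. \<exists>l'\<in>S. l \<noteq> l'")
      case False
      then show ?thesis
        by (intro sum.cong refl) (use small[OF k _ S] in auto)
    next
      case True
      then obtain l l' where l: "l \<in> S" "l' \<in> S" "l \<noteq> l'" by blast
      have lp: "l < p" "l' < p"
        using l S by auto
      let ?t = "transpose (k * p + l) (k * p + l')"
      have t: "?t (k * p + i) = k * p + transpose l l' i" for i
        by (auto simp: transpose_def)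
      have St: "transpose l l' ` S = S"
        using l by (simp add: transpose_image_eq)
      have coef: "coef k (\<tau> \<circ> ?t) S = coef k \<tau> S" for \<tau>
      proof -
        have "(\<Prod>i\<in>{..<p}-S. a (k * p + i) (\<tau> (?t (k * p + i)))) = (\<Prod>i\<in>{..<p}-S. a (k * p + i) (\<tau> (k * p + i)))"
          by (intro prod.cong refl) (use l in \<open>auto simp: t transpose_def\<close>)
        then show ?thesis
          by (simp add: coef_def)
      qed
      have cV: "cV k (\<tau> \<circ> ?t) S = cV k \<tau> S" for \<tau>
      proof -
        have "(\<Prod>i\<in>S. of_bool (\<tau> (k * p + transpose l l' i) mod n = k) / real p) =
              (\<Prod>i\<in>transpose l l' ` S. of_bool (\<tau> (k * p + i) mod n = k) / real p)"
          by (subst prod.reindex) (auto intro: inj_on_subset[OF inj_transpose])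
        then show ?thesis
          by (simp add: cV_def t St)
      qed
      have cW: "cW k (\<tau> \<circ> ?t) S = cW k \<tau> S" for \<tau>
      proof -
        have tp: "transpose l l' permutes {..<p}"
          using lp by (intro permutes_swap_id) auto
        have all_t: "(\<forall>i\<in>S. Q (transpose l l' i)) \<longleftrightarrow> (\<forall>i\<in>S. Q i)" for Q
          using St by (metis (no_types, lifting) image_iff)
        have *: "(\<forall>i\<in>S. \<tau> (k * p + transpose l l' i) = q i * n + k) \<longleftrightarrow>
              (\<forall>i\<in>S. \<tau> (k * p + i) = q (transpose l l' i) * n + k)" for q
          using all_t[of "\<lambda>i. \<tau> (k * p + i) = q (transpose l l' i) * n + k"] by simp
        have "card {q. q permutes {..<p} \<and> (\<forall>i\<in>S. \<tau> (k * p + transpose l l' i) = q i * n + k)} =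
              card {q. q permutes {..<p} \<and> (\<forall>i\<in>S. \<tau> (k * p + i) = q i * n + k)}"
        proof (rule bij_betw_same_card)
          show "bij_betw (\<lambda>q. q \<circ> transpose l l')
             {q. q permutes {..<p} \<and> (\<forall>i\<in>S. \<tau> (k * p + transpose l l' i) = q i * n + k)}
             {q. q permutes {..<p} \<and> (\<forall>i\<in>S. \<tau> (k * p + i) = q i * n + k)}"
            unfolding *
            by (rule bij_betw_byWitness[where f' = "\<lambda>q. q \<circ> transpose l l'"])
               (auto simp: comp_assoc intro: permutes_compose[OF tp])
        qed
        then show ?thesis
          by (simp add: cW_def t)
      qed
      have less: "k * p + l < ?N" "k * p + l' < ?N" "k * p + l \<noteq> k * p + l'"
        using block_index_less[OF k] lp l by auto
      show ?thesis
        by (subst (1 2) sum_sign_swap_invariant[OF less]) (simp_all only: coef cV cW Z[OF lp])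
    qed
    then show ?thesis
      unfolding W V sum_distrib_right sum_distrib_left
      by (rule trans[OF sum.swap trans[OF sum.cong[OF refl] sum.swap]]) auto
  qed
  \<comment> \<open>A hybrid: the first \<open>K\<close> blocks are averaged, the others still
    summed over their permutations. Raising \<open>K\<close> exchanges one block at a time.\<close>
  define Z where "Z = (\<lambda>K \<tau>. (\<Prod>k<K. V k \<tau>) * (\<Prod>k\<in>{K..<n}. W k \<tau>))"
  have Z: "(\<Sum>\<tau> | \<tau> permutes {..<?N}. of_int (sign \<tau>) * Z 0 \<tau>) =
        (\<Sum>\<tau> | \<tau> permutes {..<?N}. of_int (sign \<tau>) * Z K \<tau>)" if "K \<le> n" for K
    using that
  proof (induction K)
    case (Suc K)
    define R where "R = (\<lambda>\<tau>. (\<Prod>k<K. V k \<tau>) * (\<Prod>k\<in>{Suc K..<n}. W k \<tau>))"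
    have "{K..<n} = insert K {Suc K..<n}"
      using Suc.prems by auto
    then have ZK: "Z K \<tau> = W K \<tau> * R \<tau>" "Z (Suc K) \<tau> = V K \<tau> * R \<tau>" for \<tau>
      by (simp_all add: Z_def R_def mult_ac)
    have "R (\<tau> \<circ> transpose (K * p + l) (K * p + l')) = R \<tau>" if l: "l < p" "l' < p" for \<tau> l l'
    proof -
      have "transpose (K * p + l) (K * p + l') (k * p + i) = k * p + i" if "k \<noteq> K" "i < p" for k i
      proof -
        have "k * p + i \<noteq> K * p + j" if "j < p" for j
          using \<open>k \<noteq> K\<close> div_mod_block(1)[OF \<open>i < p\<close>, of k] div_mod_block(1)[OF that, of K] by metis
        then show ?thesis
          using l by (intro transpose_apply_other) auto
      qed
      then have "V k (\<tau> \<circ> transpose (K * p + l) (K * p + l')) = V k \<tau>"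
        "W k (\<tau> \<circ> transpose (K * p + l) (K * p + l')) = W k \<tau>" if "k \<noteq> K" for k
        using that by (auto simp: V_def W_def)
      then show ?thesis
        by (simp add: R_def)
    qed
    then show ?case
      using Suc swap_block[of K R] by (simp add: ZK)
  qed (simp add: Z_def)
  have block_map: "block_map p n \<beta> (k * p + l) = \<beta> k l * n + k" if "k < n" "l < p" for \<beta> k l
    using that block_index_less[OF that] by (simp add: block_map_def)
  have "(\<Sum>\<beta>\<in>block_perms p n. fdet ?N (\<lambda>i j. a i j + y i * of_bool (j = block_map p n \<beta> i))) =
      (\<Sum>\<tau> | \<tau> permutes {..<?N}. of_int (sign \<tau>) *
         (\<Sum>\<beta>\<in>block_perms p n. \<Prod>i<?N. a i (\<tau> i) + y i * of_bool (\<tau> i = block_map p n \<beta> i)))"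
    unfolding fdet_leibniz by (subst sum.swap) (simp add: sum_distrib_left)
  also have "\<dots> = (\<Sum>\<tau> | \<tau> permutes {..<?N}. of_int (sign \<tau>) * Z 0 \<tau>)"
  proof (intro sum.cong refl arg_cong2[of _ _ _ _ "(*)"])
    fix \<tau> :: "nat \<Rightarrow> nat"
    have "(\<Sum>\<beta>\<in>block_perms p n. \<Prod>i<?N. a i (\<tau> i) + y i * of_bool (\<tau> i = block_map p n \<beta> i)) =
      (\<Sum>\<beta>\<in>block_perms p n. \<Prod>k<n. \<Prod>l<p. a (k * p + l) (\<tau> (k * p + l)) +
          y (k * p + l) * of_bool (\<tau> (k * p + l) = \<beta> k l * n + k))"
      unfolding prod_blocks by (intro sum.cong prod.cong refl) (simp add: block_map)
    also have "\<dots> = (\<Prod>k<n. W k \<tau>)"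
      unfolding W_def block_perms_def by (rule prod_sum_PiE[symmetric]) (use finP in auto)
    finally show "(\<Sum>\<beta>\<in>block_perms p n. \<Prod>i<?N. a i (\<tau> i) + y i * of_bool (\<tau> i = block_map p n \<beta> i)) = Z 0 \<tau>"
      by (simp add: Z_def atLeast0LessThan)
  qed
  also have "\<dots> = (\<Sum>\<tau> | \<tau> permutes {..<?N}. of_int (sign \<tau>) * Z n \<tau>)"
    by (rule Z) simp
  also have "\<dots> = (\<Sum>\<tau> | \<tau> permutes {..<?N}. fact p ^ n * (of_int (sign \<tau>) *
       (\<Prod>i<?N. a i (\<tau> i) + y i * (of_bool (\<tau> i mod n = i div p) / p))))"
  proof (intro sum.cong refl)
    fix \<tau> :: "nat \<Rightarrow> nat"
    have "Z n \<tau> = fact p ^ n * (\<Prod>i<?N. a i (\<tau> i) + y i * (of_bool (\<tau> i mod n = i div p) / p))"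
      unfolding prod_blocks by (simp add: Z_def V_def prod.distrib)
    then show "of_int (sign \<tau>) * Z n \<tau> = fact p ^ n * (of_int (sign \<tau>) *
       (\<Prod>i<?N. a i (\<tau> i) + y i * (of_bool (\<tau> i mod n = i div p) / p)))"
      by simp
  qed
  also have "\<dots> = fact p ^ n * fdet ?N (\<lambda>i j. a i j + y i * (of_bool (j mod n = i div p) / p))"
    by (simp add: fdet_leibniz sum_distrib_left)
  finally show ?thesis .
qed

section \<open>Counting cyclic block permutations\<close>

lemma sum_blocks: "(\<Sum>i<n * p. g i) = (\<Sum>k<n. \<Sum>l<p. g (k * p + l))" for n p :: nat
proof -
  have "(\<Sum>i<n * p. g i) = (\<Sum>k<n. \<Sum>i\<in>{k * p..<k * p + p}. g i)"
    by (rule sum.nat_group[symmetric])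
  also have "\<dots> = (\<Sum>k<n. \<Sum>l<p. g (k * p + l))"
  proof (rule sum.cong[OF refl])
    fix k
    show "(\<Sum>i\<in>{k * p..<k * p + p}. g i) = (\<Sum>l<p. g (k * p + l))"
      by (rule sum.reindex_bij_witness[of _ "\<lambda>l. k * p + l" "\<lambda>i. i - k * p"]) auto
  qed
  finally show ?thesis .
qed

text \<open>The residue of an image modulo \<open>n\<close> recovers the block and the quotient
  recovers the letter, which determines the column because each block is a permutation.\<close>

lemma block_map_permutes:
  assumes "p > 0" "n > 0" "\<beta> \<in> block_perms p n"
  shows "block_map p n \<beta> permutes {..<n * p}"
proof (rule bij_imp_permutes)
  have perm: "\<beta> k permutes {..<p}" if "k < n" for k
    using assms(3) that by (auto simp: block_perms_def PiE_iff)
  have less: "block_map p n \<beta> i < n * p" if i: "i < n * p" for i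
  proof -
    have "i div p < n" "i mod p < p"
      using i assms by (auto simp: less_mult_imp_div_less)
    moreover from this have "\<beta> (i div p) (i mod p) < p"
      using permutes_in_image[OF perm] by blast
    ultimately have "\<beta> (i div p) (i mod p) * n + i div p < p * n"
      by (intro block_index_less)
    then show ?thesis
      using i by (simp add: block_map_def mult.commute)
  qed
  have inj: "inj_on (block_map p n \<beta>) {..<n * p}"
  proof (rule inj_onI)
    fix i j assume ij: "i \<in> {..<n * p}" "j \<in> {..<n * p}" "block_map p n \<beta> i = block_map p n \<beta> j"
    have i: "i div p < n" "j div p < n"
      using ij assms by (auto simp: less_mult_imp_div_less)
    have eq: "\<beta> (i div p) (i mod p) * n + i div p = \<beta> (j div p) (j mod p) * n + j div p"
      using ij by (simp add: block_map_def)
    have d: "i div p = j div p"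
      using div_mod_block(2)[OF i(1), of "\<beta> (i div p) (i mod p)"] div_mod_block(2)[OF i(2), of "\<beta> (j div p) (j mod p)"] eq
      by metis
    then have "\<beta> (i div p) (i mod p) = \<beta> (i div p) (j mod p)"
      using eq assms(2) by simp
    then have "i mod p = j mod p"
      using permutes_inj[OF perm[OF i(1)]] by (auto dest: injD)
    then show "i = j"
      using d by (metis div_mult_mod_eq)
  qed
  moreover have "block_map p n \<beta> ` {..<n * p} \<subseteq> {..<n * p}"
    using less by auto
  ultimately show "bij_betw (block_map p n \<beta>) {..<n * p} {..<n * p}"
    unfolding bij_betw_def by (simp add: endo_inj_surj)
qed (simp add: block_map_def)

text \<open>Here \<open>A\<close> is the adjacency matrix of the generalized de Bruijn graph, and \<open>F\<close> is the matrix
  of \<open>x\<^sup>l \<mapsto> x\<^bsup>pl\<^esup>\<close>. On \<open>\<int>[x] / (x\<^sup>n - 1)\<close> the map \<open>A\<close> is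
  \<open>x\<^sup>l \<mapsto> x\<^bsup>pl\<^esup> (1 - x\<^sup>p) / (1 - x)\<close>, so multiplication by \<open>1 - x\<close> intertwines \<open>A\<close> and \<open>F\<close>. The matrix
  \<open>T\<close> is this multiplication, made invertible by adding the coefficient sum to the first entry.\<close>

lemma fdet_de_Bruijn_adjacency:
  fixes p n :: nat
  defines "A \<equiv> \<lambda>k l. (\<Sum>j<p. of_bool ((l * p + j) mod n = k) :: real)"
  assumes p: "p > 1" and n: "n > 0"
  shows "real (p - 1) * real p ^ n * fdet n (\<lambda>k l. of_bool (l = k) - A k l / p + 1) =
    real (p * n) * fdet n (\<lambda>i j. real p * of_bool (j = i) + (-1) * of_bool (j = i * p mod n))"
proof -
  define E where "E = (\<lambda>k l. of_bool (l = k) - A k l / p + 1)"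
  define F where "F = (\<lambda>k l. of_bool (k = l * p mod n) :: real)"
  \<comment> \<open>\<open>E'\<close> is the conjugate of \<open>E\<close> by \<open>T\<close>.
    Outside row 0 it agrees with \<open>G\<close>; the constant added in row 0 is chosen so that the
    corner becomes \<open>n\<close>, the common column sum of \<open>E\<close>.\<close>
  define E' where "E' = (\<lambda>k l. of_bool (l = k) - F k l / p + of_bool (k = 0) * (real n - (real p - 1) / p))"
  define G where "G = (\<lambda>k l. of_bool (l = k) - F k l / p)"
  define T where "T = (\<lambda>k l. of_bool (l = k) - of_bool (k = (l + 1) mod n) + of_bool (k = 0) :: real)"
  have sum3l: "(\<Sum>l<n. (a l - b l + c l) * v l) = (\<Sum>l<n. a l * v l) - (\<Sum>l<n. b l * v l) + (\<Sum>l<n. c l * v l)"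
    and sum3r: "(\<Sum>l<n. v l * (a l - b l + c l)) = (\<Sum>l<n. v l * a l) - (\<Sum>l<n. v l * b l) + (\<Sum>l<n. v l * c l)"
    for a b c v :: "nat \<Rightarrow> real"
    by (simp_all only: distrib_right distrib_left left_diff_distrib right_diff_distrib sum.distrib sum_subtractf)
  have colA: "(\<Sum>k<n. A k l) = p" for l
  proof -
    have "(\<Sum>k<n. A k l) = (\<Sum>j<p. \<Sum>k<n. of_bool ((l * p + j) mod n = k) * 1)"
      unfolding A_def by (subst sum.swap) simp
    also have "\<dots> = (\<Sum>j<p. 1)"
      using n by (intro sum.cong refl) (subst sum_of_bool_select, auto)
    finally show ?thesis by simp
  qed
  \<comment> \<open>Adding all rows shows that a kernel vector of \<open>T\<close> has coefficient
    sum 0; the single rows then make it constant, hence zero.\<close>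
  have T0: "fdet n T \<noteq> 0"
  proof
    assume "fdet n T = 0"
    then obtain v j where v: "j < n" "v j \<noteq> 0" "\<And>k. k < n \<Longrightarrow> (\<Sum>l<n. T k l * v l) = 0"
      unfolding fdet_eq_0_iff by blast
    have Tv: "(\<Sum>l<n. T k l * v l) = v k - (\<Sum>l<n. of_bool (k = (l + 1) mod n) * v l) + of_bool (k = 0) * (\<Sum>l<n. v l)"
      if "k < n" for k
      unfolding T_def sum3l sum_distrib_left sum_of_bool_select(1)[OF that] ..
    have "(\<Sum>k<n. \<Sum>l<n. of_bool (k = (l + 1) mod n) * v l) = (\<Sum>l<n. \<Sum>k<n. of_bool (k = (l + 1) mod n) * v l)"
      by (rule sum.swap)
    also have "\<dots> = (\<Sum>l<n. v l)"
      using n by (intro sum.cong refl) (subst sum_of_bool_select, auto)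
    finally have s: "(\<Sum>k<n. \<Sum>l<n. of_bool (k = (l + 1) mod n) * v l) = (\<Sum>l<n. v l)" .
    have "0 = (\<Sum>k<n. \<Sum>l<n. T k l * v l)"
      using v(3) by simp
    also have "\<dots> = (\<Sum>k<n. v k) - (\<Sum>l<n. v l) + (\<Sum>k<n. of_bool (k = 0) * (\<Sum>l<n. v l))"
      by (subst s[symmetric]) (simp add: Tv sum.distrib sum_subtractf del: sum_mult_of_bool_eq sum_of_bool_mult_eq)
    also have "\<dots> = (\<Sum>l<n. v l)"
      using n by (subst sum_of_bool_select) auto
    finally have sum0: "(\<Sum>l<n. v l) = 0" by simp
    have const: "v k = v 0" if "k < n" for k
      using that
    proof (induction k)
      case (Suc k)
      have "(\<Sum>l<n. of_bool (Suc k = (l + 1) mod n) * v l) = (\<Sum>l<n. of_bool (l = k) * v l)"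
      proof (rule sum.cong[OF refl])
        fix l assume "l \<in> {..<n}"
        then have "Suc k = (l + 1) mod n \<longleftrightarrow> l = k"
          using Suc.prems by (cases "l + 1 = n") auto
        then show "of_bool (Suc k = (l + 1) mod n) * v l = of_bool (l = k) * v l"
          by simp
      qed
      also have "\<dots> = v k"
        using Suc.prems by (subst sum_of_bool_select) auto
      finally have vk: "(\<Sum>l<n. of_bool (Suc k = (l + 1) mod n) * v l) = v k" .
      have "v (Suc k) - v k + of_bool (Suc k = 0) * (\<Sum>l<n. v l) = 0"
        using trans[OF Tv[OF Suc.prems, symmetric] v(3)[OF Suc.prems]] unfolding vk .
      then have "v (Suc k) = v k"
        by simp
      then show ?case
        using Suc.IH Suc.prems by simp
    qed simp
    have "(\<Sum>l<n. v l) = (\<Sum>l<n. v 0)"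
      by (intro sum.cong refl, rule const) simp
    then have "(\<Sum>l<n. v l) = n * v 0"
      by simp
    then have "v 0 = 0"
      using sum0 n by simp
    then show False
      using const[OF v(1)] v(2) by simp
  qed
  have "fdet n T * fdet n E = fdet n (\<lambda>k l. \<Sum>i<n. T k i * E i l)"
    by (rule fdet_mult)
  also have "\<dots> = fdet n (\<lambda>k l. \<Sum>i<n. E' k i * T i l)"
  proof (rule fdet_cong)
    fix k l assume kl: "k < n" "l < n"
    have TE: "(\<Sum>i<n. T k i * E i l) = E k l - (\<Sum>i<n. of_bool (k = (i + 1) mod n) * E i l) + of_bool (k = 0) * (\<Sum>i<n. E i l)"
      unfolding T_def sum3l sum_distrib_left sum_of_bool_select(2)[OF kl(1)] sum_of_bool_select(1)[OF kl(1)] ..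
    have sumE: "(\<Sum>i<n. E i l) = n"
      using kl p sum_of_bool_select(2)[OF kl(2), of "\<lambda>_. 1 :: real"]
      by (simp add: E_def sum.distrib sum_subtractf colA sum_divide_distrib[symmetric])
    have pred: "(\<Sum>i<n. of_bool (k = (i + 1) mod n) * h i) = h ((k + n - 1) mod n)" for h :: "nat \<Rightarrow> real"
    proof -
      have "(\<Sum>i<n. of_bool (k = (i + 1) mod n) * h i) = (\<Sum>i<n. of_bool (i = (k + n - 1) mod n) * h i)"
      proof (rule sum.cong[OF refl])
        fix i assume i: "i \<in> {..<n}"
        have "k = (i + 1) mod n \<longleftrightarrow> i = (k + n - 1) mod n"
        proof (cases "i + 1 = n")
          case True
          then show ?thesis
            using kl by (cases k) auto
        next
          case False
          then show ?thesis
            using kl i by (cases k) auto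
        qed
        then show "of_bool (k = (i + 1) mod n) * h i = of_bool (i = (k + n - 1) mod n) * h i"
          by simp
      qed
      then show ?thesis
        using n by (simp add: sum_of_bool_select del: sum_mult_of_bool_eq sum_of_bool_mult_eq)
    qed
    have A_shift: "(\<Sum>i<n. of_bool (k = (i + 1) mod n) * A i l) = (\<Sum>j<p. of_bool ((l * p + Suc j) mod n = k))"
    proof -
      have "(\<Sum>i<n. of_bool (k = (i + 1) mod n) * A i l) =
          (\<Sum>j<p. \<Sum>i<n. of_bool (k = (i + 1) mod n) * of_bool ((l * p + j) mod n = i))"
        unfolding A_def sum_distrib_left by (rule sum.swap)
      also have "\<dots> = (\<Sum>j<p. of_bool ((l * p + Suc j) mod n = k))"
        using n by (intro sum.cong refl) (subst sum_of_bool_select, auto simp: mod_Suc_eq)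
      finally show ?thesis .
    qed
    \<comment> \<open>Multiplication by \<open>1 - x\<close> telescopes a run of \<open>p\<close>
      consecutive exponents to its two end terms.\<close>
    have tel: "A k l - (\<Sum>i<n. of_bool (k = (i + 1) mod n) * A i l) = F k l - F k ((l + 1) mod n)"
    proof -
      have "A k l - (\<Sum>i<n. of_bool (k = (i + 1) mod n) * A i l) =
         (\<Sum>j<p. of_bool ((l * p + j) mod n = k) - of_bool ((l * p + Suc j) mod n = k))"
        unfolding A_shift by (simp add: A_def sum_subtractf)
      also have "\<dots> = of_bool ((l * p + 0) mod n = k) - of_bool ((l * p + p) mod n = k)"
        by (rule sum_lessThan_telescope')
      also have "(l * p + p) mod n = ((l + 1) mod n) * p mod n"
        by (simp add: mod_mult_left_eq add.commute)
      also have "of_bool ((l * p + 0) mod n = k) - of_bool (((l + 1) mod n) * p mod n = k) = F k l - F k ((l + 1) mod n)"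
        unfolding F_def by (simp only: add_0_right eq_commute[of k])
      finally show ?thesis .
    qed
    have EE: "E k l - (\<Sum>i<n. of_bool (k = (i + 1) mod n) * E i l) =
        of_bool (l = k) - of_bool (k = (l + 1) mod n) - (F k l - F k ((l + 1) mod n)) / p"
    proof -
      have "(\<Sum>i<n. of_bool (k = (i + 1) mod n) * E i l) =
         (\<Sum>i<n. of_bool (k = (i + 1) mod n) * of_bool (l = i)) -
         (\<Sum>i<n. of_bool (k = (i + 1) mod n) * A i l) / p + (\<Sum>i<n. of_bool (k = (i + 1) mod n) * 1)"
        unfolding E_def sum3r sum_divide_distrib by simp
      also have "(\<Sum>i<n. of_bool (k = (i + 1) mod n) * of_bool (l = i)) = (of_bool (k = (l + 1) mod n) :: real)"
        using kl by (subst sum_of_bool_select) auto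
      also have "(\<Sum>i<n. of_bool (k = (i + 1) mod n) * 1) = (1 :: real)"
        by (rule pred)
      finally show ?thesis
        unfolding tel[symmetric] by (simp add: E_def diff_divide_distrib)
    qed
    have "E' k 0 = of_bool (k = 0) * real n"
      using p by (auto simp: E'_def F_def field_simps)
    have "(\<Sum>i<n. E' k i * T i l) = (\<Sum>i<n. E' k i * of_bool (l = i)) - (\<Sum>i<n. E' k i * of_bool (i = (l + 1) mod n))
         + (\<Sum>i<n. E' k i * of_bool (i = 0))"
      unfolding T_def sum3r ..
    also have "\<dots> = E' k l - E' k ((l + 1) mod n) + E' k 0"
      using kl n by (simp add: sum_of_bool_select del: sum_mult_of_bool_eq sum_of_bool_mult_eq)
    also have "\<dots> = of_bool (l = k) - of_bool (k = (l + 1) mod n) - (F k l - F k ((l + 1) mod n)) / p + of_bool (k = 0) * real n"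
      unfolding \<open>E' k 0 = _\<close> by (auto simp: E'_def diff_divide_distrib)
    finally show "(\<Sum>i<n. T k i * E i l) = (\<Sum>i<n. E' k i * T i l)"
      unfolding TE EE sumE by simp
  qed
  also have "\<dots> = fdet n E' * fdet n T"
    by (rule fdet_mult[symmetric])
  finally have EE': "fdet n E = fdet n E'"
    using T0 by simp
  have col0: "F i 0 = of_bool (i = 0)" for i
    by (simp add: F_def)
  \<comment> \<open>Both first columns vanish below the corner, so the determinants differ only
    through the corner entries \<open>(p - 1) / p\<close> and \<open>n\<close>.\<close>
  have "G 0 0 * fdet n E' = E' 0 0 * fdet n G"
    by (rule fdet_first_column) (use n in \<open>auto simp: G_def E'_def col0\<close>)
  moreover have "G 0 0 = (real p - 1) / p" "E' 0 0 = n"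
    using p by (simp_all add: G_def E'_def col0 field_simps)
  ultimately have EG: "(real p - 1) * fdet n E = real (p * n) * fdet n G"
    using p by (simp add: EE' field_simps)
  have "real p ^ n * fdet n G = fdet n (\<lambda>k l. real p * G k l)"
    by (rule fdet_scale[symmetric])
  also have "fdet n (\<lambda>k l. real p * G k l) = fdet n (\<lambda>k l. real p * of_bool (k = l) + (-1) * of_bool (k = l * p mod n))"
    by (rule fdet_cong) (use p in \<open>auto simp: G_def F_def right_diff_distrib\<close>)
  also have "\<dots> = fdet n (\<lambda>i j. real p * of_bool (j = i) + (-1) * of_bool (j = i * p mod n))"
    (is "_ = ?D") by (rule fdet_transpose)
  finally have G: "real p ^ n * fdet n G = ?D" .
  have "real (p - 1) * real p ^ n * fdet n E = real p ^ n * ((real p - 1) * fdet n E)"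
    using p by (simp add: of_nat_diff mult_ac)
  also have "\<dots> = real (p * n) * (real p ^ n * fdet n G)"
    unfolding EG by (simp add: mult_ac)
  finally show ?thesis
    unfolding G E_def .
qed

text \<open>\<open>M\<close> has zero row and column sums, so the correction left by the omitted
  index and the all-ones matrix are rank one updates that give multiples of one number
  \<open>\<kappa>\<close>: the first yields the count, the second is evaluated by
  \<open>fdet_de_Bruijn_adjacency\<close>.\<close>

lemma card_cyclic_block_maps:
  assumes p: "p > 1" and n: "n > 0"
  shows "real (card {\<beta> \<in> block_perms p n. \<forall>i<n * p. \<exists>k. (block_map p n \<beta> ^^ k) 0 = i}) * real n * real (p - 1) =
    fact (p - 1) ^ n * fdet n (\<lambda>i j. real p * of_bool (j = i) + (-1) * of_bool (j = i * p mod n))"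
    (is "real (card ?C) * _ * _ = _ * ?D")
proof -
  let ?N = "n * p"
  define A where "A = (\<lambda>k l. (\<Sum>j<p. of_bool ((l * p + j) mod n = k) :: real))"
  define M where "M = (\<lambda>k l. of_bool (l = k) - A k l / p)"
  define \<kappa> where "\<kappa> = fdet n (\<lambda>k l. M k l + of_bool (k = 0) * of_bool (l = 0))"
  have np: "0 < ?N" using p n by simp
  have fin: "finite (block_perms p n)"
    unfolding block_perms_def by (intro finite_PiE) (auto simp: finite_permutations)
  have "(\<Sum>k<n. A k l) = p" for l
  proof -
    have "(\<Sum>k<n. A k l) = (\<Sum>j<p. \<Sum>k<n. of_bool ((l * p + j) mod n = k) * 1)"
      unfolding A_def by (subst sum.swap) simp
    also have "\<dots> = (\<Sum>j<p. 1)"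
      using n by (intro sum.cong refl) (subst sum_of_bool_select, auto)
    finally show ?thesis by simp
  qed
  then have col: "(\<Sum>k<n. M k l) = 0" if "l < n" for l
    using that p sum_of_bool_select(2)[of l n "\<lambda>_. 1 :: real"]
    by (simp add: M_def sum_subtractf sum_divide_distrib[symmetric])
  have "(\<Sum>l<n. A k l) = p" if "k < n" for k
  proof -
    have "(\<Sum>l<n. A k l) = (\<Sum>i<n * p. of_bool (i mod n = k))"
      unfolding A_def by (rule sum_blocks[symmetric])
    also have "\<dots> = (\<Sum>i<p * n. of_bool (i mod n = k))"
      by (simp add: mult.commute)
    also have "\<dots> = (\<Sum>c<p. \<Sum>r<n. of_bool ((c * n + r) mod n = k))"
      by (rule sum_blocks)
    also have "\<dots> = (\<Sum>c<p. \<Sum>r<n. of_bool (r = k) * 1)"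
      by (intro sum.cong refl) auto
    also have "\<dots> = (\<Sum>c<p. 1)"
      using that by (intro sum.cong refl) (subst sum_of_bool_select, auto)
    finally show ?thesis by simp
  qed
  then have row: "(\<Sum>l<n. M k l) = 0" if "k < n" for k
    using that p sum_of_bool_select(1)[of k n "\<lambda>_. 1 :: real"]
    by (simp add: M_def sum_subtractf sum_divide_distrib[symmetric])
  note rank_one = fdet_rank_one_update[OF n row col]
  have "real (card ?C) = (\<Sum>\<beta>\<in>block_perms p n. of_bool (\<forall>i<?N. \<exists>k. (block_map p n \<beta> ^^ k) 0 = i))"
    using fin by (simp add: Int_def conj_commute)
  also have "\<dots> = (\<Sum>\<beta>\<in>block_perms p n. fdet ?N (\<lambda>i j. of_bool (j = i) + (- of_bool (i \<noteq> 0)) * of_bool (j = block_map p n \<beta> i)))"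
  proof (rule sum.cong[OF refl])
    fix \<beta> assume "\<beta> \<in> block_perms p n"
    then have perm: "block_map p n \<beta> permutes {..<?N}"
      using p n by (intro block_map_permutes) auto
    show "of_bool (\<forall>i<?N. \<exists>k. (block_map p n \<beta> ^^ k) 0 = i) =
      fdet ?N (\<lambda>i j. of_bool (j = i) + (- of_bool (i \<noteq> 0)) * of_bool (j = block_map p n \<beta> i) :: real)"
      by (subst fdet_reduced_permutation[OF perm np, symmetric], rule fdet_cong) auto
  qed
  also have "\<dots> = fact p ^ n * fdet ?N (\<lambda>i j. of_bool (j = i) + (- of_bool (i \<noteq> 0)) * (of_bool (j mod n = i div p) / p))"
    using p by (intro sum_block_perms_fdet) simp
  \<comment> \<open>Apart from the omitted row 0, the averaged entry depends on the row only through
    its block and on the column only through its residue, so it factors through \<open>n\<close>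
    indices.\<close>
  also have "fdet ?N (\<lambda>i j. of_bool (j = i) + (- of_bool (i \<noteq> 0)) * (of_bool (j mod n = i div p) / p)) =
    fdet ?N (\<lambda>i j. of_bool (j = i) - (\<Sum>k<n. (of_bool (i \<noteq> 0) * of_bool (i div p = k) / p) * of_bool (j mod n = k)))"
  proof (rule fdet_cong)
    fix i j assume "i < ?N" "j < ?N"
    have "(\<Sum>k<n. (of_bool (i \<noteq> 0) * of_bool (i div p = k) / p) * of_bool (j mod n = k)) =
       of_bool (i \<noteq> 0) * of_bool (i div p = j mod n) / real p"
      using n by (subst sum_of_bool_select) auto
    then show "of_bool (j = i) + (- of_bool (i \<noteq> 0)) * (of_bool (j mod n = i div p) / p) =
       of_bool (j = i) - (\<Sum>k<n. (of_bool (i \<noteq> 0) * of_bool (i div p = k) / real p) * of_bool (j mod n = k))"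
      by auto
  qed
  also have "\<dots> = fdet n (\<lambda>k l. of_bool (l = k) - (\<Sum>i<?N. of_bool (i mod n = k) * (of_bool (i \<noteq> 0) * of_bool (i div p = l) / p)))"
    by (rule fdet_sylvester)
  also have "\<dots> = fdet n (\<lambda>k l. M k l + of_bool (k = 0) / p * of_bool (l = 0))"
  proof (rule fdet_cong)
    fix k l assume kl: "k < n" "l < n"
    \<comment> \<open>The omitted position 0 lies in block 0 and has residue 0, so leaving it out
      changes only the corner.\<close>
    have "(\<Sum>i<?N. of_bool (i mod n = k) * (of_bool (i \<noteq> 0) * of_bool (i div p = l) / real p)) =
       (\<Sum>i<?N. of_bool (i mod n = k) * of_bool (i div p = l) / real p) -
       (\<Sum>i<?N. of_bool (i = 0) * (of_bool (i mod n = k) * of_bool (i div p = l) / real p))"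
      unfolding sum_subtractf[symmetric] by (intro sum.cong refl) auto
    also have "(\<Sum>i<?N. of_bool (i = 0) * (of_bool (i mod n = k) * of_bool (i div p = l) / real p)) =
       of_bool (k = 0) * of_bool (l = 0) / real p"
      using np by (subst sum_of_bool_select) auto
    also have "(\<Sum>i<?N. of_bool (i mod n = k) * of_bool (i div p = l) / real p) =
        (\<Sum>l'<n. \<Sum>j<p. of_bool ((l' * p + j) mod n = k) * of_bool ((l' * p + j) div p = l) / real p)"
      by (rule sum_blocks)
    also have "\<dots> = (\<Sum>l'<n. of_bool (l' = l) * (\<Sum>j<p. of_bool ((l' * p + j) mod n = k) / real p))"
      unfolding sum_distrib_left by (intro sum.cong refl) auto
    also have "\<dots> = A k l / p"
      unfolding A_def sum_divide_distrib using kl by (subst sum_of_bool_select) auto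
    finally show "of_bool (l = k) - (\<Sum>i<?N. of_bool (i mod n = k) * (of_bool (i \<noteq> 0) * of_bool (i div p = l) / p)) =
      M k l + of_bool (k = 0) / p * of_bool (l = 0)"
      by (simp add: M_def)
  qed
  also have "\<dots> = (\<Sum>k<n. of_bool (k = 0) * (1 / real p)) * (\<Sum>l<n. of_bool (l = 0) * 1) * \<kappa>"
    unfolding \<kappa>_def by (subst rank_one) auto
  also have "\<dots> = \<kappa> / p"
    using n by (subst (1 2) sum_of_bool_select) auto
  finally have card: "real (card ?C) = fact p ^ n * (\<kappa> / p)" .
  have "fdet n (\<lambda>k l. of_bool (l = k) - A k l / p + 1) = fdet n (\<lambda>k l. M k l + 1 * 1)"
    by (simp add: M_def)
  also have "\<dots> = real n * real n * \<kappa>"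
    unfolding \<kappa>_def by (subst rank_one) auto
  finally have "real (p - 1) * real p ^ n * (real n * real n * \<kappa>) = real (p * n) * ?D"
    using fdet_de_Bruijn_adjacency[OF p n] by (simp add: A_def)
  then have D: "real (p - 1) * real p ^ n * (real n * \<kappa>) = real p * ?D"
    using n by simp
  have fact: "fact p ^ n = real p ^ n * fact (p - 1) ^ n"
    using p by (simp add: fact_reduce power_mult_distrib)
  have "real p * (real (card ?C) * real n * real (p - 1)) =
      fact (p - 1) ^ n * (real (p - 1) * real p ^ n * (real n * \<kappa>))"
    unfolding card fact using p by simp
  also have "\<dots> = real p * (fact (p - 1) ^ n * ?D)"
    unfolding D by (simp only: mult_ac)
  finally have "real p * (real (card ?C) * real n * real (p - 1)) = real p * (fact (p - 1) ^ n * ?D)" .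
  then show ?thesis
    using p by simp
qed

section \<open>Polynomials without zeros at roots of unity\<close>

lemma prime_CHAR_alg_closure: "prime CHAR('p :: prime_card mod_ring alg_closure)"
  using prime_card[where 'a = 'p] by (simp add: CHAR_alg_closure_mod_ring)

lemma frobenius_add:
  fixes x y :: "'p :: prime_card mod_ring alg_closure"
  shows "(x + y) ^ CARD('p) = x ^ CARD('p) + y ^ CARD('p)"
  by (rule freshmans_dream) (use prime_CHAR_alg_closure in \<open>simp_all add: CHAR_alg_closure_mod_ring\<close>)

interpretation frobenius: comm_ring_hom "\<lambda>x :: 'p :: prime_card mod_ring alg_closure. x ^ CARD('p)"
  by unfold_locales (simp_all add: frobenius_add power_mult_distrib)

interpretation to_ac: field_hom "to_ac :: 'p :: prime_card mod_ring \<Rightarrow> 'p mod_ring alg_closure"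
  by unfold_locales simp_all

interpretation to_ac_poly: map_poly_comm_ring_hom "to_ac :: 'p :: prime_card mod_ring \<Rightarrow> 'p mod_ring alg_closure" ..

lemma frobenius_eq_iff:
  fixes x y :: "'p :: prime_card mod_ring alg_closure"
  shows "x ^ CARD('p) = y ^ CARD('p) \<longleftrightarrow> x = y"
proof
  assume "x ^ CARD('p) = y ^ CARD('p)"
  then have "(x - y) ^ CARD('p) = 0"
    using frobenius.hom_minus[of x y] by simp
  then show "x = y" by simp
qed simp

lemma card_mod_ring_power: "(a :: 'p :: prime_card mod_ring) ^ CARD('p) = a"
proof -
  obtain i where i: "a = of_nat i"
    using surj_of_nat_mod_ring by blast
  have "[i ^ CARD('p) = i] (mod CARD('p))"
  proof (cases "CARD('p) dvd i")
    case True
    moreover from this have "CARD('p) dvd i ^ CARD('p)"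
      using dvd_power[of "CARD('p)" i] dvd_trans zero_less_card_finite by blast
    ultimately show ?thesis
      by (simp add: cong_def mod_eq_0_iff_dvd)
  next
    case False
    then have "[i ^ (CARD('p) - 1) * i = 1 * i] (mod CARD('p))"
      by (intro cong_mult fermat_theorem prime_card) (simp_all add: cong_def)
    then show ?thesis
      by (simp add: power_eq_if[of i "CARD('p)"] mult.commute)
  qed
  then have "of_nat (i ^ CARD('p)) = (of_nat i :: 'p mod_ring)"
    by (metis cong_def of_nat_mod_CHAR semiring_char_mod_ring)
  then show ?thesis
    using i by simp
qed

lemma to_ac_frobenius: "to_ac (a :: 'p :: prime_card mod_ring) ^ CARD('p) = to_ac a"
  by (simp add: card_mod_ring_power flip: to_ac_power)

text \<open>The image of the prime field consists of fixed points of Frobenius, of which there are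
  just \<open>CARD('p)\<close>.\<close>

lemma range_to_ac: "range (to_ac :: 'p :: prime_card mod_ring \<Rightarrow> _) = {x. x ^ CARD('p) = x}"
proof (rule card_seteq)
  have card: "card {x :: 'p mod_ring alg_closure. x ^ CARD('p) = x} = CARD('p)"
    using card_GF_ext[of 1, where 'p = 'p] by (simp add: GF_ext_def)
  then show "finite {x :: 'p mod_ring alg_closure. x ^ CARD('p) = x}"
    using card_gt_0_iff[of "{x :: 'p mod_ring alg_closure. x ^ CARD('p) = x}"] by simp
  have "card (range (to_ac :: 'p mod_ring \<Rightarrow> _)) = CARD('p)"
    by (simp add: card_image[OF inj_to_ac])
  then show "card {x :: 'p mod_ring alg_closure. x ^ CARD('p) = x} \<le> card (range (to_ac :: 'p mod_ring \<Rightarrow> _))"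
    using card by simp
qed (auto simp: to_ac_frobenius)

lemma poly_frobenius:
  fixes f :: "'p :: prime_card mod_ring poly"
  shows "poly (map_poly to_ac f) (x ^ CARD('p)) = poly (map_poly to_ac f) x ^ CARD('p)"
proof -
  have "poly (map_poly to_ac f) x ^ CARD('p) =
      poly (map_poly (\<lambda>x. x ^ CARD('p)) (map_poly to_ac f)) (x ^ CARD('p))"
    by (rule frobenius.poly_map_poly[symmetric])
  also have "map_poly (\<lambda>x. x ^ CARD('p)) (map_poly to_ac f) = map_poly to_ac f"
    by (rule poly_eqI) (simp add: to_ac_frobenius)
  finally show ?thesis ..
qed

section \<open>Polynomials of bounded degree and prescribed zeros\<close>

definition small_polys :: "nat \<Rightarrow> 'a :: zero poly set" where
  "small_polys n = {f. \<forall>i\<ge>n. coeff f i = 0}"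

lemma small_polys_iff: "f \<in> small_polys n \<longleftrightarrow> f = 0 \<or> degree f < n"
proof
  assume f: "f \<in> small_polys n"
  show "f = 0 \<or> degree f < n"
  proof (rule ccontr)
    assume *: "\<not> (f = 0 \<or> degree f < n)"
    then have "coeff f (degree f) = 0"
      using f unfolding small_polys_def by simp
    then show False
      using * by simp
  qed
next
  assume "f = 0 \<or> degree f < n"
  then show "f \<in> small_polys n"
    unfolding small_polys_def by (auto intro: coeff_eq_0)
qed

lemma bij_betw_Poly_small_polys: "bij_betw Poly {xs :: 'a :: zero list. length xs = n} (small_polys n)"
proof (rule bij_betw_byWitness[where f' = "\<lambda>f. map (coeff f) [0..<n]"])
  show "\<forall>xs\<in>{xs :: 'a list. length xs = n}. map (coeff (Poly xs)) [0..<n] = xs"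
    by (auto intro!: nth_equalityI simp: nth_default_def)
  show "\<forall>f\<in>small_polys n. Poly (map (coeff f) [0..<n]) = (f :: 'a poly)"
    by (auto intro!: poly_eqI simp: small_polys_def nth_default_def)
  show "Poly ` {xs :: 'a list. length xs = n} \<subseteq> small_polys n"
    by (auto simp: small_polys_def nth_default_def)
qed auto

lemma card_small_polys: "card (small_polys n :: 'a :: {finite, zero} poly set) = CARD('a) ^ n"
  and finite_small_polys: "finite (small_polys n :: 'a :: {finite, zero} poly set)"
  using bij_betw_same_card[OF bij_betw_Poly_small_polys[of n, where 'a = 'a]]
    bij_betw_finite[OF bij_betw_Poly_small_polys[of n, where 'a = 'a]]
    card_lists_length_eq[of "UNIV :: 'a set" n] finite_lists_length_eq[of "UNIV :: 'a set" n]
  by simp_all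

lemma card_poly_roots_le:
  fixes f :: "'a :: idom poly"
  assumes "f \<noteq> 0" "Z \<subseteq> {x. poly f x = 0}"
  shows "card Z \<le> degree f"
  using card_mono[OF poly_roots_finite[OF assms(1)] assms(2)] card_poly_roots_bound[OF assms(1)] by simp

text \<open>Frobenius permutes \<open>Z\<close>, so it fixes the coefficients of the monic
  polynomial with simple zeros exactly at \<open>Z\<close>. That polynomial comes from some
  \<open>g\<close> over the prime field, and the polynomials to be counted are the multiples of
  \<open>g\<close>.\<close>

lemma card_small_polys_vanishing:
  fixes Z :: "'p :: prime_card mod_ring alg_closure set"
  assumes "finite Z" and frob: "\<And>z. z \<in> Z \<Longrightarrow> z ^ CARD('p) \<in> Z" and "card Z \<le> n"
  shows "card {f \<in> small_polys n. \<forall>z\<in>Z. poly (map_poly to_ac f) z = 0} = CARD('p) ^ (n - card Z)"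
proof -
  define P where "P = (\<Prod>z\<in>Z. [:-z, 1:])"
  have P0: "P \<noteq> 0" and degP: "degree P = card Z"
    using assms(1) by (auto simp: P_def degree_prod_eq_sum_degree)
  have rootsP: "poly P z = 0 \<longleftrightarrow> z \<in> Z" for z
    using assms(1) by (auto simp: P_def poly_prod)
  have "(\<lambda>z. z ^ CARD('p)) ` Z = Z"
    by (rule endo_inj_surj) (use assms(1) frob in \<open>auto simp: inj_on_def frobenius_eq_iff\<close>)
  then have "map_poly (\<lambda>x. x ^ CARD('p)) P = P"
  proof -
    interpret fp: map_poly_comm_ring_hom "\<lambda>x :: 'p mod_ring alg_closure. x ^ CARD('p)" ..
    have "map_poly (\<lambda>x. x ^ CARD('p)) P = (\<Prod>z\<in>Z. map_poly (\<lambda>x. x ^ CARD('p)) [:-z, 1:])"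
      unfolding P_def by (rule fp.hom_prod)
    also have "\<dots> = (\<Prod>z\<in>Z. [:-(z ^ CARD('p)), 1:])"
      by (intro prod.cong refl) (simp add: frobenius.map_poly_pCons_hom frobenius.hom_uminus)
    also have "\<dots> = (\<Prod>z\<in>(\<lambda>z. z ^ CARD('p)) ` Z. [:-z, 1:])"
      by (subst prod.reindex) (auto simp: inj_on_def frobenius_eq_iff)
    finally show ?thesis
      using \<open>_ ` Z = Z\<close> by (simp add: P_def)
  qed
  then have "coeff P i \<in> range to_ac" for i
    unfolding range_to_ac using frobenius.coeff_map_poly_hom[of P i] by simp
  then have "map_poly to_ac (map_poly of_ac P) = P"
    by (intro poly_eqI) (simp add: coeff_map_poly to_ac_of_ac)
  then obtain g :: "'p mod_ring poly" where g: "map_poly to_ac g = P"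
    by blast
  have degg: "degree g = card Z" and g0: "g \<noteq> 0"
    using degP P0 by (auto simp flip: g)
  have mult: "map_poly to_ac (f * h) = map_poly to_ac f * map_poly to_ac h" for f h :: "'p mod_ring poly"
    by (simp add: to_ac_poly.hom_mult)
  have eq: "{f \<in> small_polys n. \<forall>z\<in>Z. poly (map_poly to_ac f) z = 0} = (*) g ` small_polys (n - card Z)"
  proof (intro equalityI subsetI)
    fix f assume f: "f \<in> {f \<in> small_polys n. \<forall>z\<in>Z. poly (map_poly to_ac f) z = 0}"
    have fg: "f = g * (f div g) + f mod g"
      by simp
    have "f mod g = 0"
    proof (rule ccontr)
      assume "f mod g \<noteq> 0"
      then have "degree (f mod g) < card Z"
        using g0 degg degree_mod_less by metis
      moreover have "poly (map_poly to_ac (f mod g)) z = 0" if "z \<in> Z" for z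
      proof -
        have "poly (map_poly to_ac f) z = poly (map_poly to_ac (g * (f div g) + f mod g)) z"
          by simp
        also have "\<dots> = poly (map_poly to_ac (f mod g)) z"
          using that rootsP by (simp only: to_ac.map_poly_hom_add mult g poly_add poly_mult) simp
        finally show ?thesis
          using f that by simp
      qed
      then have "card Z \<le> degree (map_poly to_ac (f mod g))"
        using \<open>f mod g \<noteq> 0\<close> by (intro card_poly_roots_le) auto
      ultimately show False by simp
    qed
    then have fg: "f = g * (f div g)"
      using fg by simp
    have "f div g \<in> small_polys (n - card Z)"
    proof (cases "f div g = 0")
      case False
      then have "degree f = card Z + degree (f div g)"
        using g0 degg by (subst fg) (simp add: degree_mult_eq)
      moreover have "degree f < n"
        using f False by (auto simp: small_polys_iff)
      ultimately show ?thesis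
        by (auto simp: small_polys_iff)
    qed (simp add: small_polys_iff)
    then show "f \<in> (*) g ` small_polys (n - card Z)"
      using fg by blast
  next
    fix f assume "f \<in> (*) g ` small_polys (n - card Z)"
    then obtain h where h: "f = g * h" "h \<in> small_polys (n - card Z)"
      by blast
    have "f \<in> small_polys n"
    proof (cases "h = 0")
      case False
      then show ?thesis
        using h g0 degg by (auto simp: small_polys_iff degree_mult_eq)
    qed (simp add: h small_polys_iff)
    moreover have "poly (map_poly to_ac f) z = 0" if "z \<in> Z" for z
      using that rootsP by (simp add: h(1) mult g)
    ultimately show "f \<in> {f \<in> small_polys n. \<forall>z\<in>Z. poly (map_poly to_ac f) z = 0}"
      by simp
  qed
  have "inj_on ((*) g) (small_polys (n - card Z))"
    using g0 by (auto intro: inj_onI)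
  then show ?thesis
    unfolding eq by (simp add: card_image card_small_polys)
qed

text \<open>Induction on \<open>m\<close>: for \<open>m = q m'\<close> with \<open>q\<close> prime, take a \<open>q\<close>-th root of a primitive
  \<open>m'\<close>-th root of unity if \<open>q\<close> divides \<open>m'\<close>, and multiply by a primitive \<open>q\<close>-th root of unity
  otherwise.\<close>

lemma primitive_root_of_unity_exists:
  assumes "coprime m CHAR('a :: alg_closed_field)" "m > 0"
  shows "\<exists>z :: 'a. \<forall>k. z ^ k = 1 \<longleftrightarrow> m dvd k"
  using assms
proof (induction m rule: less_induct)
  case (less m)
  show ?case
  proof (cases "m = 1")
    case False
    then obtain q where q: "prime q" "q dvd m"
      using prime_factor_nat by blast
    then obtain m' where m': "m = q * m'"
      by blast
    have "m' < m" "m' > 0" "coprime m' CHAR('a)"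
      using less.prems q m' prime_gt_1_nat[OF q(1)] by auto
    then obtain w :: 'a where w: "\<And>k. w ^ k = 1 \<longleftrightarrow> m' dvd k"
      using less.IH by blast
    show ?thesis
    proof (cases "q dvd m'")
      case True
      obtain z where z: "z ^ q = w"
        using nth_root_exists prime_gt_0_nat[OF q(1)] by blast
      have "z ^ k = 1 \<longleftrightarrow> m dvd k" for k
      proof
        assume k: "z ^ k = 1"
        then have "w ^ k = 1"
          by (simp add: z[symmetric] power_mult[symmetric] mult.commute[of q]) (simp add: power_mult)
        then have "q dvd k"
          using True w dvd_trans by blast
        then obtain j where j: "k = q * j" by blast
        then have "w ^ j = 1"
          using k by (simp add: z[symmetric] power_mult)
        then show "m dvd k"
          using w m' j by simp
      next
        assume "m dvd k"
        then obtain j where "k = m * j"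
          by blast
        then have "k = q * (m' * j)"
          by (simp add: m' mult.assoc)
        then show "z ^ k = 1"
          using w[of "m' * j"] by (simp add: power_mult z)
      qed
      then show ?thesis by blast
    next
      case False
      have "CHAR('a) \<noteq> q"
        using less.prems(1) q m' by (auto simp: prime_gt_1_nat)
      moreover have "CHAR('a) \<noteq> 1"
        by simp
      ultimately have q0: "of_nat q \<noteq> (0 :: 'a)"
        using q(1) by (auto simp: of_nat_eq_0_iff_char_dvd prime_nat_iff)
      \<comment> \<open>This is \<open>(x^q - 1) / (x - 1)\<close>. Its value at 1 is
        \<open>q\<close>, nonzero in the field, so its zero is a \<open>q\<close>-th root of unity
        other than 1.\<close>
      define s where "s = (\<Sum>i<q. monom 1 i :: 'a poly)"
      have polys: "poly s x = (\<Sum>i<q. x ^ i)" for x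
        by (simp add: s_def poly_sum poly_monom)
      have "coeff s (q - 1) = 1"
        using prime_gt_1_nat[OF q(1)] by (simp add: s_def coeff_sum)
      then have "degree s > 0"
        using prime_gt_1_nat[OF q(1)] le_degree[of s "q - 1"] by auto
      then obtain u where u: "poly s u = 0"
        using alg_closed_imp_poly_has_root by blast
      have "u ^ q = 1"
        using power_diff_1_eq[of u q] u polys[of u] by simp
      moreover have "u \<noteq> 1"
        using u polys[of u] q0 by auto
      ultimately have u: "u ^ k = 1 \<longleftrightarrow> q dvd k" for k
      proof -
        have "u ^ k \<noteq> 1" if "\<not> q dvd k"
        proof
          assume k: "u ^ k = 1"
          have "coprime q k"
            using that q(1) by (simp add: prime_imp_coprime)
          then obtain x y where "q * x = k * y + 1"
            using bezout_nat[of q k] prime_gt_0_nat[OF q(1)] by (auto simp: coprime_iff_gcd_eq_1)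
          then have "u ^ (q * x) = u ^ (k * y) * u"
            by (simp add: mult.commute)
          then show False
            using k \<open>u ^ q = 1\<close> \<open>u \<noteq> 1\<close> by (simp add: power_mult)
        qed
        moreover have "u ^ k = 1" if "q dvd k"
          using that \<open>u ^ q = 1\<close> by (auto simp: power_mult)
        ultimately show ?thesis by blast
      qed
      have cop: "coprime q m'"
        using False q(1) by (simp add: prime_imp_coprime)
      have "(w * u) ^ k = 1 \<longleftrightarrow> m dvd k" for k
      proof
        assume k: "(w * u) ^ k = 1"
        have "(w * u) ^ (k * m') = 1" "(w * u) ^ (k * q) = 1"
          using k by (simp_all add: power_mult)
        moreover have "w ^ (k * m') = 1" "u ^ (k * q) = 1"
          using w[of "k * m'"] u[of "k * q"] by simp_all
        ultimately have "u ^ (k * m') = 1" "w ^ (k * q) = 1"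
          by (simp_all add: power_mult_distrib)
        then have "q dvd k * m'" "m' dvd k * q"
          using u w by simp_all
        then have "q dvd k" "m' dvd k"
          using cop by (simp_all add: coprime_dvd_mult_left_iff coprime_commute)
        then show "m dvd k"
          using cop m' by (simp add: divides_mult)
      next
        assume "m dvd k"
        then have "q dvd k" "m' dvd k"
          using m' by auto
        then have "u ^ k = 1" "w ^ k = 1"
          unfolding u w .
        then show "(w * u) ^ k = 1"
          by (simp add: power_mult_distrib)
      qed
      then show ?thesis by blast
    qed
  qed (auto intro: exI[of _ 1])
qed

definition nonvanishing_polys :: "nat \<Rightarrow> 'p :: prime_card mod_ring poly set" where
  "nonvanishing_polys n = {f \<in> small_polys n. \<forall>z. z ^ n = 1 \<longrightarrow> poly (map_poly to_ac f) z \<noteq> 0}"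

text \<open>The exponents at which a polynomial vanishes are closed under multiplication by
  \<open>p\<close> modulo \<open>n\<close>, so the Moebius identity for closed sets detects that
  there are none. After exchanging the sums, each \<open>S\<close> mapped onto itself is weighted by
  the number of polynomials vanishing on it.\<close>

lemma card_nonvanishing_polys:
  assumes n: "n > 0"
  shows "real (card (nonvanishing_polys n :: 'p :: prime_card mod_ring poly set)) =
    fdet n (\<lambda>i j. real CARD('p) * of_bool (j = i) + (-1) * of_bool (j = i * CARD('p) mod n))"
proof -
  let ?p = "CARD('p)"
  let ?V = "small_polys n :: 'p mod_ring poly set"
  have p: "prime ?p" by (rule prime_card)
  \<comment> \<open>Only the part \<open>m\<close> prime to \<open>p\<close> carries distinct roots:
    an \<open>n\<close>-th root of unity is already an \<open>m\<close>-th one because Frobenius is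
    injective.\<close>
  define a m where "a = multiplicity ?p n" and "m = n div ?p ^ a"
  have nm: "n = ?p ^ a * m"
    by (simp add: m_def a_def multiplicity_dvd)
  have "\<not> ?p dvd m"
    using multiplicity_decompose[of n ?p] n prime_gt_1_nat[OF p] by (simp add: m_def a_def)
  with p have "coprime ?p m"
    by (rule prime_imp_coprime)
  then have cop: "coprime m ?p"
    by (simp only: coprime_commute)
  have m0: "m > 0"
    using n nm by (cases m) auto
  have "coprime m CHAR('p mod_ring alg_closure)"
    unfolding CHAR_alg_closure_mod_ring by (rule cop)
  then obtain \<zeta> :: "'p mod_ring alg_closure" where \<zeta>: "\<And>k. \<zeta> ^ k = 1 \<longleftrightarrow> m dvd k"
    using primitive_root_of_unity_exists m0 by blast
  have \<zeta>0: "\<zeta> \<noteq> 0"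
    using \<zeta>[of m] m0 by (auto simp: power_0_left)
  have \<zeta>_eq: "i mod m = j mod m" if "\<zeta> ^ i = \<zeta> ^ j" for i j
  proof -
    have *: "i mod m = j mod m" if "\<zeta> ^ i = \<zeta> ^ j" "i \<le> j" for i j
    proof -
      have "\<zeta> ^ i * \<zeta> ^ (j - i) = \<zeta> ^ j"
        using that(2) by (simp only: power_add[symmetric] le_add_diff_inverse)
      then have "\<zeta> ^ (j - i) = 1"
        using that(1) \<zeta>0 by simp
      then have "m dvd j - i"
        unfolding \<zeta> .
      then show ?thesis
        using that(2) by (metis mod_eq_dvd_iff_nat)
    qed
    show ?thesis
      by (metis * that nat_le_linear)
  qed
  have \<zeta>_mod: "\<zeta> ^ (i mod n) = \<zeta> ^ i" for i
  proof -
    have "\<zeta> ^ i = \<zeta> ^ (n * (i div n)) * \<zeta> ^ (i mod n)"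
      by (simp add: power_add[symmetric])
    also have "\<zeta> ^ (n * (i div n)) = 1"
      unfolding \<zeta> by (simp add: nm)
    finally show ?thesis by simp
  qed
  have roots: "\<exists>k<n. z = \<zeta> ^ k" if z: "z ^ n = 1" for z
  proof -
    have inj: "x = y" if "x ^ ?p ^ i = y ^ ?p ^ i" for x y :: "'p mod_ring alg_closure" and i
      using that by (induction i) (auto simp: power_mult power_Suc2 frobenius_eq_iff simp del: power_Suc)
    have "(z ^ m) ^ ?p ^ a = 1 ^ ?p ^ a"
      using z by (simp add: nm power_mult[symmetric] mult.commute)
    then have zm: "z ^ m = 1"
      using inj by blast
    let ?f = "monom 1 m - 1 :: 'p mod_ring alg_closure poly"
    have f: "coeff ?f m = 1"
      using m0 by simp
    then have f0: "?f \<noteq> 0"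
      by (metis coeff_0 zero_neq_one)
    have "degree ?f \<le> m"
      by (intro degree_diff_le) (auto simp: degree_monom_le)
    have polyf: "poly ?f x = x ^ m - 1" for x
      by (simp add: poly_monom)
    have "inj_on (\<lambda>k. \<zeta> ^ k) {..<m}"
      using \<zeta>_eq by (intro inj_onI) fastforce
    then have "card ((\<lambda>k. \<zeta> ^ k) ` {..<m}) = m"
      by (simp add: card_image)
    moreover have "card {x. poly ?f x = 0} \<le> m"
      using card_poly_roots_le[OF f0 subset_refl] \<open>degree ?f \<le> m\<close> by simp
    moreover have "(\<lambda>k. \<zeta> ^ k) ` {..<m} \<subseteq> {x. poly ?f x = 0}"
    proof
      fix x assume "x \<in> (\<lambda>k. \<zeta> ^ k) ` {..<m}"
      then obtain k where "x = \<zeta> ^ k" by blast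
      then have "x ^ m = 1"
        by (simp only: power_mult[symmetric] \<zeta>) simp
      then show "x \<in> {x. poly ?f x = 0}"
        unfolding polyf by simp
    qed
    ultimately have "(\<lambda>k. \<zeta> ^ k) ` {..<m} = {x. poly ?f x = 0}"
      by (intro card_seteq poly_roots_finite f0) auto
    then have "z \<in> (\<lambda>k. \<zeta> ^ k) ` {..<m}"
      using zm unfolding polyf by simp
    then show ?thesis
    proof
      fix k assume "z = \<zeta> ^ k" "k \<in> {..<m}"
      moreover have "m \<le> n"
        using n nm by (intro dvd_imp_le) auto
      ultimately show ?thesis
        by (intro exI[of _ k]) auto
    qed
  qed
  define f where "f = (\<lambda>i. i * ?p mod n)"
  define Y where "Y = (\<lambda>v :: 'p mod_ring poly. {k. k < n \<and> poly (map_poly to_ac v) (\<zeta> ^ k) = 0})"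
  have \<zeta>f: "\<zeta> ^ f i = (\<zeta> ^ i) ^ ?p" for i
    by (simp add: f_def \<zeta>_mod power_mult)
  have Y: "Y v \<subseteq> {..<n}" "f ` Y v \<subseteq> Y v" for v
    using n by (auto simp: Y_def \<zeta>f poly_frobenius) (auto simp: f_def)
  have unit: "v \<in> nonvanishing_polys n \<longleftrightarrow> v \<in> ?V \<and> Y v = {}" for v
  proof -
    have "(\<zeta> ^ k) ^ n = 1" for k
      unfolding power_mult[symmetric] \<zeta> by (simp add: nm)
    then show ?thesis
      using roots unfolding nonvanishing_polys_def Y_def by blast
  qed
  have vanish: "card {v \<in> ?V. S \<subseteq> Y v} = ?p ^ (n - card S)" if S: "S \<subseteq> {..<n}" "f ` S = S" for S
  proof -
    have fin: "finite S"
      using S(1) finite_subset by blast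
    have inj: "inj_on (\<lambda>k. \<zeta> ^ k) S"
    proof (rule inj_onI)
      fix i j assume ij: "i \<in> S" "j \<in> S" "\<zeta> ^ i = \<zeta> ^ j"
      \<comment> \<open>Each element of \<open>S\<close> is again some \<open>l * p mod n\<close>
        with \<open>l\<close> in \<open>S\<close>, so going back \<open>b\<close> times shows
        divisibility by \<open>p ^ b\<close>, as long as this divides \<open>n\<close>. Exponents
        naming the same root agree modulo \<open>m\<close> and modulo \<open>p ^ a\<close>, hence
        coincide.\<close>
      have dvd: "?p ^ b dvd k" if "b \<le> a" "k \<in> S" for b k
        using that
      proof (induction b arbitrary: k)
        case (Suc b)
        then obtain l where l: "l \<in> S" "k = f l"
          using S(2) by blast
        then have "?p ^ Suc b dvd l * ?p"
          using Suc by (simp add: mult.commute)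
        moreover have "?p ^ Suc b dvd n"
          using Suc.prems unfolding nm by (meson dvd_mult2 le_imp_power_dvd)
        ultimately show ?case
          by (simp add: l f_def dvd_mod)
      qed simp
      have "i mod m = j mod m" "i mod ?p ^ a = j mod ?p ^ a"
        using \<zeta>_eq[OF ij(3)] dvd[of a i] dvd[of a j] ij by auto
      then have "[i = j] (mod m * ?p ^ a)"
        using cop by (intro coprime_cong_mult_nat) (auto simp: cong_def)
      then have "[i = j] (mod n)"
        by (subst nm) (simp add: mult.commute)
      moreover have "i < n" "j < n"
        using ij S(1) by auto
      ultimately show "i = j"
        by (simp add: cong_def)
    qed
    have "card {v \<in> ?V. S \<subseteq> Y v} = card {v \<in> ?V. \<forall>z\<in>(\<lambda>k. \<zeta> ^ k) ` S. poly (map_poly to_ac v) z = 0}"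
      using S(1) by (intro arg_cong[of _ _ card]) (auto simp: Y_def)
    also have "\<dots> = ?p ^ (n - card ((\<lambda>k. \<zeta> ^ k) ` S))"
    proof (rule card_small_polys_vanishing)
      show "z ^ ?p \<in> (\<lambda>k. \<zeta> ^ k) ` S" if "z \<in> (\<lambda>k. \<zeta> ^ k) ` S" for z
        using that S(2) \<zeta>f by (metis (no_types, lifting) imageE imageI)
      show "card ((\<lambda>k. \<zeta> ^ k) ` S) \<le> n"
        using card_mono[OF _ S(1)] card_image_le[OF fin, of "\<lambda>k. \<zeta> ^ k"] by simp
    qed (use fin in simp)
    finally show ?thesis
      using inj by (simp add: card_image)
  qed
  have "real (card (nonvanishing_polys n :: 'p mod_ring poly set)) = (\<Sum>v\<in>?V. of_bool (Y v = {}))"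
  proof -
    have "nonvanishing_polys n = {v \<in> ?V. Y v = {}}"
      using unit by blast
    then show ?thesis
      using finite_small_polys[of n, where 'a = "'p mod_ring"] by (simp add: Int_def conj_commute)
  qed
  also have "\<dots> = (\<Sum>v\<in>?V. \<Sum>S\<in>Pow (Y v). (-1) ^ card S * functional_minor n f S)"
    using Y by (intro sum.cong refl sum_functional_minor_closed[symmetric]) auto
  also have "\<dots> = (\<Sum>v\<in>?V. \<Sum>S\<in>Pow {..<n}. of_bool (S \<subseteq> Y v) * ((-1) ^ card S * functional_minor n f S))"
    using Y(1) by (intro sum.cong refl sum.mono_neutral_cong_left) auto
  also have "\<dots> = (\<Sum>S\<in>Pow {..<n}. real (card {v \<in> ?V. S \<subseteq> Y v}) * ((-1) ^ card S * functional_minor n f S))"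
    by (subst sum.swap)
       (use finite_small_polys[of n, where 'a = "'p mod_ring"] in \<open>simp add: sum_distrib_right[symmetric] Int_def conj_commute\<close>)
  also have "\<dots> = (\<Sum>S\<in>Pow {..<n}. (\<Prod>i\<in>S. -1) * (\<Prod>i\<in>{..<n}-S. real ?p) * functional_minor n f S)"
  proof (rule sum.cong[OF refl])
    fix S assume S: "S \<in> Pow {..<n}"
    show "real (card {v \<in> ?V. S \<subseteq> Y v}) * ((-1) ^ card S * functional_minor n f S) =
       (\<Prod>i\<in>S. -1) * (\<Prod>i\<in>{..<n}-S. real ?p) * functional_minor n f S"
    proof (cases "f ` S = S")
      case True
      have "card ({..<n} - S) = n - card S"
        using S by (subst card_Diff_subset) (auto intro: finite_subset)
      then show ?thesis
        using vanish[OF _ True] S by simp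
    next
      case False
      then have "functional_minor n f S = (0 :: real)"
        using S n by (intro functional_minor_eq_0) (auto simp: f_def)
      then show ?thesis by simp
    qed
  qed
  also have "\<dots> = fdet n (\<lambda>i j. real ?p * of_bool (j = i) + (-1) * of_bool (j = f i))"
    by (rule fdet_functional_expand[symmetric])
  finally show ?thesis
    by (simp only: f_def)
qed

section \<open>Normal elements\<close>

definition cyc_poly :: "nat \<Rightarrow> 'p :: prime_card mod_ring poly" where
  "cyc_poly n = monom 1 n - 1"

lemma degree_cyc_poly: "n > 0 \<Longrightarrow> degree (cyc_poly n :: 'p :: prime_card mod_ring poly) = n"
  unfolding cyc_poly_def diff_conv_add_uminus
  by (subst degree_add_eq_left) (simp_all add: degree_monom_eq)

lemma cyc_poly_nonzero: "n > 0 \<Longrightarrow> (cyc_poly n :: 'p :: prime_card mod_ring poly) \<noteq> 0"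
  using degree_cyc_poly[of n, where 'p = 'p] by (metis degree_0 less_irrefl)

lemma poly_cyc_poly: "poly (map_poly to_ac (cyc_poly n)) z = z ^ n - 1"
  by (simp add: cyc_poly_def to_ac_poly.hom_minus poly_monom)

lemma small_polys_dvd:
  fixes f :: "'p :: prime_card mod_ring poly"
  assumes "n > 0" "cyc_poly n dvd f" "f \<in> small_polys n"
  shows "f = 0"
proof (rule ccontr)
  assume "f \<noteq> 0"
  then have "degree (cyc_poly n :: 'p mod_ring poly) \<le> degree f"
    using assms(2) by (intro dvd_imp_degree_le)
  then show False
    using assms(3) \<open>f \<noteq> 0\<close> degree_cyc_poly[OF assms(1), where 'p = 'p] by (simp add: small_polys_iff)
qed

text \<open>If \<open>v\<close> and \<open>cyc_poly n\<close> are coprime, a Bezout identity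
  excludes common zeros, and \<open>v\<close> can be cancelled from the divisibility. Otherwise the
  quotient of \<open>cyc_poly n\<close> by the gcd is a nonzero small polynomial that kills
  \<open>v\<close>, and a zero of the gcd is a common zero.\<close>

lemma nonvanishing_polys_iff:
  fixes v :: "'p :: prime_card mod_ring poly"
  assumes n: "n > 0"
  shows "v \<in> nonvanishing_polys n \<longleftrightarrow>
    v \<in> small_polys n \<and> (\<forall>f\<in>small_polys n. cyc_poly n dvd f * v \<longrightarrow> f = 0)"
proof -
  let ?d = "gcd v (cyc_poly n)"
  have "(\<forall>z. z ^ n = 1 \<longrightarrow> poly (map_poly to_ac v) z \<noteq> 0) \<longleftrightarrow>
        (\<forall>f\<in>small_polys n. cyc_poly n dvd f * v \<longrightarrow> f = 0)"
  proof (cases "is_unit ?d")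
    case True
    then have cop: "coprime v (cyc_poly n)"
      by (simp only: is_unit_gcd)
    have "\<forall>f\<in>small_polys n. cyc_poly n dvd f * v \<longrightarrow> f = 0"
      using cop small_polys_dvd[OF n] by (auto simp: coprime_dvd_mult_left_iff coprime_commute)
    moreover have "poly (map_poly to_ac v) z \<noteq> 0" if z: "z ^ n = 1" for z
    proof
      assume vz: "poly (map_poly to_ac v) z = 0"
      obtain a b where "a * v + b * cyc_poly n = 1"
        using cop bezout_coefficients_fst_snd[of v "cyc_poly n"] by (metis coprime_iff_gcd_eq_1)
      then have "poly (map_poly to_ac (a * v + b * cyc_poly n)) z = 1"
        by simp
      then show False
        by (simp only: to_ac_poly.hom_add to_ac_poly.hom_mult poly_add poly_mult vz poly_cyc_poly z) simp
    qed
    ultimately show ?thesis by blast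
  next
    case False
    have d0: "?d \<noteq> 0"
      using cyc_poly_nonzero[OF n, where 'p = 'p] by simp
    then have deg: "degree ?d > 0"
      using False by (simp add: is_unit_iff_degree)
    obtain h where h: "cyc_poly n = ?d * h"
      using gcd_dvd2[of v "cyc_poly n"] by (elim dvdE)
    obtain v' where v': "v = ?d * v'"
      using gcd_dvd1[of v "cyc_poly n"] by (elim dvdE)
    have "degree (map_poly to_ac ?d) > 0"
      using deg by simp
    then obtain z where z: "poly (map_poly to_ac ?d) z = 0"
      using alg_closed_imp_poly_has_root by blast
    have "poly (map_poly to_ac (?d * h)) z = 0" "poly (map_poly to_ac (?d * v')) z = 0"
      by (simp_all only: to_ac_poly.hom_mult poly_mult z mult_zero_left)
    then have "z ^ n = 1 \<and> poly (map_poly to_ac v) z = 0"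
      unfolding h[symmetric] v'[symmetric] by (simp add: poly_cyc_poly)
    moreover have "h \<noteq> 0"
      using h cyc_poly_nonzero[OF n, where 'p = 'p] by auto
    moreover have "h \<in> small_polys n"
    proof -
      have "n = degree ?d + degree h"
        using degree_cyc_poly[OF n, where 'p = 'p] d0 \<open>h \<noteq> 0\<close> by (subst (asm) h) (simp add: degree_mult_eq)
      then show ?thesis
        using deg by (simp add: small_polys_iff)
    qed
    moreover have "cyc_poly n dvd h * v"
    proof -
      have "h * v = ?d * h * v'"
        by (subst v') (simp add: mult_ac)
      then show ?thesis
        by (metis h dvd_triv_left)
    qed
    ultimately show ?thesis by blast
  qed
  then show ?thesis
    by (simp add: nonvanishing_polys_def)
qed

text \<open>\<open>GF_ext n\<close> as a module over polynomials, the variable acting as the Frobenius map.\<close>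

definition frob_act :: "'p :: prime_card mod_ring poly \<Rightarrow> 'p mod_ring alg_closure \<Rightarrow> 'p mod_ring alg_closure" where
  "frob_act f x = (\<Sum>i\<le>degree f. to_ac (coeff f i) * x ^ (CARD('p) ^ i))"

lemma frob_act_sum:
  fixes x :: "'p :: prime_card mod_ring alg_closure"
  assumes "f \<in> small_polys n"
  shows "frob_act f x = (\<Sum>i<n. to_ac (coeff f i) * x ^ (CARD('p) ^ i))"
proof (cases "f = 0")
  case False
  then have "degree f < n"
    using assms by (simp add: small_polys_iff)
  then show ?thesis
    unfolding frob_act_def by (intro sum.mono_neutral_left) (auto simp: coeff_eq_0)
qed (simp add: frob_act_def)

lemma small_polys_Suc_degree: "f \<in> small_polys (Suc (degree f))"
  by (simp add: small_polys_iff)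

lemma small_polys_mono: "f \<in> small_polys m \<Longrightarrow> m \<le> n \<Longrightarrow> f \<in> small_polys n"
  by (auto simp: small_polys_def)

lemma frob_act_0 [simp]: "frob_act 0 x = 0"
  by (simp add: frob_act_def)

lemma frob_act_zero_right [simp]: "frob_act f 0 = 0"
  by (simp add: frob_act_def power_0_left)

lemma frob_act_monom: "frob_act (monom c i) (x :: 'p :: prime_card mod_ring alg_closure) = to_ac c * x ^ (CARD('p) ^ i)"
proof -
  have "monom c i \<in> small_polys (Suc i)"
    by (auto simp: small_polys_def)
  then show ?thesis
    by (subst frob_act_sum) (auto simp: if_distrib if_distribR sum.delta cong: if_cong)
qed

lemma frob_act_add: "frob_act (f + g) x = frob_act f x + frob_act g x"
proof -
  define N where "N = Suc (max (degree f) (degree g))"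
  have f: "f \<in> small_polys N" and g: "g \<in> small_polys N"
    using small_polys_mono[OF small_polys_Suc_degree, of f N] small_polys_mono[OF small_polys_Suc_degree, of g N]
    by (auto simp: N_def)
  then have fg: "f + g \<in> small_polys N"
    by (simp add: small_polys_def)
  show ?thesis
    by (simp add: frob_act_sum[OF f] frob_act_sum[OF g] frob_act_sum[OF fg] distrib_right sum.distrib)
qed

lemma frob_act_uminus: "frob_act (- f) x = - frob_act f x"
  using frob_act_add[of f "- f" x] by (simp add: eq_neg_iff_add_eq_0 add.commute)

lemma frob_act_diff: "frob_act (f - g) x = frob_act f x - frob_act g x"
  using frob_act_add[of f "- g" x] by (simp add: frob_act_uminus)

lemma frob_act_pCons: "frob_act (pCons a f) (x :: 'p :: prime_card mod_ring alg_closure) = to_ac a * x + frob_act f x ^ CARD('p)"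
proof -
  have f: "f \<in> small_polys (Suc (degree f))"
    by (rule small_polys_Suc_degree)
  have pf: "pCons a f \<in> small_polys (Suc (Suc (degree f)))"
    by (auto simp: small_polys_def coeff_pCons coeff_eq_0 split: nat.splits)
  have "frob_act f x ^ CARD('p) = (\<Sum>i<Suc (degree f). to_ac (coeff f i) * x ^ (CARD('p) ^ Suc i))"
    unfolding frob_act_sum[OF f] frobenius.hom_sum
    by (intro sum.cong refl) (simp add: power_mult_distrib to_ac_frobenius power_mult[symmetric] mult.commute)
  then show ?thesis
    unfolding frob_act_sum[OF pf] sum.lessThan_Suc_shift by simp
qed

lemma frob_act_smult: "frob_act (smult c f) x = to_ac c * frob_act f x"
proof -
  have f: "f \<in> small_polys (Suc (degree f))"
    by (rule small_polys_Suc_degree)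
  then have cf: "smult c f \<in> small_polys (Suc (degree f))"
    by (simp add: small_polys_def)
  show ?thesis
    by (simp only: frob_act_sum[OF f] frob_act_sum[OF cf] sum_distrib_left coeff_smult to_ac_mult mult.assoc)
qed

text \<open>Frobenius is additive and fixes the coefficients, so multiplying by the variable amounts
  to raising the value to the power \<open>CARD('p)\<close>. Horner's scheme then gives the module
  law.\<close>

lemma frob_act_mult: "frob_act (f * g) x = frob_act f (frob_act g x)"
proof (induction f)
  case (pCons a f)
  have "frob_act (pCons a f * g) x = frob_act (smult a g + pCons 0 (f * g)) x"
    by simp
  also have "\<dots> = to_ac a * frob_act g x + frob_act (f * g) x ^ CARD('a)"
    by (simp only: frob_act_add frob_act_smult frob_act_pCons) simp
  also have "\<dots> = frob_act (pCons a f) (frob_act g x)"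
    by (simp add: frob_act_pCons pCons.IH)
  finally show ?case .
qed simp

lemma frob_act_cyc_poly: "frob_act (cyc_poly n) x = 0 \<longleftrightarrow> x \<in> GF_ext n"
proof -
  have "frob_act (cyc_poly n) x = frob_act (monom 1 n) x - frob_act (monom 1 0) x"
    by (simp add: cyc_poly_def frob_act_diff)
  then show ?thesis
    by (simp only: frob_act_monom) (simp add: GF_ext_def)
qed

lemma frob_act_GF_ext: "x \<in> GF_ext n \<Longrightarrow> frob_act f x \<in> GF_ext n"
  by (metis frob_act_cyc_poly frob_act_mult frob_act_zero_right mult.commute)

text \<open>The action of \<open>f\<close> is evaluation of a linearised polynomial. Its terms sit
  at the distinct exponents \<open>CARD('p) ^ i\<close>, so the leading coefficient of
  \<open>f\<close> survives and the degree bounds the number of zeros.\<close>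

lemma card_frob_act_kernel:
  fixes f :: "'p :: prime_card mod_ring poly"
  assumes "f \<noteq> 0"
  shows "finite {x. frob_act f x = 0}" "card {x. frob_act f x = 0} \<le> CARD('p) ^ degree f"
proof -
  define L where "L = (\<Sum>i\<le>degree f. monom (to_ac (coeff f i)) (CARD('p) ^ i))"
  have L: "poly L x = frob_act f x" for x
    by (simp add: L_def frob_act_def poly_sum poly_monom)
  have p: "CARD('p) > 1"
    using prime_card[where 'a = 'p] prime_gt_1_nat by blast
  have "coeff L (CARD('p) ^ degree f) = (\<Sum>i\<le>degree f. if i = degree f then to_ac (coeff f i) else 0)"
    unfolding L_def coeff_sum coeff_monom using p by (intro sum.cong) auto
  also have "\<dots> \<noteq> 0"
    using assms by simp
  finally have L0: "L \<noteq> 0"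
    by auto
  have "degree L \<le> CARD('p) ^ degree f"
    unfolding L_def using p
    by (intro degree_sum_le order_trans[OF degree_monom_le]) (auto intro: power_increasing)
  then show "finite {x. frob_act f x = 0}" "card {x. frob_act f x = 0} \<le> CARD('p) ^ degree f"
    using card_poly_roots_le[OF L0 subset_refl] poly_roots_finite[OF L0] by (simp_all add: L)
qed

section \<open>Counting elements by their annihilator\<close>

lemma sum_card_fibres:
  assumes "finite A" "finite C" "s ` A \<subseteq> C"
  shows "(\<Sum>c\<in>C. card {x \<in> A. s x = c}) = card A"
proof -
  have "(\<Sum>c\<in>C. card {x \<in> A. s x = c}) = card (\<Union>c\<in>C. {x \<in> A. s x = c})"
    by (rule card_UN_disjoint[symmetric]) (use assms in auto)
  also have "(\<Union>c\<in>C. {x \<in> A. s x = c}) = A"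
    using assms(3) by blast
  finally show ?thesis .
qed

text \<open>Summed over all values, both sides give the common cardinality, so inequalities at every
  value are equalities. At values not attained on \<open>A\<close> the inequality is
  trivial.\<close>

lemma card_fibres_eq:
  fixes s :: "'a \<Rightarrow> 'c" and t :: "'b \<Rightarrow> 'c"
  assumes "finite A" "finite B" "card A = card B"
    and le: "\<And>a. a \<in> A \<Longrightarrow> card {x \<in> A. s x = s a} \<le> card {y \<in> B. t y = s a}"
  shows "card {x \<in> A. s x = c} = card {y \<in> B. t y = c}"
proof (cases "c \<in> s ` A \<union> t ` B")
  case True
  have "(\<Sum>c\<in>s ` A \<union> t ` B. card {x \<in> A. s x = c}) = (\<Sum>c\<in>s ` A \<union> t ` B. card {x \<in> B. t x = c})"
    using assms by (simp add: sum_card_fibres)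
  then show ?thesis
  proof (rule sum_mono_inv)
    fix c show "card {x \<in> A. s x = c} \<le> card {y \<in> B. t y = c}"
    proof (cases "c \<in> s ` A")
      case False
      then have "{x \<in> A. s x = c} = {}" by auto
      then show ?thesis by (simp only: card.empty le0)
    qed (use le in auto)
  qed (use True assms in auto)
next
  case False
  then have "{x \<in> A. s x = c} = {}" "{y \<in> B. t y = c} = {}" by auto
  then show ?thesis by (simp only: card.empty)
qed

text \<open>\<open>GF_ext n\<close> and the quotient by \<open>cyc_poly n\<close> have equally many elements with a given
  annihilator. For \<open>\<gamma>\<close> with annihilator \<open>(g)\<close> and \<open>cyc_poly n = g h\<close>, sending
  \<open>frob_act r \<gamma>\<close> with \<open>degree r < degree g\<close> to \<open>r h\<close> gives one inequality, and both sides have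
  \<open>p\<^sup>n\<close> elements in total.\<close>

lemma card_annihilator_eq:
  fixes I :: "'p :: prime_card mod_ring poly set"
  assumes n: "n > 0"
  shows "card {x \<in> GF_ext n. {f. frob_act f x = 0} = I} = card {v \<in> small_polys n. {f. cyc_poly n dvd f * v} = I}"
proof (rule card_fibres_eq)
  let ?p = "CARD('p)" and ?G = "GF_ext n :: 'p mod_ring alg_closure set"
  have cardG: "card ?G = ?p ^ n"
    using n by (rule card_GF_ext)
  then show "card ?G = card (small_polys n :: 'p mod_ring poly set)"
    by (simp add: card_small_polys)
  show "finite ?G"
    using cardG card_gt_0_iff[of ?G] by simp
  show "finite (small_polys n :: 'p mod_ring poly set)"
    by (rule finite_small_polys)
  fix \<gamma> assume \<gamma>: "\<gamma> \<in> ?G"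
  let ?P = "\<lambda>g. g \<noteq> 0 \<and> frob_act g \<gamma> = 0"
  \<comment> \<open>By division with remainder, a nonzero polynomial of least degree killing
    \<open>\<gamma>\<close> generates the annihilator.\<close>
  define g where "g = arg_min degree ?P"
  have "?P (cyc_poly n)"
    using \<gamma> cyc_poly_nonzero[OF n, where 'p = 'p] by (simp add: frob_act_cyc_poly)
  then have g: "?P g" and g_min: "degree g \<le> degree f" if "?P f" for f
    using arg_min_natI[of ?P _ degree] arg_min_nat_le[of ?P _ degree] that unfolding g_def by blast+
  have g0: "g \<noteq> 0" and actg: "frob_act g \<gamma> = 0"
    using g[OF \<open>?P (cyc_poly n)\<close>] by auto
  have small0: "f = 0" if "f \<in> small_polys (degree g)" "frob_act f \<gamma> = 0" for f
    using g_min[of f] that by (cases "f = 0") (auto simp: small_polys_iff)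
  have ann: "frob_act f \<gamma> = 0 \<longleftrightarrow> g dvd f" for f
  proof
    assume "g dvd f"
    then obtain k where "f = g * k" by (elim dvdE)
    then have "f = k * g" by (simp only: mult.commute)
    then show "frob_act f \<gamma> = 0"
      using actg by (simp add: frob_act_mult)
  next
    assume f: "frob_act f \<gamma> = 0"
    have "frob_act (f div g * g + f mod g) \<gamma> = 0"
      using f by simp
    then have "frob_act (f mod g) \<gamma> = 0"
      by (simp only: frob_act_add frob_act_mult actg frob_act_zero_right add_0_left)
    moreover have "f mod g \<in> small_polys (degree g)"
      using g0 degree_mod_less[of g f] by (auto simp: small_polys_iff)
    ultimately have "f mod g = 0"
      by (rule small0[rotated])
    then show "g dvd f"
      by (simp only: dvd_eq_mod_eq_0)
  qed
  obtain h where h: "cyc_poly n = g * h"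
    using ann[of "cyc_poly n"] \<gamma> unfolding frob_act_cyc_poly by (meson dvdE)
  have h0: "h \<noteq> 0"
    using h cyc_poly_nonzero[OF n, where 'p = 'p] by auto
  have deg: "degree g + degree h = n"
    using degree_cyc_poly[OF n, where 'p = 'p] g0 h0 by (subst (asm) h) (simp add: degree_mult_eq)
  let ?S = "small_polys (degree g) :: 'p mod_ring poly set"
  have inj: "inj_on (\<lambda>r. frob_act r \<gamma>) ?S"
  proof (rule inj_onI)
    fix r s assume rs: "r \<in> ?S" "s \<in> ?S" "frob_act r \<gamma> = frob_act s \<gamma>"
    then have "r - s \<in> ?S"
      by (simp add: small_polys_def)
    then show "r = s"
      using small0[of "r - s"] rs by (simp add: frob_act_diff)
  qed
  \<comment> \<open>The injective image has as many elements as the kernel of \<open>g\<close> can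
    have, so everything killed by \<open>g\<close> is obtained from \<open>\<gamma>\<close>.\<close>
  have K: "(\<lambda>r. frob_act r \<gamma>) ` ?S = {x. frob_act g x = 0}"
  proof (rule card_seteq)
    show "(\<lambda>r. frob_act r \<gamma>) ` ?S \<subseteq> {x. frob_act g x = 0}"
      using actg by (auto simp flip: frob_act_mult) (simp add: mult.commute[of g] frob_act_mult)
    show "card {x. frob_act g x = 0} \<le> card ((\<lambda>r. frob_act r \<gamma>) ` ?S)"
      using card_frob_act_kernel(2)[OF g0] by (simp add: card_image[OF inj] card_small_polys)
  qed (rule card_frob_act_kernel(1)[OF g0])
  let ?I = "{f. frob_act f \<gamma> = 0}"
  define R where "R = {r \<in> ?S. {f. frob_act f (frob_act r \<gamma>) = 0} = ?I}"
  have finR: "finite R"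
    unfolding R_def using finite_small_polys[of "degree g", where 'a = "'p mod_ring"] by simp
  have sub: "{x \<in> ?G. {f. frob_act f x = 0} = ?I} \<subseteq> (\<lambda>r. frob_act r \<gamma>) ` R"
  proof
    fix x assume x: "x \<in> {x \<in> ?G. {f. frob_act f x = 0} = ?I}"
    then have "frob_act g x = 0"
      using actg by blast
    then obtain r where "r \<in> ?S" "x = frob_act r \<gamma>"
      using K by blast
    then show "x \<in> (\<lambda>r. frob_act r \<gamma>) ` R"
      using x unfolding R_def by blast
  qed
  have "card {x \<in> ?G. {f. frob_act f x = 0} = ?I} \<le> card R"
    using card_mono[OF _ sub] card_image_le[OF finR, of "\<lambda>r. frob_act r \<gamma>"] finR by (meson finite_imageI order_trans)
  also have "\<dots> = card ((\<lambda>r. r * h) ` R)"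
    using h0 by (intro card_image[symmetric] inj_onI) simp
  also have "\<dots> \<le> card {v \<in> small_polys n. {f. cyc_poly n dvd f * v} = ?I}"
  proof (rule card_mono)
    show "(\<lambda>r. r * h) ` R \<subseteq> {v \<in> small_polys n. {f. cyc_poly n dvd f * v} = ?I}"
    proof safe
      fix r assume r: "r \<in> R"
      show "r * h \<in> small_polys n"
      proof (cases "r = 0")
        case False
        then show ?thesis
          using r h0 deg by (auto simp: R_def small_polys_iff degree_mult_eq)
      qed (simp add: small_polys_iff)
      \<comment> \<open>Cancelling \<open>h\<close> turns divisibility by \<open>g * h\<close> into
        divisibility of \<open>f * r\<close> by \<open>g\<close>, which says that \<open>f\<close>
        kills \<open>frob_act r \<gamma>\<close>.\<close>
      have iff: "cyc_poly n dvd f * (r * h) \<longleftrightarrow> frob_act f \<gamma> = 0" for f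
      proof -
        have "cyc_poly n dvd f * (r * h) \<longleftrightarrow> g dvd f * r"
          using h0 by (simp add: h mult.assoc[symmetric])
        also have "\<dots> \<longleftrightarrow> frob_act f (frob_act r \<gamma>) = 0"
          by (simp add: ann[symmetric] frob_act_mult)
        also have "\<dots> \<longleftrightarrow> frob_act f \<gamma> = 0"
          using r by (auto simp: R_def)
        finally show ?thesis .
      qed
      show "frob_act f \<gamma> = 0" if "cyc_poly n dvd f * (r * h)" for f
        using iff that by blast
      show "cyc_poly n dvd f * (r * h)" if "frob_act f \<gamma> = 0" for f
        using iff that by blast
    qed
  qed (use finite_small_polys[of n, where 'a = "'p mod_ring"] in simp)
  finally show "card {x \<in> ?G. {f. frob_act f x = 0} = ?I} \<le> card {v \<in> small_polys n. {f. cyc_poly n dvd f * v} = ?I}" .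
qed

text \<open>A linear relation among the conjugates is a polynomial of degree below \<open>n\<close>
  killing \<open>\<gamma>\<close>. If only 0 does, the \<open>CARD('p) ^ n\<close> combinations are
  distinct and fill \<open>GF_ext n\<close>, so spanning comes from counting.\<close>

lemma normal_elements_iff:
  fixes \<gamma> :: "'p :: prime_card mod_ring alg_closure"
  assumes n: "n > 0"
  shows "\<gamma> \<in> normal_elements n \<longleftrightarrow> \<gamma> \<in> GF_ext n \<and> (\<forall>f\<in>small_polys n. frob_act f \<gamma> = 0 \<longrightarrow> f = 0)"
proof -
  let ?p = "CARD('p)"
  define c where "c = (\<lambda>i. \<gamma> ^ (?p ^ i))"
  have norm: "\<gamma> \<in> normal_elements n \<longleftrightarrow>
    \<gamma> \<in> GF_ext n \<and> inj_on c {..<n} \<and> GF.independent (c ` {..<n}) \<and> GF.span (c ` {..<n}) = GF_ext n"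
    by (simp add: normal_elements_def c_def Let_def)
  have act: "frob_act f \<gamma> = (\<Sum>i<n. GF_scale (coeff f i) (c i))" if "f \<in> small_polys n" for f
    using frob_act_sum[OF that] by (simp add: GF_scale_def c_def)
  have coeffs: "\<exists>f\<in>small_polys n. \<forall>i<n. coeff f i = a i" for a :: "nat \<Rightarrow> 'p mod_ring"
    by (rule bexI[of _ "Poly (map a [0..<n])"]) (auto simp: small_polys_def nth_default_def)
  show ?thesis
  proof safe
    assume "\<gamma> \<in> normal_elements n"
    then have inj: "inj_on c {..<n}" and ind: "GF.independent (c ` {..<n})" and "\<gamma> \<in> GF_ext n"
      by (auto simp: norm)
    then show "\<gamma> \<in> GF_ext n" by simp
    fix f assume f: "f \<in> small_polys n" "frob_act f \<gamma> = 0"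
    define u where "u = (\<lambda>x. coeff f (inv_into {..<n} c x))"
    have "(\<Sum>x\<in>c ` {..<n}. GF_scale (u x) x) = (\<Sum>i<n. GF_scale (u (c i)) (c i))"
      using inj by (simp add: sum.reindex)
    also have "\<dots> = (\<Sum>i<n. GF_scale (coeff f i) (c i))"
      using inj by (intro sum.cong refl) (simp add: u_def)
    also have "\<dots> = 0"
      using f act by simp
    finally have "u (c i) = 0" if "i < n" for i
      using that GF.independentD[OF ind _ subset_refl, of u "c i"] by simp
    then have "coeff f i = 0" if "i < n" for i
      using that inj by (simp add: u_def)
    then have "coeff f i = 0" for i
      using f(1) by (cases "i < n") (auto simp: small_polys_def)
    then show "f = 0"
      by (intro poly_eqI) simp
  next
    assume G: "\<gamma> \<in> GF_ext n" and triv: "\<forall>f\<in>small_polys n. frob_act f \<gamma> = 0 \<longrightarrow> f = 0"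
    have inj: "inj_on c {..<n}"
    proof (rule inj_onI, rule ccontr)
      fix i j assume ij: "i \<in> {..<n}" "j \<in> {..<n}" "c i = c j" "i \<noteq> j"
      have "monom 1 i - monom 1 j \<in> small_polys n"
        using ij by (auto simp: small_polys_def)
      moreover have "frob_act (monom 1 i - monom 1 j) \<gamma> = 0"
        using ij(3) by (simp add: frob_act_diff frob_act_monom c_def)
      ultimately have "monom 1 i - monom 1 j = (0 :: 'p mod_ring poly)"
        using triv by blast
      then show False
        using ij(4) by (simp add: monom_eq_iff')
    qed
    have ind: "GF.independent (c ` {..<n})"
    proof -
      have "u x = 0" if "(\<Sum>x\<in>c ` {..<n}. GF_scale (u x) x) = 0" "x \<in> c ` {..<n}" for u x
      proof -
        obtain f where f: "f \<in> small_polys n" "\<forall>i<n. coeff f i = u (c i)"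
          using coeffs[of "\<lambda>i. u (c i)"] by blast
        have "frob_act f \<gamma> = (\<Sum>i<n. GF_scale (u (c i)) (c i))"
          unfolding act[OF f(1)] by (intro sum.cong refl) (simp add: f(2))
        also have "\<dots> = (\<Sum>x\<in>c ` {..<n}. GF_scale (u x) x)"
          using inj by (simp add: sum.reindex)
        finally have "frob_act f \<gamma> = 0"
          unfolding that(1) .
        then have "f = 0"
          using f(1) triv by blast
        then show "u x = 0"
          using f(2) that(2) by auto
      qed
      then show ?thesis
        by (subst GF.dependent_finite) auto
    qed
    have span: "GF.span (c ` {..<n}) = GF_ext n"
    proof
      have sub: "GF.subspace (GF_ext n :: 'p mod_ring alg_closure set)"
      proof (rule GF.subspaceI)
        show "x + y \<in> GF_ext n" if "x \<in> GF_ext n" "y \<in> GF_ext n" for x y :: "'p mod_ring alg_closure"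
        proof -
          have "(x + y) ^ ?p ^ n = x ^ ?p ^ n + y ^ ?p ^ n"
            by (rule freshmans_dream'[OF prime_CHAR_alg_closure]) (simp add: CHAR_alg_closure_mod_ring)
          then show ?thesis
            using that by (simp add: GF_ext_def)
        qed
        show "GF_scale a x \<in> GF_ext n" if "x \<in> GF_ext n" for a and x :: "'p mod_ring alg_closure"
          using frob_act_GF_ext[OF that, of "monom a 0"] by (simp only: frob_act_monom GF_scale_def) simp
      qed (simp add: GF_ext_def)
      have "c i \<in> GF_ext n" for i
        using frob_act_GF_ext[OF G, of "monom 1 i"] by (simp add: frob_act_monom c_def)
      then show "GF.span (c ` {..<n}) \<subseteq> GF_ext n"
        by (intro GF.span_minimal sub) auto
      have "(\<lambda>f. frob_act f \<gamma>) ` small_polys n = GF_ext n"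
      proof (rule card_seteq)
        show "finite (GF_ext n :: 'p mod_ring alg_closure set)"
          using card_GF_ext[OF n, where 'p = 'p] card_gt_0_iff[of "GF_ext n :: 'p mod_ring alg_closure set"] by simp
        have "inj_on (\<lambda>f. frob_act f \<gamma>) (small_polys n)"
        proof (rule inj_onI)
          fix r s assume rs: "r \<in> small_polys n" "s \<in> small_polys n" "frob_act r \<gamma> = frob_act s \<gamma>"
          then have "r - s \<in> small_polys n"
            by (simp add: small_polys_def)
          moreover have "frob_act (r - s) \<gamma> = 0"
            using rs(3) by (simp add: frob_act_diff)
          ultimately have "r - s = 0"
            using triv by blast
          then show "r = s" by simp
        qed
        then show "card (GF_ext n :: 'p mod_ring alg_closure set) \<le> card ((\<lambda>f. frob_act f \<gamma>) ` small_polys n)"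
          by (simp add: card_image card_small_polys card_GF_ext[OF n])
      qed (use frob_act_GF_ext[OF G] in auto)
      moreover have "frob_act f \<gamma> \<in> GF.span (c ` {..<n})" if "f \<in> small_polys n" for f
        unfolding act[OF that] by (intro GF.span_sum GF.span_scale GF.span_base) auto
      ultimately show "GF_ext n \<subseteq> GF.span (c ` {..<n})"
        by (metis (no_types, lifting) image_subsetI)
    qed
    show "\<gamma> \<in> normal_elements n"
      unfolding norm by (intro conjI G inj ind span)
  qed
qed

text \<open>Reduction modulo \<open>cyc_poly n\<close> stays inside \<open>I\<close>, so
  \<open>I\<close> is controlled by its members of degree below \<open>n\<close>. This expresses
  normality and nonvanishing alike as having one prescribed annihilator.\<close>

lemma annihilator_trivial_iff:
  fixes I :: "'p :: prime_card mod_ring poly set"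
  assumes n: "n > 0"
    and add: "\<And>f g. f \<in> I \<Longrightarrow> g \<in> I \<Longrightarrow> f - g \<in> I"
    and dvd: "\<And>f. cyc_poly n dvd f \<Longrightarrow> f \<in> I"
  shows "I = {f. cyc_poly n dvd f} \<longleftrightarrow> (\<forall>f\<in>small_polys n. f \<in> I \<longrightarrow> f = 0)"
proof
  assume "I = {f. cyc_poly n dvd f}"
  then show "\<forall>f\<in>small_polys n. f \<in> I \<longrightarrow> f = 0"
    using small_polys_dvd[OF n] by blast
next
  assume triv: "\<forall>f\<in>small_polys n. f \<in> I \<longrightarrow> f = 0"
  have "cyc_poly n dvd f" if "f \<in> I" for f
  proof -
    have "f - f div cyc_poly n * cyc_poly n \<in> I"
      by (intro add dvd that) simp
    then have "f mod cyc_poly n \<in> I"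
      by (simp add: minus_div_mult_eq_mod)
    moreover have "f mod cyc_poly n \<in> small_polys n"
      using degree_mod_less[OF cyc_poly_nonzero[OF n, where 'p = 'p], of f]
      by (simp only: small_polys_iff degree_cyc_poly[OF n])
    ultimately have "f mod cyc_poly n = 0"
      using triv by blast
    then show ?thesis
      by (simp only: dvd_eq_mod_eq_0)
  qed
  then show "I = {f. cyc_poly n dvd f}"
    using dvd by blast
qed

lemma num_normal_eq_card_nonvanishing_polys:
  assumes n: "n > 0"
  shows "num_normal TYPE('p :: prime_card) n = card (nonvanishing_polys n :: 'p mod_ring poly set)"
proof -
  let ?I = "{f :: 'p mod_ring poly. cyc_poly n dvd f}"
  have "normal_elements n = {x \<in> GF_ext n. {f :: 'p mod_ring poly. frob_act f x = 0} = ?I}"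
  proof (rule Set.set_eqI)
    fix x :: "'p mod_ring alg_closure"
    have "{f. frob_act f x = 0} = ?I \<longleftrightarrow> (\<forall>f\<in>small_polys n. f \<in> {f. frob_act f x = 0} \<longrightarrow> f = 0)" if x: "x \<in> GF_ext n"
    proof (rule annihilator_trivial_iff[OF n])
      show "f \<in> {f. frob_act f x = 0}" if "cyc_poly n dvd f" for f
      proof -
        obtain k where "f = cyc_poly n * k"
          using \<open>cyc_poly n dvd f\<close> by (elim dvdE)
        then have "f = k * cyc_poly n" by (simp only: mult.commute)
        moreover have "frob_act (cyc_poly n) x = 0"
          using x by (simp add: frob_act_cyc_poly)
        ultimately show ?thesis
          by (simp add: frob_act_mult)
      qed
    qed (simp add: frob_act_diff)
    note * = this[unfolded mem_Collect_eq]
    show "x \<in> normal_elements n \<longleftrightarrow> x \<in> {x \<in> GF_ext n. {f :: 'p mod_ring poly. frob_act f x = 0} = ?I}"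
      unfolding normal_elements_iff[OF n] mem_Collect_eq by (rule conj_cong[OF refl], rule sym, rule *)
  qed
  then have "num_normal TYPE('p) n = card {x \<in> GF_ext n. {f :: 'p mod_ring poly. frob_act f x = 0} = ?I}"
    by (simp add: num_normal_def)
  also have "\<dots> = card {v \<in> small_polys n. {f. cyc_poly n dvd f * v} = ?I}"
    by (rule card_annihilator_eq[OF n])
  also have "{v \<in> small_polys n. {f. cyc_poly n dvd f * v} = ?I} = nonvanishing_polys n"
  proof (rule Set.set_eqI)
    fix v :: "'p mod_ring poly"
    have "{f. cyc_poly n dvd f * v} = ?I \<longleftrightarrow> (\<forall>f\<in>small_polys n. f \<in> {f. cyc_poly n dvd f * v} \<longrightarrow> f = 0)"
      by (rule annihilator_trivial_iff[OF n]) (auto simp: left_diff_distrib intro: dvd_diff)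
    note * = this[unfolded mem_Collect_eq]
    show "v \<in> {v \<in> small_polys n. {f. cyc_poly n dvd f * v} = ?I} \<longleftrightarrow> v \<in> nonvanishing_polys n"
      unfolding nonvanishing_polys_iff[OF n] mem_Collect_eq by (rule conj_cong[OF refl], rule *)
  qed
  finally show ?thesis .
qed

section \<open>Invertible necklaces\<close>

lemma invertible_mat_iff_det:
  fixes A :: "'a :: field mat"
  assumes A: "A \<in> carrier_mat n n"
  shows "invertible_mat A \<longleftrightarrow> det A \<noteq> 0"
proof
  assume "invertible_mat A"
  then obtain B where B: "A * B = 1\<^sub>m (dim_row A)" "B * A = 1\<^sub>m (dim_row B)"
    by (auto simp: invertible_mat_def inverts_mat_def)
  have "dim_col (A * B) = n" "dim_col (B * A) = dim_row B"
    using A by (simp_all only: B index_one_mat carrier_matD)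
  then have "B \<in> carrier_mat n n"
    using A by (intro carrier_matI) auto
  then have "det A * det B = 1"
    using det_mult[OF A, of B] B(1) A by simp
  then show "det A \<noteq> 0" by auto
next
  assume "det A \<noteq> 0"
  then have "A \<in> Units (ring_mat TYPE('a) n ())"
    by (rule det_non_zero_imp_unit[OF A])
  then obtain B where "B \<in> carrier_mat n n" "B * A = 1\<^sub>m n" "A * B = 1\<^sub>m n"
    by (auto simp: Units_def ring_mat_simps)
  then show "invertible_mat A"
    using A by (auto simp: invertible_mat_def inverts_mat_def square_mat.simps)
qed

lemma length_bw_rows [simp]: "length (bw_rows w) = length w"
  by (simp add: bw_rows_def)

lemma set_bw_rows: "set (bw_rows w) = (\<lambda>k. rotate k w) ` {..<length w}"
  by (auto simp: bw_rows_def)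

lemma bw_matrix_mat:
  "bw_matrix w = mat (length w) (length w) (\<lambda>(i, j). of_nat (bw_rows w ! i ! j))"
proof -
  have "length (bw_rows w ! i) = length w" if "i < length w" for i
  proof -
    have "bw_rows w ! i \<in> set (bw_rows w)"
      using that by (intro nth_mem) simp
    then show ?thesis
      by (auto simp: set_bw_rows)
  qed
  then show ?thesis
    unfolding bw_matrix_def mat_of_rows_list_def by (intro eq_matI) auto
qed

text \<open>Sorting only permutes the rows, so the kernel is that of the unsorted matrix of
  rotations.\<close>

lemma invertible_bw_matrix_iff:
  assumes w: "length w = n"
  shows "invertible_mat (bw_matrix w :: 'p :: prime_card mod_ring mat) \<longleftrightarrow>
    (\<forall>x :: nat \<Rightarrow> 'p mod_ring. (\<forall>k<n. (\<Sum>i<n. of_nat (w ! ((k + i) mod n)) * x i) = 0) \<longrightarrow> (\<forall>i<n. x i = 0))"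
proof -
  have "invertible_mat (bw_matrix w :: 'p mod_ring mat) \<longleftrightarrow> fdet n (\<lambda>i j. of_nat (bw_rows w ! i ! j) :: 'p mod_ring) \<noteq> 0"
    unfolding bw_matrix_mat fdet_def w by (rule invertible_mat_iff_det[of _ n]) simp
  also have "\<dots> \<longleftrightarrow> (\<forall>x :: nat \<Rightarrow> 'p mod_ring. (\<forall>l<n. (\<Sum>i<n. of_nat (bw_rows w ! l ! i) * x i) = 0) \<longrightarrow> (\<forall>i<n. x i = 0))"
    unfolding fdet_eq_0_iff by blast
  also have "(\<lambda>x :: nat \<Rightarrow> 'p mod_ring. \<forall>l<n. (\<Sum>i<n. of_nat (bw_rows w ! l ! i) * x i) = 0) =
     (\<lambda>x. \<forall>k<n. (\<Sum>i<n. of_nat (w ! ((k + i) mod n)) * x i) = 0)"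
  proof
    fix x :: "nat \<Rightarrow> 'p mod_ring"
    have "(\<forall>l<n. (\<Sum>i<n. of_nat (bw_rows w ! l ! i) * x i) = 0) \<longleftrightarrow>
        (\<forall>r\<in>set (bw_rows w). (\<Sum>i<n. of_nat (r ! i) * x i) = 0)"
      using w by (auto simp: all_set_conv_all_nth)
    also have "\<dots> \<longleftrightarrow> (\<forall>k<n. (\<Sum>i<n. of_nat (rotate k w ! i) * x i) = 0)"
      using w by (auto simp: set_bw_rows)
    also have "\<dots> \<longleftrightarrow> (\<forall>k<n. (\<Sum>i<n. of_nat (w ! ((k + i) mod n)) * x i) = 0)"
      using w by (simp add: nth_rotate)
    finally show "(\<forall>l<n. (\<Sum>i<n. of_nat (bw_rows w ! l ! i) * x i) = 0) \<longleftrightarrow>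
      (\<forall>k<n. (\<Sum>i<n. of_nat (w ! ((k + i) mod n)) * x i) = 0)" .
  qed
  finally show ?thesis by meson
qed

section \<open>Multiplication modulo \<open>x^n - 1\<close> in coordinates\<close>

lemma cyc_poly_dvd_monom_diff: "cyc_poly n dvd monom a i - monom a (i mod n)"
proof -
  have "(monom 1 n :: 'a mod_ring poly) - 1 dvd monom 1 n ^ (i div n) - 1"
    unfolding power_diff_1_eq by simp
  also have "monom 1 n ^ (i div n) - 1 dvd monom a (i mod n) * (monom 1 n ^ (i div n) - (1 :: 'a mod_ring poly))"
    by simp
  also have "\<dots> = monom a i - monom a (i mod n)"
    by (simp add: monom_power right_diff_distrib mult_monom)
  finally show ?thesis
    by (simp add: cyc_poly_def)
qed

lemma small_polys_sum_monom: "f \<in> small_polys n \<Longrightarrow> f = (\<Sum>i<n. monom (coeff f i) i)"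
  by (rule poly_eqI) (auto simp: coeff_sum small_polys_def if_distrib sum.delta cong: if_cong)

text \<open>The polynomial \<open>r\<close> of cyclic convolution coefficients is congruent to
  \<open>f * v\<close> and too small to be divisible unless it is 0. The index \<open>n - i\<close>
  stands for \<open>- i\<close> modulo \<open>n\<close>.\<close>

lemma cyc_poly_dvd_mult_iff:
  fixes f v :: "'p :: prime_card mod_ring poly"
  assumes n: "n > 0" and f: "f \<in> small_polys n" and v: "v \<in> small_polys n"
  shows "cyc_poly n dvd f * v \<longleftrightarrow> (\<forall>k<n. (\<Sum>i<n. coeff f i * coeff v ((k + (n - i)) mod n)) = 0)"
proof -
  define c where "c = (\<lambda>k. \<Sum>i<n. coeff f i * coeff v ((k + (n - i)) mod n))"
  define r where "r = (\<Sum>k<n. monom (c k) k)"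
  have r: "r \<in> small_polys n" "\<And>k. k < n \<Longrightarrow> coeff r k = c k"
    by (auto simp: r_def small_polys_def coeff_sum if_distrib sum.delta cong: if_cong)
  have r_eq: "r = (\<Sum>i<n. \<Sum>j<n. monom (coeff f i * coeff v j) ((i + j) mod n))"
  proof -
    have "r = (\<Sum>k<n. \<Sum>i<n. monom (coeff f i * coeff v ((k + (n - i)) mod n)) k)"
      unfolding r_def c_def by (intro sum.cong refl poly_eqI) (simp add: coeff_sum)
    also have "\<dots> = (\<Sum>i<n. \<Sum>k<n. monom (coeff f i * coeff v ((k + (n - i)) mod n)) k)"
      by (rule sum.swap)
    also have "\<dots> = (\<Sum>i<n. \<Sum>j<n. monom (coeff f i * coeff v j) ((i + j) mod n))"
    proof (rule sum.cong[OF refl])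
      fix i assume "i \<in> {..<n}"
      then have i: "i < n" by simp
      have 1: "((i + j) mod n + (n - i)) mod n = j" if "j < n" for j
      proof -
        have "((i + j) mod n + (n - i)) mod n = (i + j + (n - i)) mod n"
          by (simp add: mod_add_left_eq)
        also have "i + j + (n - i) = j + n"
          using i by simp
        finally show ?thesis
          using that by simp
      qed
      have 2: "(i + (k + (n - i)) mod n) mod n = k" if "k < n" for k
      proof -
        have "(i + (k + (n - i)) mod n) mod n = (i + (k + (n - i))) mod n"
          by (simp add: mod_add_right_eq)
        also have "i + (k + (n - i)) = k + n"
          using i by simp
        finally show ?thesis
          using that by simp
      qed
      show "(\<Sum>k<n. monom (coeff f i * coeff v ((k + (n - i)) mod n)) k) =
         (\<Sum>j<n. monom (coeff f i * coeff v j) ((i + j) mod n))"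
        by (rule sum.reindex_bij_witness[of _ "\<lambda>j. (i + j) mod n" "\<lambda>k. (k + (n - i)) mod n"])
           (use 1 2 n in auto)
    qed
    finally show ?thesis .
  qed
  have "f * v = (\<Sum>i<n. monom (coeff f i) i) * (\<Sum>j<n. monom (coeff v j) j)"
    using small_polys_sum_monom[OF f] small_polys_sum_monom[OF v] by simp
  also have "\<dots> = (\<Sum>i<n. \<Sum>j<n. monom (coeff f i * coeff v j) (i + j))"
    by (simp add: sum_product mult_monom)
  finally have "f * v - r = (\<Sum>i<n. \<Sum>j<n. monom (coeff f i * coeff v j) (i + j) - monom (coeff f i * coeff v j) ((i + j) mod n))"
    by (simp add: r_eq sum_subtractf)
  then have "cyc_poly n dvd f * v - r"
    by (simp only:) (intro dvd_sum cyc_poly_dvd_monom_diff)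
  then have "cyc_poly n dvd f * v \<longleftrightarrow> cyc_poly n dvd r"
    using dvd_diff_commute dvd_add_right_iff[of "cyc_poly n" "f * v - r" r] by simp
  also have "\<dots> \<longleftrightarrow> r = 0"
    using small_polys_dvd[OF n _ r(1)] by auto
  also have "\<dots> \<longleftrightarrow> (\<forall>k<n. c k = 0)"
  proof
    assume "r = 0"
    then show "\<forall>k<n. c k = 0"
      using r(2) by (metis coeff_0)
  next
    assume "\<forall>k<n. c k = 0"
    then show "r = 0"
      by (simp add: r_def)
  qed
  finally show ?thesis
    by (simp only: c_def)
qed

definition word_poly :: "nat list \<Rightarrow> 'p :: prime_card mod_ring poly" where
  "word_poly w = Poly (map of_nat w)"

text \<open>The kernel equations are correlations, with indices \<open>k + i\<close>. Negating the
  index of the vector turns them into cyclic convolutions, so kernel vectors correspond to small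
  polynomials annihilating the word polynomial.\<close>

lemma invertible_bw_matrix_iff_nonvanishing:
  assumes n: "n > 0" and w: "length w = n"
  shows "invertible_mat (bw_matrix w :: 'p :: prime_card mod_ring mat) \<longleftrightarrow>
    (word_poly w :: 'p mod_ring poly) \<in> nonvanishing_polys n"
proof -
  let ?v = "word_poly w :: 'p mod_ring poly"
  have v: "?v \<in> small_polys n" "\<And>i. i < n \<Longrightarrow> coeff ?v i = of_nat (w ! i)"
    using w by (auto simp: word_poly_def small_polys_def nth_default_def)
  \<comment> \<open>The outer \<open>mod\<close> keeps the negative of 0 in range.\<close>
  define neg where "neg = (\<lambda>i. (n - i) mod n)"
  have neg: "neg i < n" "i < n \<Longrightarrow> neg (neg i) = i" for i
    using n by (cases "i = 0"; auto simp: neg_def)+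
  have conv: "(\<Sum>i<n. of_nat (w ! ((k + i) mod n)) * x i) =
      (\<Sum>i<n. x (neg i) * coeff ?v ((k + (n - i)) mod n))" for k and x :: "nat \<Rightarrow> 'p mod_ring"
  proof (rule sum.reindex_bij_witness[of _ neg neg])
    fix i assume i: "i \<in> {..<n}"
    then have "(k + (n - neg i)) mod n = (k + i) mod n"
      by (cases "i = 0") (auto simp: neg_def)
    then show "x (neg (neg i)) * coeff ?v ((k + (n - neg i)) mod n) = of_nat (w ! ((k + i) mod n)) * x i"
      using i n v(2) neg by simp
  qed (use neg in auto)
  have "invertible_mat (bw_matrix w :: 'p mod_ring mat) \<longleftrightarrow>
    (\<forall>x :: nat \<Rightarrow> 'p mod_ring. (\<forall>k<n. (\<Sum>i<n. x (neg i) * coeff ?v ((k + (n - i)) mod n)) = 0) \<longrightarrow> (\<forall>i<n. x i = 0))"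
    unfolding invertible_bw_matrix_iff[OF w] conv ..
  also have "\<dots> \<longleftrightarrow> (\<forall>f\<in>small_polys n. cyc_poly n dvd f * ?v \<longrightarrow> f = 0)"
  proof safe
    fix f :: "'p mod_ring poly"
    assume *: "\<forall>x :: nat \<Rightarrow> 'p mod_ring. (\<forall>k<n. (\<Sum>i<n. x (neg i) * coeff ?v ((k + (n - i)) mod n)) = 0) \<longrightarrow> (\<forall>i<n. x i = 0)"
    assume f: "f \<in> small_polys n" "cyc_poly n dvd f * ?v"
    have "(\<Sum>i<n. coeff f (neg (neg i)) * coeff ?v ((k + (n - i)) mod n)) = 0" if "k < n" for k
    proof -
      have "(\<Sum>i<n. coeff f (neg (neg i)) * coeff ?v ((k + (n - i)) mod n)) =
          (\<Sum>i<n. coeff f i * coeff ?v ((k + (n - i)) mod n))"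
        using neg by (intro sum.cong refl) simp
      also have "\<dots> = 0"
        using f(2) that unfolding cyc_poly_dvd_mult_iff[OF n f(1) v(1)] by blast
      finally show ?thesis .
    qed
    then have "\<forall>i<n. coeff f (neg i) = 0"
      using *[THEN spec[of _ "\<lambda>i. coeff f (neg i)"]] by blast
    then have "coeff f i = 0" if "i < n" for i
      using neg(1)[of i] neg(2)[OF that] by metis
    then have "coeff f i = 0" for i
      using f(1) by (cases "i < n") (auto simp: small_polys_def)
    then show "f = 0"
      by (intro poly_eqI) simp
  next
    fix x :: "nat \<Rightarrow> 'p mod_ring" and i
    assume *: "\<forall>f\<in>small_polys n. cyc_poly n dvd f * ?v \<longrightarrow> f = 0"
    assume x: "\<forall>k<n. (\<Sum>i<n. x (neg i) * coeff ?v ((k + (n - i)) mod n)) = 0" and i: "i < n"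
    define f where "f = Poly (map (\<lambda>i. x (neg i)) [0..<n])"
    have f: "f \<in> small_polys n" "\<And>i. i < n \<Longrightarrow> coeff f i = x (neg i)"
      by (auto simp: f_def small_polys_def nth_default_def)
    have "cyc_poly n dvd f * ?v"
      unfolding cyc_poly_dvd_mult_iff[OF n f(1) v(1)]
    proof (intro allI impI)
      fix k assume "k < n"
      have "(\<Sum>i<n. coeff f i * coeff ?v ((k + (n - i)) mod n)) = (\<Sum>i<n. x (neg i) * coeff ?v ((k + (n - i)) mod n))"
        by (intro sum.cong refl) (simp add: f(2))
      also have "\<dots> = 0"
        using x \<open>k < n\<close> by blast
      finally show "(\<Sum>i<n. coeff f i * coeff ?v ((k + (n - i)) mod n)) = 0" .
    qed
    then have "f = 0"
      using * f(1) by blast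
    then have "x (neg (neg i)) = 0"
      using f(2)[of "neg i"] neg(1)[of i] by simp
    then show "x i = 0"
      using neg(2)[OF i] by simp
  qed
  also have "\<dots> \<longleftrightarrow> ?v \<in> nonvanishing_polys n"
    using v(1) by (simp add: nonvanishing_polys_iff[OF n])
  finally show ?thesis .
qed

lemma bij_betw_word_poly:
  "bij_betw word_poly (words CARD('p) n) (small_polys n :: 'p :: prime_card mod_ring poly set)"
proof -
  have inj: "a = b" if "of_nat a = (of_nat b :: 'p mod_ring)" "a < CARD('p)" "b < CARD('p)" for a b
  proof -
    have "a mod CARD('p) = b mod CARD('p)"
      using that(1) of_nat_eq_iff_cong_CHAR[of a b, where 'a = "'p mod_ring"] by (simp add: cong_def)
    then show ?thesis
      using that by simp
  qed
  have "bij_betw (map of_nat) (words CARD('p) n) {xs :: 'p mod_ring list. length xs = n}"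
    unfolding bij_betw_def
  proof
    show "inj_on (map of_nat :: _ \<Rightarrow> 'p mod_ring list) (words CARD('p) n)"
    proof (rule inj_onI)
      fix xs ys assume *: "xs \<in> words CARD('p) n" "ys \<in> words CARD('p) n"
        "map of_nat xs = (map of_nat ys :: 'p mod_ring list)"
      show "xs = ys"
        by (rule map_inj_on[OF *(3)]) (use * inj in \<open>auto simp: words_def inj_on_def subset_iff\<close>)
    qed
    show "map of_nat ` words CARD('p) n = {xs :: 'p mod_ring list. length xs = n}"
    proof (intro equalityI subsetI)
      fix xs :: "'p mod_ring list" assume xs: "xs \<in> {xs. length xs = n}"
      define g where "g = (\<lambda>x :: 'p mod_ring. SOME i. i < CARD('p) \<and> x = of_nat i)"
      have g: "g x < CARD('p) \<and> x = of_nat (g x)" for x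
        unfolding g_def by (rule someI_ex) (rule surj_of_nat_mod_ring)
      have "map of_nat (map g xs) = xs"
        using g by (simp add: o_def flip: g)
      moreover have "map g xs \<in> words CARD('p) n"
        using xs g by (auto simp: words_def)
      ultimately show "xs \<in> map of_nat ` words CARD('p) n"
        by (metis imageI)
    qed (auto simp: words_def)
  qed
  from bij_betw_trans[OF this bij_betw_Poly_small_polys] show ?thesis
    by (simp add: o_def word_poly_def[abs_def])
qed

section \<open>Sizes of necklaces\<close>

lemma necklace_self: "w \<in> necklace w"
  unfolding necklace_def by (rule range_eqI[of _ _ 0]) simp

lemma necklace_conv:
  assumes "w \<noteq> []"
  shows "necklace w = (\<lambda>k. rotate k w) ` {..<length w}"
proof
  show "necklace w \<subseteq> (\<lambda>k. rotate k w) ` {..<length w}"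
    unfolding necklace_def
  proof
    fix u assume "u \<in> range (\<lambda>k. rotate k w)"
    then obtain k where "u = rotate k w" by blast
    then have "u = rotate (k mod length w) w"
      by (metis rotate_conv_mod)
    then show "u \<in> (\<lambda>k. rotate k w) ` {..<length w}"
      using assms by auto
  qed
qed (auto simp: necklace_def)

lemma necklace_eq:
  assumes "v \<in> necklace w"
  shows "necklace v = necklace w"
proof -
  obtain k where k: "v = rotate k w"
    using assms by (auto simp: necklace_def)
  have sub: "necklace (rotate j u) \<subseteq> necklace u" for j and u :: "'a list"
    by (auto simp: necklace_def rotate_rotate)
  have "w = rotate (length w * k - k) v" if "w \<noteq> []"
  proof -
    have "rotate (length w * k - k) v = rotate (length w * k - k + k) w"
      by (simp add: k rotate_rotate)
    also have "length w * k - k + k = length w * k"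
      using that by (cases w) auto
    also have "rotate (length w * k) w = w"
      by (simp add: rotate_id)
    finally show ?thesis ..
  qed
  then have "necklace w \<subseteq> necklace v"
    using sub[of "length w * k - k" v] k by (cases "w = []") auto
  then show ?thesis
    using sub[of k w] k by auto
qed

lemma words_necklace: "v \<in> necklace w \<Longrightarrow> w \<in> words p n \<Longrightarrow> v \<in> words p n"
  by (auto simp: necklace_def words_def)

text \<open>Coinciding rotations would be equal rows of a nonsingular matrix.\<close>

lemma card_necklace_invertible:
  assumes "length w = n" "n > 0" "invertible_mat (bw_matrix w :: 'p :: prime_card mod_ring mat)"
  shows "card (necklace w) = n"
proof -
  have "distinct (bw_rows w)"
  proof (rule ccontr)
    assume "\<not> distinct (bw_rows w)"
    then obtain i j where ij: "i < n" "j < n" "i \<noteq> j" "bw_rows w ! i = bw_rows w ! j"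
      using assms(1) by (auto simp: distinct_conv_nth)
    then have "fdet n (\<lambda>i j. of_nat (bw_rows w ! i ! j) :: 'p mod_ring) = 0"
      by (intro fdet_identical_rows[of i n j]) auto
    then have "det (bw_matrix w :: 'p mod_ring mat) = 0"
      by (simp add: bw_matrix_mat fdet_def assms(1))
    then show False
      using assms(3) invertible_mat_iff_det[of "bw_matrix w :: 'p mod_ring mat" n]
      by (simp add: bw_matrix_mat assms(1))
  qed
  then have "inj_on (\<lambda>k. rotate k w) {..<n}"
    by (simp add: bw_rows_def distinct_map assms(1) atLeast0LessThan)
  then show ?thesis
    using assms by (subst necklace_conv) (auto simp: card_image)
qed

text \<open>All rotations of a word share its matrix, so the invertible words split into disjoint
  necklaces of exactly \<open>n\<close> words each.\<close>

lemma InvNeck_eq_card_nonvanishing_polys: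
  assumes n: "n > 0"
  shows "n * InvNeck TYPE('p :: prime_card) n = card (nonvanishing_polys n :: 'p mod_ring poly set)"
proof -
  define W where "W = {w \<in> words CARD('p) n. invertible_mat (bw_matrix w :: 'p mod_ring mat)}"
  have W_eq: "W = {w \<in> words CARD('p) n. (word_poly w :: 'p mod_ring poly) \<in> nonvanishing_polys n}"
    unfolding W_def using invertible_bw_matrix_iff_nonvanishing[OF n] by (auto simp: words_def)
  have fin: "finite (words CARD('p) n)"
    using bij_betw_finite[OF bij_betw_word_poly[of n, where 'p = 'p]] finite_small_polys[of n, where 'a = "'p mod_ring"] by simp
  have "bij_betw word_poly W (nonvanishing_polys n :: 'p mod_ring poly set)"
  proof (rule bij_betw_subset[OF bij_betw_word_poly])
    have "nonvanishing_polys n \<subseteq> (word_poly ` words CARD('p) n :: 'p mod_ring poly set)"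
      using bij_betw_imp_surj_on[OF bij_betw_word_poly[of n, where 'p = 'p]] by (auto simp: nonvanishing_polys_def)
    then show "word_poly ` W = (nonvanishing_polys n :: 'p mod_ring poly set)"
      unfolding W_eq by auto
  qed (auto simp: W_def)
  then have cardW: "card W = card (nonvanishing_polys n :: 'p mod_ring poly set)"
    by (rule bij_betw_same_card)
  have inv: "invertible_necklaces TYPE('p) n = necklace ` W"
    by (auto simp: invertible_necklaces_def W_def)
  have sub: "necklace w \<subseteq> W" if "w \<in> W" for w
  proof
    fix v assume v: "v \<in> necklace w"
    then have "length v = length w"
      by (auto simp: necklace_def)
    then have "bw_matrix v = (bw_matrix w :: 'p mod_ring mat)"
      unfolding bw_matrix_def bw_rows_necklace_cong[OF v] by simp
    then show "v \<in> W"
      using that words_necklace[OF v] by (simp add: W_def)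
  qed
  have "n * card (necklace ` W) = card (\<Union> (necklace ` W))"
  proof (rule card_partition)
    show "card c = n" if "c \<in> necklace ` W" for c
      using that n card_necklace_invertible[where 'p = 'p] by (auto simp: W_def words_def)
    show "c1 \<inter> c2 = {}" if "c1 \<in> necklace ` W" "c2 \<in> necklace ` W" "c1 \<noteq> c2" for c1 c2
      using that necklace_eq by blast
    show "finite (necklace ` W)"
      using fin by (simp add: W_def)
    have "\<Union> (necklace ` W) \<subseteq> W"
      using sub by blast
    then show "finite (\<Union> (necklace ` W))"
      by (rule finite_subset) (use fin in \<open>simp add: W_def\<close>)
  qed
  also have "\<Union> (necklace ` W) = W"
    using sub necklace_self by blast
  finally show ?thesis
    unfolding InvNeck_def inv cardW .
qed

section \<open>Burrows--Wheeler transforms of generalized de Bruijn words\<close>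

lemma funpow_orbit_sym:
  assumes "permutation \<pi>" "(\<pi> ^^ m) x = y"
  shows "\<exists>k. (\<pi> ^^ k) y = x"
proof -
  obtain l where l: "\<pi> ^^ l = id" "l > 0"
    using permutation_is_nilpotent[OF assms(1)] by blast
  \<comment> \<open>These steps complete \<open>m\<close> periods of length \<open>l\<close>; the
    subtraction is exact because \<open>l > 0\<close>.\<close>
  have "(\<pi> ^^ (l * m - m)) y = (\<pi> ^^ (l * m - m + m)) x"
    using assms(2) by (simp add: funpow_add)
  also have "l * m - m + m = l * m"
    using l(2) by (cases l) auto
  also have "\<pi> ^^ (l * m) = id"
    using l(1) by (simp add: funpow_mult[symmetric])
  finally show ?thesis by auto
qed

lemma funpow_inv_orbit_iff:
  assumes "\<pi> permutes S" "finite S"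
  shows "(\<exists>k. (inv_into UNIV \<pi> ^^ k) x = y) \<longleftrightarrow> (\<exists>k. (\<pi> ^^ k) x = y)"
proof -
  have perm: "permutation \<pi>" "permutation (inv_into UNIV \<pi>)"
    using assms permutes_inv permutation_permutes by blast+
  have *: "(inv_into UNIV f ^^ k) a = b \<longleftrightarrow> (f ^^ k) b = a" if "bij f" for f :: "'a \<Rightarrow> 'a" and k a b
  proof (induction k arbitrary: a b)
    case (Suc k)
    have "(inv_into UNIV f ^^ Suc k) a = b \<longleftrightarrow> (inv_into UNIV f ^^ k) a = f b"
      using that by (metis bij_inv_eq_iff comp_apply funpow.simps(2))
    then show ?case
      using Suc.IH by (simp add: funpow_swap1)
  qed auto
  have bij: "bij \<pi>"
    by (rule permutes_bij[OF assms(1)])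
  have "(\<exists>k. (inv_into UNIV \<pi> ^^ k) x = y) \<longleftrightarrow> (\<exists>k. (\<pi> ^^ k) y = x)"
    by (simp add: *[OF bij])
  also have "\<dots> \<longleftrightarrow> (\<exists>k. (\<pi> ^^ k) x = y)"
    using funpow_orbit_sym[OF perm(1)] by blast
  finally show ?thesis .
qed

text \<open>The orbit of 0 has \<open>N\<close> points, so \<open>N\<close> is the period of 0;
  powers of \<open>\<psi>\<close> commute, which carries this to every point of the orbit.\<close>

lemma funpow_transitive:
  assumes "\<psi> permutes {..<N}" "\<And>i. i < N \<Longrightarrow> \<exists>k. (\<psi> ^^ k) 0 = i" "i < N"
  shows "(\<psi> ^^ N) i = i"
proof -
  have perm: "permutation \<psi>"
    using assms(1) permutation_permutes by blast
  have "range (\<lambda>k. (\<psi> ^^ k) 0) = {..<N}"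
    using assms permutes_in_funpow_image[OF assms(1), of 0] by force
  moreover have "set (support \<psi> 0) = range (\<lambda>k. (\<psi> ^^ k) 0)"
    by (rule support_set[OF perm])
  moreover have "distinct (support \<psi> 0)"
    using cycle_of_permutation[OF perm] by simp
  ultimately have "length (support \<psi> 0) = N"
    by (metis card_lessThan distinct_card)
  then have "least_power \<psi> 0 = N"
    by simp
  then have N0: "(\<psi> ^^ N) 0 = 0"
    using least_power_of_permutation(1)[OF perm, of 0] by simp
  obtain k where k: "(\<psi> ^^ k) 0 = i"
    using assms(2,3) by blast
  have "(\<psi> ^^ N) i = (\<psi> ^^ (N + k)) 0"
    by (simp add: funpow_add k)
  also have "\<dots> = (\<psi> ^^ k) ((\<psi> ^^ N) 0)"
    by (simp add: funpow_add add.commute[of N])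
  finally show ?thesis
    by (simp add: N0 k)
qed

section \<open>Words cut into blocks\<close>

lemma concat_nth_blocks:
  assumes "\<And>u. u \<in> set us \<Longrightarrow> length u = p" "i < length us * p"
  shows "concat us ! i = us ! (i div p) ! (i mod p)"
  using assms
proof (induction us arbitrary: i)
  case (Cons v us)
  have v: "length v = p" and p: "p > 0"
    using Cons.prems by (auto intro: gr0I)
  show ?case
  proof (cases "i < p")
    case False
    then have "concat us ! (i - p) = us ! ((i - p) div p) ! ((i - p) mod p)"
      using Cons.prems by (intro Cons.IH) auto
    moreover have "i div p = Suc ((i - p) div p)" "i mod p = (i - p) mod p"
      using False p by (simp_all add: le_div_geq le_mod_geq)
    ultimately show ?thesis
      using False v by (simp add: nth_append)
  qed (use v in \<open>simp add: nth_append\<close>)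
qed simp

lemma length_concat_blocks: "(\<And>u. u \<in> set us \<Longrightarrow> length u = p) \<Longrightarrow> length (concat us) = length us * p"
  by (induction us) auto

lemma length_alphabet_perm: "alphabet_perm p u \<Longrightarrow> length u = p"
  using distinct_card[of u] by (auto simp: alphabet_perm_def)

definition block_word :: "nat \<Rightarrow> nat \<Rightarrow> (nat \<Rightarrow> nat \<Rightarrow> nat) \<Rightarrow> nat list" where
  "block_word p n \<beta> = map (\<lambda>i. \<beta> (i div p) (i mod p)) [0..<n * p]"

lemma block_word_eq_iff:
  assumes p: "p > 0" and n: "n > 0"
  shows "(length u = n * p \<and> (\<exists>us. (\<forall>v\<in>set us. alphabet_perm p v) \<and> u = concat us)) \<longleftrightarrow>
         u \<in> block_word p n ` block_perms p n"
proof
  assume "length u = n * p \<and> (\<exists>us. (\<forall>v\<in>set us. alphabet_perm p v) \<and> u = concat us)"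
  then obtain us where us: "\<And>v. v \<in> set us \<Longrightarrow> alphabet_perm p v" "u = concat us" "length u = n * p"
    by blast
  have len: "length v = p" if "v \<in> set us" for v
    using that us(1) length_alphabet_perm by blast
  have "length us = n"
    using length_concat_blocks[of us p] len us p by simp
  \<comment> \<open>The values outside the ranges are conventions: the identity beyond the alphabet,
    as \<open>permutes\<close> demands, and \<open>undefined\<close> beyond the blocks, as
    \<open>PiE\<close> demands.\<close>
  define \<beta> where "\<beta> = restrict (\<lambda>k j. if j < p then us ! k ! j else j) {..<n}"
  have "(\<lambda>j. if j < p then us ! k ! j else j) permutes {..<p}" if "k < n" for k
  proof (rule bij_imp_permutes)
    have k: "us ! k \<in> set us"
      using that \<open>length us = n\<close> by simp
    have "bij_betw ((!) (us ! k)) {..<p} {..<p}"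
      using us(1)[OF k] len[OF k] by (intro bij_betw_nth) (auto simp: alphabet_perm_def)
    then show "bij_betw (\<lambda>j. if j < p then us ! k ! j else j) {..<p} {..<p}"
      by (rule bij_betw_cong[THEN iffD1, rotated]) simp
  qed simp
  then have "\<beta> \<in> block_perms p n"
    by (auto simp: \<beta>_def block_perms_def)
  moreover have "u = block_word p n \<beta>"
  proof (rule nth_equalityI)
    fix i assume "i < length u"
    then have i: "i < n * p"
      using us(3) by simp
    then have "i div p < n" "i mod p < p"
      using p by (auto simp: less_mult_imp_div_less)
    then show "u ! i = block_word p n \<beta> ! i"
      using i concat_nth_blocks[of us p i] len \<open>length us = n\<close>
      by (simp add: us(2) block_word_def \<beta>_def)
  qed (simp add: us(3) block_word_def)
  ultimately show "u \<in> block_word p n ` block_perms p n"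
    by blast
next
  assume "u \<in> block_word p n ` block_perms p n"
  then obtain \<beta> where \<beta>: "\<beta> \<in> block_perms p n" "u = block_word p n \<beta>"
    by blast
  define us where "us = map (\<lambda>k. map (\<beta> k) [0..<p]) [0..<n]"
  have "alphabet_perm p v" if v: "v \<in> set us" for v
  proof -
    obtain k where k: "k < n" "v = map (\<beta> k) [0..<p]"
      using v by (auto simp: us_def)
    have perm: "\<beta> k permutes {..<p}"
      using \<beta>(1) k(1) by (auto simp: block_perms_def PiE_iff)
    show ?thesis
      using permutes_image[OF perm] permutes_inj_on[OF perm]
      by (simp add: alphabet_perm_def k(2) distinct_map atLeast0LessThan)
  qed
  moreover have "u = concat us"
  proof (rule nth_equalityI)
    have len: "length v = p" if "v \<in> set us" for v
      using that by (auto simp: us_def)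
    show "length u = length (concat us)"
      using length_concat_blocks[of us p] len by (simp add: \<beta>(2) block_word_def us_def)
    fix i assume "i < length u"
    then have i: "i < n * p"
      by (simp add: \<beta>(2) block_word_def)
    then have "i div p < n" "i mod p < p"
      using p by (auto simp: less_mult_imp_div_less)
    then show "u ! i = concat us ! i"
      using i concat_nth_blocks[of us p i] len by (simp add: \<beta>(2) block_word_def us_def)
  qed
  moreover have "length u = n * p"
    by (simp add: \<beta>(2) block_word_def)
  ultimately show "length u = n * p \<and> (\<exists>us. (\<forall>v\<in>set us. alphabet_perm p v) \<and> u = concat us)"
    by blast
qed

lemma inj_on_block_word:
  assumes "p > 0"
  shows "inj_on (block_word p n) (block_perms p n)"
proof (rule inj_onI)
  fix \<beta> \<beta>' assume \<beta>: "\<beta> \<in> block_perms p n" "\<beta>' \<in> block_perms p n" "block_word p n \<beta> = block_word p n \<beta>'"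
  have eq: "\<beta> k l = \<beta>' k l" if "k < n" "l < p" for k l
  proof -
    have "block_word p n \<beta> ! (k * p + l) = block_word p n \<beta>' ! (k * p + l)"
      by (simp only: \<beta>(3))
    then show ?thesis
      using that block_index_less[OF that] by (simp add: block_word_def div_mod_block)
  qed
  have "\<beta> k = \<beta>' k" if k: "k < n" for k
  proof
    fix l
    have "\<beta> k permutes {..<p}" "\<beta>' k permutes {..<p}"
      using \<beta>(1,2) k by (auto simp: block_perms_def PiE_iff)
    then show "\<beta> k l = \<beta>' k l"
      using eq[OF k] by (cases "l < p") (auto simp: permutes_not_in)
  qed
  then show "\<beta> = \<beta>'"
    using \<beta>(1,2) unfolding block_perms_def by (intro PiE_ext) auto
qed

section \<open>Inverting the transform\<close>

lemma rotate1_snoc_inverse: "x \<noteq> [] \<Longrightarrow> rotate1 (last x # butlast x) = x"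
  by simp

lemma snoc_le_snoc_imp:
  assumes "length xs = length ys" "xs @ [c] \<le> ys @ [c :: 'a :: linorder]"
  shows "xs \<le> ys"
  using assms by (induction xs ys rule: list_induct2) auto

lemma mset_bw_rows_rotate1: "image_mset rotate1 (mset (bw_rows w)) = mset (bw_rows w)"
proof -
  have "image_mset rotate1 (mset (bw_rows w)) = mset (map (\<lambda>k. rotate k (rotate1 w)) [0..<length w])"
    by (simp add: bw_rows_def rotate1_rotate_swap image_mset.compositionality o_def)
  also have "\<dots> = mset (bw_rows w)"
    by (simp only: mset_rotations_rotate1 bw_rows_def mset_sort)
  finally show ?thesis .
qed

locale block_permutation =
  fixes p n :: nat and \<beta> :: "nat \<Rightarrow> nat \<Rightarrow> nat"
  assumes p: "p > 1" and n: "n > 0" and \<beta>: "\<beta> \<in> block_perms p n"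
begin

definition letter :: "nat \<Rightarrow> nat" where
  "letter i = \<beta> (i div p) (i mod p)"

text \<open>The inverse of the last-to-first mapping: it is to send the number of a row to the
  number of that row rotated once to the left.\<close>

definition \<psi> :: "nat \<Rightarrow> nat" where
  "\<psi> = inv_into UNIV (block_map p n \<beta>)"

text \<open>\<open>letter i\<close> is meant as the last letter of row \<open>i\<close>. The
  exponents start at 1 because one rotation to the left brings the first letter to the end.\<close>

definition row :: "nat \<Rightarrow> nat list" where
  "row i = map (\<lambda>m. letter ((\<psi> ^^ Suc m) i)) [0..<n * p]"

lemma block_map_perm: "block_map p n \<beta> permutes {..<n * p}"
  using p n \<beta> by (intro block_map_permutes) auto

lemma \<psi>_perm: "\<psi> permutes {..<n * p}"
  unfolding \<psi>_def by (rule permutes_inv[OF block_map_perm])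

lemma block_map_eq: "i < n * p \<Longrightarrow> block_map p n \<beta> i = letter i * n + i div p"
  by (simp add: block_map_def letter_def)

lemma \<psi>_less: "i < n * p \<Longrightarrow> \<psi> i < n * p"
  using permutes_in_image[OF \<psi>_perm, of i] by simp

lemma \<psi>_funpow_less: "i < n * p \<Longrightarrow> (\<psi> ^^ k) i < n * p"
  using permutes_in_funpow_image[OF \<psi>_perm, of i k] by simp

lemma block_map_\<psi>: "block_map p n \<beta> (\<psi> i) = i"
  unfolding \<psi>_def by (rule permutes_inverses(1)[OF block_map_perm])

text \<open>In sorted order each letter fills \<open>n\<close> consecutive rows, one for each block.
  So \<open>i div n\<close> is the first letter of row \<open>i\<close>, and \<open>i mod n\<close>
  is the block where this occurrence stands.\<close>

lemma letter_\<psi>: "i < n * p \<Longrightarrow> letter (\<psi> i) = i div n" "i < n * p \<Longrightarrow> \<psi> i div p = i mod n"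
proof -
  assume i: "i < n * p"
  have *: "letter (\<psi> i) * n + \<psi> i div p = i"
    using block_map_eq[OF \<psi>_less[OF i]] block_map_\<psi>[of i] by simp
  have "\<psi> i div p < n"
    using \<psi>_less[OF i] by (simp add: less_mult_imp_div_less)
  then show "letter (\<psi> i) = i div n" "\<psi> i div p = i mod n"
    using div_mod_block[of "\<psi> i div p" n "letter (\<psi> i)"] * by simp_all
qed

lemma \<psi>_mono:
  assumes "i \<le> j" "j < n * p" "i div n = j div n"
  shows "\<psi> i \<le> \<psi> j"
proof (cases "i = j")
  case False
  then have "i mod n < j mod n"
    using assms by (metis div_mult_mod_eq nat_add_left_cancel_less order_le_imp_less_or_eq)
  then have "\<psi> i div p < \<psi> j div p"
    using letter_\<psi>(2)[of i] letter_\<psi>(2)[of j] assms by simp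
  then show ?thesis
    by (metis div_le_mono not_le order_less_imp_le)
qed simp

lemma letter_less: "i < n * p \<Longrightarrow> letter i < p"
proof -
  assume "i < n * p"
  then have "i div p < n" "i mod p < p"
    using p by (auto simp: less_mult_imp_div_less)
  then show "letter i < p"
    using \<beta> permutes_in_image[of "\<beta> (i div p)" "{..<p}" "i mod p"]
    by (auto simp: letter_def block_perms_def PiE_iff)
qed

lemma block_word_letter: "block_word p n \<beta> = map letter [0..<n * p]"
  by (simp add: block_word_def letter_def[abs_def])

text \<open>Prefixes of arbitrary length let the induction pass to the rotated rows: different first
  letters decide the comparison, and for equal ones \<open>\<psi>\<close> keeps the order.\<close>

lemma row_le:
  assumes "i \<le> j" "j < n * p"
  shows "map (\<lambda>m. letter ((\<psi> ^^ Suc m) i)) [0..<l] \<le> map (\<lambda>m. letter ((\<psi> ^^ Suc m) j)) [0..<l]"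
  using assms
proof (induction l arbitrary: i j)
  case (Suc l)
  have eq: "map (\<lambda>m. letter ((\<psi> ^^ Suc m) i)) [0..<Suc l] =
      letter (\<psi> i) # map (\<lambda>m. letter ((\<psi> ^^ Suc m) (\<psi> i))) [0..<l]" for i
    by (subst map_upt_Suc) (simp add: funpow_swap1)
  have i: "i < n * p"
    using Suc.prems by simp
  have le: "i div n \<le> j div n"
    using Suc.prems by (simp add: div_le_mono)
  show ?case
  proof (cases "i div n = j div n")
    case True
    have "map (\<lambda>m. letter ((\<psi> ^^ Suc m) (\<psi> i))) [0..<l] \<le> map (\<lambda>m. letter ((\<psi> ^^ Suc m) (\<psi> j))) [0..<l]"
      using \<psi>_mono[OF Suc.prems True] \<psi>_less[OF Suc.prems(2)] by (rule Suc.IH)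
    then show ?thesis
      unfolding eq letter_\<psi>(1)[OF i] letter_\<psi>(1)[OF Suc.prems(2)] using True by simp
  next
    case False
    then show ?thesis
      unfolding eq letter_\<psi>(1)[OF i] letter_\<psi>(1)[OF Suc.prems(2)] using le by simp
  qed
qed simp

text \<open>The last-to-first mapping of the Burrows--Wheeler transform is \<open>block_map p n \<beta>\<close>: moving the
  last letter of a row to the front sorts the rows by last letter first, ties being broken by the
  old order.\<close>

lemma bw_rows_eq:
  assumes w: "length w = n * p" and bwt: "bwt w = block_word p n \<beta>"
  shows "bw_rows w = map row [0..<n * p]"
    and "i < n * p \<Longrightarrow> bw_rows w ! \<psi> i = rotate1 (bw_rows w ! i)"
proof -
  let ?N = "n * p"
  define r where "r = (\<lambda>i. bw_rows w ! i)"
  have N0: "?N > 0" using p n by simp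
  have len_r: "length (r i) = ?N" if "i < ?N" for i
  proof -
    have "r i \<in> set (bw_rows w)"
      unfolding r_def using that w by (intro nth_mem) simp
    then show ?thesis
      using w by (auto simp: set_bw_rows)
  qed
  have last_r: "last (r i) = letter i" if "i < ?N" for i
  proof -
    have "bwt w ! i = letter i"
      using that by (simp add: bwt block_word_letter)
    then show ?thesis
      using that w by (simp add: bwt_def r_def)
  qed
  have sorted: "sorted (bw_rows w)"
    by (simp add: bw_rows_def)
  let ?shift = "\<lambda>x :: nat list. last x # butlast x"
  \<comment> \<open>The rows taken in the order \<open>\<psi>\<close>, each with its last letter
    moved to the front. This is a sorted list of the same rows, hence the list of rows itself, and
    comparing entries gives the rotation law.\<close>
  define L where "L = permute_list \<psi> (map ?shift (bw_rows w))"
  have L: "length L = ?N" "\<And>j. j < ?N \<Longrightarrow> L ! j = ?shift (r (\<psi> j))"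
    using w \<psi>_less by (simp_all add: L_def permute_list_def r_def)
  have "mset L = image_mset ?shift (mset (bw_rows w))"
    unfolding L_def using w \<psi>_perm by (subst mset_permute_list) auto
  also have "\<dots> = image_mset ?shift (image_mset rotate1 (mset (bw_rows w)))"
    by (simp only: mset_bw_rows_rotate1)
  also have "\<dots> = image_mset (\<lambda>x. x) (mset (bw_rows w))"
    unfolding image_mset.compositionality
  proof (rule image_mset_cong)
    fix x assume "x \<in># mset (bw_rows w)"
    then have "x \<noteq> []"
      using w N0 by (auto simp: set_bw_rows)
    then show "(?shift \<circ> rotate1) x = x"
      by (cases x) auto
  qed
  finally have mset: "mset L = mset (bw_rows w)"
    by simp
  have "sorted L"
    unfolding sorted_iff_nth_mono
  proof (intro allI impI)
    fix i j assume ij: "i \<le> j" "j < length L"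
    then have ij': "i < ?N" "j < ?N"
      using L(1) by auto
    have "?shift (r (\<psi> i)) \<le> ?shift (r (\<psi> j))"
    proof (cases "i div n = j div n")
      case True
      have "r (\<psi> i) \<le> r (\<psi> j)"
        unfolding r_def using \<psi>_mono[OF ij(1) ij'(2) True] \<psi>_less[OF ij'(2)] w
        by (intro sorted_nth_mono[OF sorted]) auto
      moreover have "r (\<psi> i) \<noteq> []" "r (\<psi> j) \<noteq> []" "length (r (\<psi> i)) = length (r (\<psi> j))"
        using len_r \<psi>_less ij' N0 by fastforce+
      moreover have last: "last (r (\<psi> i)) = last (r (\<psi> j))"
        using last_r \<psi>_less ij' letter_\<psi>(1) True by simp
      ultimately have "butlast (r (\<psi> i)) @ [last (r (\<psi> j))] \<le> butlast (r (\<psi> j)) @ [last (r (\<psi> j))]"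
        using append_butlast_last_id[of "r (\<psi> i)"] append_butlast_last_id[of "r (\<psi> j)"] by simp
      then have "butlast (r (\<psi> i)) \<le> butlast (r (\<psi> j))"
        by (rule snoc_le_snoc_imp[rotated]) (use \<open>length (r (\<psi> i)) = _\<close> in simp)
      then show ?thesis
        using last by simp
    next
      case False
      then have "i div n < j div n"
        using div_le_mono[OF ij(1), of n] by simp
      then show ?thesis
        using last_r \<psi>_less ij' letter_\<psi>(1) by simp
    qed
    then show "L ! i \<le> L ! j"
      using L(2) ij' by simp
  qed
  then have "sort (bw_rows w) = L"
    by (rule properties_for_sort[OF mset])
  then have "bw_rows w = L"
    using sorted by (simp add: sorted_sort_id)
  then have rot: "r (\<psi> i) = rotate1 (r i)" if "i < ?N" for i
  proof -
    have "r i = ?shift (r (\<psi> i))"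
      using L(2)[OF that] \<open>bw_rows w = L\<close> by (simp add: r_def)
    moreover have "r (\<psi> i) \<noteq> []"
      using len_r[OF \<psi>_less[OF that]] N0 by auto
    ultimately show ?thesis
      using rotate1_snoc_inverse by metis
  qed
  then show "i < n * p \<Longrightarrow> bw_rows w ! \<psi> i = rotate1 (bw_rows w ! i)"
    by (simp add: r_def)
  have rots: "r ((\<psi> ^^ k) i) = rotate k (r i)" if "i < ?N" for i k
  proof (induction k)
    case (Suc k)
    then show ?case
      using rot[OF \<psi>_funpow_less[OF that, of k]] by simp
  qed simp
  show "bw_rows w = map row [0..<n * p]"
  proof (rule nth_equalityI)
    fix i assume "i < length (bw_rows w)"
    then have i: "i < ?N"
      using w by simp
    have "r i = row i"
    proof (rule nth_equalityI)
      fix m assume "m < length (r i)"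
      then have m: "m < ?N"
        using len_r[OF i] by simp
      have "letter ((\<psi> ^^ Suc m) i) = last (r ((\<psi> ^^ Suc m) i))"
        using last_r[OF \<psi>_funpow_less[OF i, of "Suc m"]] by simp
      also have "\<dots> = last (rotate (Suc m) (r i))"
        by (simp only: rots[OF i])
      also have "\<dots> = rotate (Suc m) (r i) ! (?N - 1)"
        using len_r[OF i] N0 by (subst last_conv_nth) auto
      also have "\<dots> = r i ! ((Suc m + (?N - 1)) mod ?N)"
        using len_r[OF i] N0 by (subst nth_rotate) auto
      also have "Suc m + (?N - 1) = m + ?N"
        using N0 by simp
      finally show "r i ! m = row i ! m"
        using m by (simp add: row_def)
    qed (simp add: len_r[OF i] row_def)
    then show "bw_rows w ! i = map row [0..<n * p] ! i"
      using i by (simp add: r_def)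
  qed (simp add: w)
qed

text \<open>Rotation identifies rows only as words, so a periodic \<open>w\<close> could hide
  several cycles of \<open>\<psi>\<close>. The first block excludes this: a coincidence of rows can
  be carried to row 0, sortedness then makes rows 0 and 1 equal, and two letters of one block would
  agree.\<close>

lemma transitive_if_bwt:
  assumes w: "length w = n * p" and bwt: "bwt w = block_word p n \<beta>" and i: "i < n * p"
  shows "\<exists>k. (\<psi> ^^ k) 0 = i"
proof -
  let ?N = "n * p"
  define r where "r = (\<lambda>i. bw_rows w ! i)"
  have N0: "?N > 1"
    using p n by (metis less_le_trans mult_le_mono1 nat_mult_1 Suc_leI One_nat_def)
  have rot: "r ((\<psi> ^^ k) i) = rotate k (r i)" if "i < ?N" for i k
  proof (induction k)
    case (Suc k)
    then show ?case
      using bw_rows_eq(2)[OF w bwt \<psi>_funpow_less[OF that, of k]] by (simp add: r_def)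
  qed simp
  have "r 0 \<in> necklace w" "r i \<in> necklace w"
  proof -
    have "r j \<in> set (bw_rows w)" if "j < ?N" for j
      unfolding r_def using that w by (intro nth_mem) simp
    then have *: "r j \<in> necklace w" if "j < ?N" for j
      using that by (force simp: set_bw_rows necklace_def)
    have "0 < ?N"
      using N0 by linarith
    then show "r 0 \<in> necklace w" "r i \<in> necklace w"
      using *[OF i] * by blast+
  qed
  then have "r i \<in> necklace (r 0)"
    using necklace_eq by blast
  then obtain m where "r i = rotate m (r 0)"
    by (auto simp: necklace_def)
  moreover have zero: "0 < ?N"
    using N0 by linarith
  ultimately have m: "r i = r ((\<psi> ^^ m) 0)"
    using rot[OF zero, of m] by simp
  have "permutation \<psi>"
    using \<psi>_perm permutation_permutes by blast
  then obtain l where l: "(\<psi> ^^ l) ((\<psi> ^^ m) 0) = 0"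
    using funpow_orbit_sym[OF _ refl, of \<psi> m 0] by blast
  \<comment> \<open>Row \<open>i\<close> equals row \<open>(\<psi> ^^ m) 0\<close>. Moving both
    along by \<open>l\<close> steps puts the latter at 0 and the former at \<open>b\<close>.\<close>
  define b where "b = (\<psi> ^^ l) i"
  have b: "b < ?N"
    unfolding b_def by (rule \<psi>_funpow_less[OF i])
  have "r b = rotate l (r ((\<psi> ^^ m) 0))"
    using rot[OF i, of l] by (simp add: b_def m)
  also have "\<dots> = r 0"
    using rot[OF \<psi>_funpow_less[OF zero, of m], of l] by (simp add: l)
  finally have rb: "r b = r 0" .
  have "b = 0"
  proof (rule ccontr)
    assume "b \<noteq> 0"
    have sorted: "sorted (bw_rows w)"
      by (simp add: bw_rows_def)
    have "r 0 \<le> r 1" "r 1 \<le> r b"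
      unfolding r_def using N0 w b \<open>b \<noteq> 0\<close> by (auto intro!: sorted_nth_mono[OF sorted])
    then have "r 0 = r 1"
      using rb by simp
    then have "bwt w ! 0 = bwt w ! 1"
      using N0 zero w by (simp add: bwt_def r_def)
    then have "letter 0 = letter 1"
      using N0 zero by (simp add: bwt block_word_letter)
    then have "\<beta> 0 0 = \<beta> 0 1"
      using p by (simp add: letter_def)
    moreover have "\<beta> 0 permutes {..<p}"
      using \<beta> n by (auto simp: block_perms_def PiE_iff)
    ultimately show False
      by (metis injD permutes_inj zero_neq_one)
  qed
  then have "(\<psi> ^^ l) i = (\<psi> ^^ l) ((\<psi> ^^ m) 0)"
    using l by (simp add: b_def)
  moreover have "inj (\<psi> ^^ l)"
    by (rule inj_fn[OF permutes_inj[OF \<psi>_perm]])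
  ultimately have "i = (\<psi> ^^ m) 0"
    by (rule injD[rotated])
  then show ?thesis by blast
qed

text \<open>If \<open>\<psi>\<close> is one cycle of length \<open>n * p\<close>, the rotations of
  \<open>row 0\<close> run through every \<open>row i\<close> exactly once, and
  \<open>row_le\<close> shows that these are sorted by their index.\<close>

lemma bwt_if_transitive:
  assumes trans: "\<And>i. i < n * p \<Longrightarrow> \<exists>k. (\<psi> ^^ k) 0 = i"
  shows "row 0 \<in> words p (n * p)" "bwt (row 0) = block_word p n \<beta>"
proof -
  let ?N = "n * p"
  have N0: "?N > 0" using p n by simp
  have cyc: "(\<psi> ^^ ?N) i = i" if "i < ?N" for i
    using \<psi>_perm trans that by (rule funpow_transitive)
  have len: "length (row i) = ?N" for i
    by (simp add: row_def)
  have rot: "rotate1 (row i) = row (\<psi> i)" if i: "i < ?N" for i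
  proof (rule nth_equalityI)
    fix m assume "m < length (rotate1 (row i))"
    then have m: "m < ?N" by (simp add: len)
    have "rotate1 (row i) ! m = row i ! (Suc m mod ?N)"
      using nth_rotate1[of m "row i"] m by (simp add: len)
    also have "\<dots> = letter ((\<psi> ^^ Suc m) (\<psi> i))"
    proof (cases "Suc m = ?N")
      case True
      \<comment> \<open>Wrap-around: the period \<open>n * p\<close> of \<open>\<psi>\<close> makes
        the letter read after the last one equal to the first.\<close>
      have "row i ! (Suc m mod ?N) = letter (\<psi> i)"
        using True N0 by (simp add: row_def)
      also have "\<psi> i = (\<psi> ^^ Suc m) (\<psi> i)"
        unfolding True using cyc[OF \<psi>_less[OF i]] by simp
      finally show ?thesis .
    next
      case False
      then have "Suc m < ?N" using m by simp
      then show ?thesis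
        by (simp add: row_def funpow_swap1)
    qed
    finally show "rotate1 (row i) ! m = row (\<psi> i) ! m"
      using m by (simp add: row_def)
  qed (simp add: len)
  have rots: "rotate k (row 0) = row ((\<psi> ^^ k) 0)" for k
  proof (induction k)
    case (Suc k)
    then show ?case
      using rot[OF \<psi>_funpow_less[OF N0, of k]] by simp
  qed simp
  define xs where "xs = map (\<lambda>k. (\<psi> ^^ k) 0) [0..<?N]"
  have set_xs: "set xs = {..<?N}"
  proof (intro equalityI subsetI)
    fix i assume "i \<in> {..<?N}"
    then obtain k where k: "(\<psi> ^^ k) 0 = i"
      using trans by blast
    have "(\<psi> ^^ (?N * q)) 0 = 0" for q
      using cyc[OF N0] by (induction q) (simp_all add: funpow_add)
    moreover have "\<psi> ^^ k = \<psi> ^^ (k mod ?N) \<circ> \<psi> ^^ (?N * (k div ?N))"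
      by (simp only: funpow_add[symmetric] mod_mult_div_eq)
    ultimately have "(\<psi> ^^ (k mod ?N)) 0 = i"
      using k by simp
    then show "i \<in> set xs"
      using N0 by (auto simp: xs_def)
  qed (use \<psi>_funpow_less[OF N0] in \<open>auto simp: xs_def\<close>)
  then have "distinct xs"
    by (intro card_distinct) (simp add: xs_def)
  then have "mset xs = mset [0..<?N]"
    by (subst set_eq_iff_mset_eq_distinct[symmetric]) (auto simp: set_xs)
  then have "image_mset row (mset xs) = image_mset row (mset [0..<?N])"
    by simp
  then have mset: "mset (map row [0..<?N]) = mset (map (\<lambda>k. rotate k (row 0)) [0..<?N])"
    by (simp add: xs_def rots image_mset.compositionality o_def)
  have "sorted (map row [0..<?N])"
    unfolding sorted_iff_nth_mono using row_le by (simp add: row_def)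
  then have "bw_rows (row 0) = map row [0..<?N]"
    unfolding bw_rows_def len by (rule properties_for_sort[OF mset])
  moreover have "last (row i) = letter i" if "i < ?N" for i
  proof -
    have "last (row i) = row i ! (?N - 1)"
      using N0 len by (metis last_conv_nth length_greater_0_conv)
    also have "\<dots> = letter ((\<psi> ^^ Suc (?N - 1)) i)"
      using N0 unfolding row_def by (subst nth_map) auto
    also have "Suc (?N - 1) = ?N"
      using N0 by simp
    finally show ?thesis
      by (simp only: cyc[OF that])
  qed
  ultimately show "bwt (row 0) = block_word p n \<beta>"
    by (simp add: bwt_def block_word_letter)
  show "row 0 \<in> words p ?N"
    using letter_less \<psi>_funpow_less[OF N0, of "Suc _"] by (auto simp: words_def row_def)
qed

end

lemma card_image_eq_fibres:
  assumes "\<And>x y. x \<in> W \<Longrightarrow> y \<in> W \<Longrightarrow> f x = f y \<longleftrightarrow> g x = g y"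
  shows "card (f ` W) = card (g ` W)"
proof (rule bij_betw_same_card)
  show "bij_betw (\<lambda>c. g (inv_into W f c)) (f ` W) (g ` W)"
    unfolding bij_betw_def
  proof
    have *: "g (inv_into W f (f x)) = g x" if "x \<in> W" for x
      using assms[of "inv_into W f (f x)" x] that by (simp add: inv_into_into f_inv_into_f)
    show "inj_on (\<lambda>c. g (inv_into W f c)) (f ` W)"
      by (intro inj_onI) (auto simp: * assms)
    show "(\<lambda>c. g (inv_into W f c)) ` f ` W = g ` W"
      by (auto simp: * image_iff)
  qed
qed

text \<open>On these words the transform separates necklaces because it determines all rows. Its
  values are the block words whose standard permutation is a single cycle, and a block word
  determines its family of permutations.\<close>

lemma DBW_eq_card_cyclic_block_maps:
  assumes p: "p > 1" and n: "n > 0"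
  shows "DBW p (n * p) = card {\<beta> \<in> block_perms p n. \<forall>i<n * p. \<exists>k. (block_map p n \<beta> ^^ k) 0 = i}"
proof -
  let ?N = "n * p"
  let ?C = "{\<beta> \<in> block_perms p n. \<forall>i<?N. \<exists>k. (block_map p n \<beta> ^^ k) 0 = i}"
  define W where "W = {w \<in> words p ?N. \<exists>us. (\<forall>u\<in>set us. alphabet_perm p u) \<and> bwt w = concat us}"
  have p0: "p > 0" using p by simp
  have len: "length w = ?N" if "w \<in> words p ?N" for w
    using that by (simp add: words_def)
  have bwt_len: "length (bwt w) = length w" for w :: "nat list"
    by (simp add: bwt_def)
  have W: "w \<in> W \<longleftrightarrow> w \<in> words p ?N \<and> bwt w \<in> block_word p n ` block_perms p n" for w
    unfolding W_def block_word_eq_iff[OF p0 n, symmetric] using len bwt_len by auto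
  have locale_iff: "block_permutation p n \<beta>" if "\<beta> \<in> block_perms p n" for \<beta>
    using p n that by unfold_locales
  have trans_iff: "(\<exists>k. (block_permutation.\<psi> p n \<beta> ^^ k) 0 = i) \<longleftrightarrow> (\<exists>k. (block_map p n \<beta> ^^ k) 0 = i)"
    if "\<beta> \<in> block_perms p n" for \<beta> i
  proof -
    interpret block_permutation p n \<beta>
      by (rule locale_iff[OF that])
    show ?thesis
      unfolding \<psi>_def by (rule funpow_inv_orbit_iff[OF block_map_perm]) simp
  qed
  have eq: "necklace w = necklace w' \<longleftrightarrow> bwt w = bwt w'" if ww: "w \<in> W" "w' \<in> W" for w w'
  proof
    assume "necklace w = necklace w'"
    then show "bwt w = bwt w'"
      using necklace_self by (intro bwt_necklace_cong) blast
  next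
    assume bwt: "bwt w = bwt w'"
    obtain \<beta> where B: "\<beta> \<in> block_perms p n" "bwt w = block_word p n \<beta>"
      using ww(1) W by blast
    interpret block_permutation p n \<beta>
      by (rule locale_iff[OF B(1)])
    have lens: "length w = ?N" "length w' = ?N"
      using ww W len by auto
    have "bw_rows w = bw_rows w'"
      using bw_rows_eq(1)[OF lens(1)] bw_rows_eq(1)[OF lens(2)] B(2) bwt by simp
    moreover have "w \<in> set (bw_rows w)"
      using lens p n by (auto simp: set_bw_rows intro!: image_eqI[of _ _ 0])
    ultimately have "w \<in> necklace w'"
      by (auto simp: set_bw_rows necklace_def)
    then show "necklace w = necklace w'"
      by (rule necklace_eq)
  qed
  have "gen_de_Bruijn_words p ?N = necklace ` W"
    by (auto simp: gen_de_Bruijn_words_def W_def)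
  then have "DBW p ?N = card (necklace ` W)"
    by (simp add: DBW_def)
  also have "\<dots> = card (bwt ` W)"
    by (rule card_image_eq_fibres) (rule eq)
  also have "bwt ` W = block_word p n ` ?C"
  proof (intro equalityI subsetI)
    fix u assume "u \<in> bwt ` W"
    then obtain w \<beta> where w: "w \<in> words p ?N" "u = bwt w" "\<beta> \<in> block_perms p n" "bwt w = block_word p n \<beta>"
      using W by blast
    interpret block_permutation p n \<beta>
      by (rule locale_iff[OF w(3)])
    have "\<beta> \<in> ?C"
      using transitive_if_bwt[OF len[OF w(1)] w(4)] w(3) trans_iff[OF w(3)] by blast
    then show "u \<in> block_word p n ` ?C"
      using w(2,4) by blast
  next
    fix u assume "u \<in> block_word p n ` ?C"
    then obtain \<beta> where C: "\<beta> \<in> ?C" "u = block_word p n \<beta>"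
      by blast
    then have bp: "\<beta> \<in> block_perms p n" by blast
    interpret block_permutation p n \<beta>
      by (rule locale_iff[OF bp])
    have "\<exists>k. (\<psi> ^^ k) 0 = i" if "i < ?N" for i
      using that C(1) trans_iff[OF bp] by blast
    then have "row 0 \<in> words p ?N" "bwt (row 0) = u"
      using bwt_if_transitive C(2) by auto
    then have "row 0 \<in> W"
      unfolding W using C(2) bp by blast
    then show "u \<in> bwt ` W"
      using \<open>bwt (row 0) = u\<close> by blast
  qed
  also have "card \<dots> = card ?C"
    by (intro card_image inj_on_subset[OF inj_on_block_word[OF p0]]) auto
  finally show ?thesis .
qed

theorem theorem25:
  fixes p n :: nat
  assumes "prime p" and "p = CARD('p :: prime_card)" and "n \<ge> 2"
  shows "real (DBW p (p * n)) =
           fact (p - 1) ^ n / real (p - 1) * (real (num_normal TYPE('p) n) / real n) \<and>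
         fact (p - 1) ^ n / real (p - 1) * (real (num_normal TYPE('p) n) / real n) =
           fact (p - 1) ^ n / real (p - 1) * real (InvNeck TYPE('p) n)"
proof -
  have p: "p > 1" and n: "n > 0"
    using assms(1,3) prime_gt_1_nat by auto
  let ?U = "nonvanishing_polys n :: 'p mod_ring poly set"
  have "real (DBW p (p * n)) * real n * real (p - 1) = fact (p - 1) ^ n * real (card ?U)"
    using card_cyclic_block_maps[OF p n] card_nonvanishing_polys[OF n, where 'p = 'p]
    by (simp add: DBW_eq_card_cyclic_block_maps[OF p n] mult.commute[of p] assms(2)[symmetric])
  then have "real (DBW p (p * n)) = fact (p - 1) ^ n / real (p - 1) * (real (card ?U) / real n)"
    using p n by (simp add: field_simps)
  moreover have "real (InvNeck TYPE('p) n) = real (card ?U) / real n"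
  proof -
    have "real n * real (InvNeck TYPE('p) n) = real (card ?U)"
      using InvNeck_eq_card_nonvanishing_polys[OF n, where 'p = 'p] by (metis of_nat_mult)
    then show ?thesis
      using n by (simp add: field_simps)
  qed
  ultimately show ?thesis
    by (simp add: num_normal_eq_card_nonvanishing_polys[OF n])
qed

end
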